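(* Let $a,b,c,d,q\in\mathbb{C}$ with $|q|<1$, let $s\in\mathbb{C}$ be generic, and write $s=q^{-\lambda}$. Let $f(x;s)=x^{-\lambda}\sum_{n\ge0}c_nx^n$, $c_0=1$, be the unique formal series satisfying $Df(x;s)=\big(s+\frac{abcd}{qs}-1-\frac{abcd}{q}\big)f(x;s)$, with $D$ the Askey–Wilson operator. Then $$f(x;s)=x^{-\lambda}\sum_{k,l,m,n\ge0}c_e(k,l;q^{m+n}s)\,c_o(m,n;s)\,x^{2k+2l+m+n},$$ with $c_e,c_o$ as defined in the context.
   Context: Notation: $(a_1,\dots,a_k;q)_n=\prod_{j=1}^k\prod_{i=0}^{n-1}(1-q^ia_j)$. The Askey–Wilson operator is $$D=\frac{(1-ax)(1-bx)(1-cx)(1-dx)}{(1-x^2)(1-qx^2)}(T_{q,x}-1)+\frac{(1-a/x)(1-b/x)(1-c/x)(1-d/x)}{(1-1/x^2)(1-q/x^2)}(T_{q,x}^{-1}-1),$$ $T_{q,x}^{\pm1}g(x)=g(q^{\pm1}x)$, with $T_{q,x}x^{-\lambda+n}=sq^nx^{-\lambda+n}$; the eigenvalue equation and $c_0=1$ determine $f$ uniquely. Define $$c_e(k,l;s)=\frac{(a^2;q^2)_k(q^{4l}s^2;q^2)_k}{(q^2;q^2)_k(q^{4l+2}s^2/a^2;q^2)_k}\Big(\frac{q^2}{a^2}\Big)^k\cdot\frac{(c^2/q;q^2)_l(s^2/a^2;q^2)_l}{(q^2;q^2)_l(q^3s^2/a^2c^2;q^2)_l}\cdot\frac{(s;q)_{2l}(q^2s^2/a^4;q^2)_{2l}}{(qs/a^2;q)_{2l}(s^2/a^2;q^2)_{2l}}\Big(\frac{q^2}{c^2}\Big)^l,$$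 $$c_o(m,n;s)=\frac{(-b/a;q)_m(s;q)_m(qs/cd;q)_m(qs^2/a^2c^2;q)_m}{(q;q)_m(q^2s^2/abcd;q)_m(qs^2/a^2c^2;q^2)_m}\Big(\frac{q}{b}\Big)^m\cdot\frac{(-d/c;q)_n(q^ms;q)_n(qs/ab;q)_n(-q^{m+1}s/ac;q)_n(q^{m+1}s^2/a^2c^2;q)_n}{(q;q)_n(q^{m+2}s^2/abcd;q)_n(-qs/ac;q)_n(q^{2m+1}s^2/a^2c^2;q^2)_n}\Big(\frac{q}{d}\Big)^n.$$ *)

theory Defs
  imports Complex_Main "HOL-Library.Countable_Set"
    "HOL-Computational_Algebra.Formal_Laurent_Series"
begin

definition qpoch :: "complex \<Rightarrow> complex \<Rightarrow> nat \<Rightarrow> complex" where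
  "qpoch x p n = (\<Prod>i<n. 1 - p ^ i * x)"

text \<open>
  A formal series \<open>x\<^sup>-\<^sup>\<lambda> (c\<^sub>0 + c\<^sub>1 x + c\<^sub>2 x\<^sup>2 + \<dots>)\<close> is represented by the power series of its
  coefficients; the factor \<open>x\<^sup>-\<^sup>\<lambda>\<close> is a formal symbol that enters only through
  \<open>T x\<^sup>-\<^sup>\<lambda>\<^sup>+\<^sup>n = s q\<^sup>n x\<^sup>-\<^sup>\<lambda>\<^sup>+\<^sup>n\<close>.  Thus \<open>qshift q s\<close> is \<open>T\<close> and
  \<open>qshift (inverse q) (inverse s)\<close> is its inverse.
\<close>

definition qshift :: "complex \<Rightarrow> complex \<Rightarrow> complex fps \<Rightarrow> complex fps" where
  "qshift q s F = Abs_fps (\<lambda>n. s * q ^ n * fps_nth F n)"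

definition aw_coeff ::
  "complex \<Rightarrow> complex \<Rightarrow> complex \<Rightarrow> complex \<Rightarrow> complex \<Rightarrow> complex fls \<Rightarrow> complex fls" where
  "aw_coeff a b c d q x =
     (1 - fls_const a * x) * (1 - fls_const b * x) * (1 - fls_const c * x) * (1 - fls_const d * x)
     / ((1 - x ^ 2) * (1 - fls_const q * x ^ 2))"

text \<open>
  The rational functions in the operator are expanded at \<open>x = 0\<close>, that is, they are
  evaluated in the field of formal Laurent series, the second one at \<open>1/x\<close>.
\<close>

definition aw_operator ::
  "complex \<Rightarrow> complex \<Rightarrow> complex \<Rightarrow> complex \<Rightarrow> complex \<Rightarrow> complex \<Rightarrow> complex fps \<Rightarrow> complex fls" where
  "aw_operator a b c d q s F =
     aw_coeff a b c d q fls_X * fps_to_fls (qshift q s F - F)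
     + aw_coeff a b c d q fls_X_inv * fps_to_fls (qshift (inverse q) (inverse s) F - F)"

definition aw_eigenseries ::
  "complex \<Rightarrow> complex \<Rightarrow> complex \<Rightarrow> complex \<Rightarrow> complex \<Rightarrow> complex \<Rightarrow> complex fps \<Rightarrow> bool" where
  "aw_eigenseries a b c d q s F \<longleftrightarrow>
     fps_nth F 0 = 1 \<and>
     aw_operator a b c d q s F =
       fls_const (s + a*b*c*d / (q * s) - 1 - a*b*c*d / q) * fps_to_fls F"

definition aw_f ::
  "complex \<Rightarrow> complex \<Rightarrow> complex \<Rightarrow> complex \<Rightarrow> complex \<Rightarrow> complex \<Rightarrow> complex fps" where
  "aw_f a b c d q s = (THE F. aw_eigenseries a b c d q s F)"

definition c_e :: "complex \<Rightarrow> complex \<Rightarrow> complex \<Rightarrow> nat \<Rightarrow> nat \<Rightarrow> complex \<Rightarrow> complex" where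
  "c_e a c q k l s =
     (qpoch (a^2) (q^2) k * qpoch (q^(4*l) * s^2) (q^2) k)
     / (qpoch (q^2) (q^2) k * qpoch (q^(4*l+2) * s^2 / a^2) (q^2) k)
     * (q^2 / a^2) ^ k
     * ((qpoch (c^2 / q) (q^2) l * qpoch (s^2 / a^2) (q^2) l)
        / (qpoch (q^2) (q^2) l * qpoch (q^3 * s^2 / (a^2 * c^2)) (q^2) l))
     * ((qpoch s q (2*l) * qpoch (q^2 * s^2 / a^4) (q^2) (2*l))
        / (qpoch (q * s / a^2) q (2*l) * qpoch (s^2 / a^2) (q^2) (2*l)))
     * (q^2 / c^2) ^ l"

definition c_o ::
  "complex \<Rightarrow> complex \<Rightarrow> complex \<Rightarrow> complex \<Rightarrow> complex \<Rightarrow> nat \<Rightarrow> nat \<Rightarrow> complex \<Rightarrow> complex" where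
  "c_o a b c d q m n s =
     (qpoch (- b / a) q m * qpoch s q m * qpoch (q * s / (c*d)) q m
        * qpoch (q * s^2 / (a^2 * c^2)) q m)
     / (qpoch q q m * qpoch (q^2 * s^2 / (a*b*c*d)) q m * qpoch (q * s^2 / (a^2 * c^2)) (q^2) m)
     * (q / b) ^ m
     * ((qpoch (- d / c) q n * qpoch (q^m * s) q n * qpoch (q * s / (a*b)) q n
          * qpoch (- (q^(m+1) * s) / (a*c)) q n * qpoch (q^(m+1) * s^2 / (a^2 * c^2)) q n)
        / (qpoch q q n * qpoch (q^(m+2) * s^2 / (a*b*c*d)) q n * qpoch (- (q * s) / (a*c)) q n
          * qpoch (q^(2*m+1) * s^2 / (a^2 * c^2)) (q^2) n))
     * (q / d) ^ n"

text \<open>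
  Genericity of \<open>s\<close>: \<open>s \<noteq> 0\<close>, and no \<open>s\<close>-dependent denominator factor vanishes in any
  \<open>c_e k l (q\<^sup>r s)\<close> or \<open>c_o m n s\<close>.  The conditions on \<open>qpoch (q^2 * s^2 / (a*b*c*d)) q m\<close>
  also say \<open>s\<^sup>2 \<noteq> a b c d / q\<^sup>n\<^sup>+\<^sup>1\<close> for \<open>n \<ge> 1\<close>, so that the eigenvalues belonging to \<open>s\<close>
  and \<open>q\<^sup>n s\<close> differ.
\<close>

definition aw_generic ::
  "complex \<Rightarrow> complex \<Rightarrow> complex \<Rightarrow> complex \<Rightarrow> complex \<Rightarrow> complex \<Rightarrow> bool" where
  "aw_generic a b c d q s \<longleftrightarrow>
     s \<noteq> 0 \<and>
     (\<forall>k l r. qpoch (q^(4*l+2) * (q^r * s)^2 / a^2) (q^2) k \<noteq> 0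
        \<and> qpoch (q^3 * (q^r * s)^2 / (a^2 * c^2)) (q^2) l \<noteq> 0
        \<and> qpoch (q * (q^r * s) / a^2) q (2*l) \<noteq> 0
        \<and> qpoch ((q^r * s)^2 / a^2) (q^2) (2*l) \<noteq> 0) \<and>
     (\<forall>m n. qpoch (q^2 * s^2 / (a*b*c*d)) q m \<noteq> 0
        \<and> qpoch (q * s^2 / (a^2 * c^2)) (q^2) m \<noteq> 0
        \<and> qpoch (q^(m+2) * s^2 / (a*b*c*d)) q n \<noteq> 0
        \<and> qpoch (- (q * s) / (a*c)) q n \<noteq> 0
        \<and> qpoch (q^(2*m+1) * s^2 / (a^2 * c^2)) (q^2) n \<noteq> 0)"

lemma countable_qpoch_zeros:
  assumes "\<And>s. X s = C * s ^ j" and "j > 0"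
  shows "countable {s. qpoch (X s) p n = 0}"
proof -
  have "{s. qpoch (X s) p n = 0} \<subseteq> (\<Union>i<n. {s. s ^ j = inverse (p ^ i * C)})"
  proof
    fix s assume "s \<in> {s. qpoch (X s) p n = 0}"
    then obtain i where "i < n" and e: "p ^ i * C * s ^ j = 1"
      by (auto simp: qpoch_def assms(1) mult.assoc)
    from e have "s ^ j = inverse (p ^ i * C)" by (metis inverse_unique)
    with \<open>i < n\<close> show "s \<in> (\<Union>i<n. {s. s ^ j = inverse (p ^ i * C)})" by blast
  qed
  moreover have "countable (\<Union>i<n. {s::complex. s ^ j = inverse (p ^ i * C)})"
    using assms(2) by (intro countable_UN countable_finite finite_nth_roots) auto
  ultimately show ?thesis by (rule countable_subset)
qed

lemma countable_not_aw_generic: "countable {s. \<not> aw_generic a b c d q s}"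
proof -
  let ?E = "\<lambda>k l r. {s. qpoch (q^(4*l+2) * (q^r * s)^2 / a^2) (q^2) k = 0}
     \<union> {s. qpoch (q^3 * (q^r * s)^2 / (a^2 * c^2)) (q^2) l = 0}
     \<union> {s. qpoch (q * (q^r * s) / a^2) q (2*l) = 0}
     \<union> {s. qpoch ((q^r * s)^2 / a^2) (q^2) (2*l) = 0}"
  let ?O = "\<lambda>m n. {s. qpoch (q^2 * s^2 / (a*b*c*d)) q m = 0}
     \<union> {s. qpoch (q * s^2 / (a^2 * c^2)) (q^2) m = 0}
     \<union> {s. qpoch (q^(m+2) * s^2 / (a*b*c*d)) q n = 0}
     \<union> {s. qpoch (- (q * s) / (a*c)) q n = 0}
     \<union> {s. qpoch (q^(2*m+1) * s^2 / (a^2 * c^2)) (q^2) n = 0}"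
  have "countable (?E k l r)" for k l r
    by (intro countable_Un
        countable_qpoch_zeros[where C = "q^(4*l+2) * (q^r)^2 / a^2" and j = 2]
        countable_qpoch_zeros[where C = "q^3 * (q^r)^2 / (a^2 * c^2)" and j = 2]
        countable_qpoch_zeros[where C = "q * q^r / a^2" and j = 1]
        countable_qpoch_zeros[where C = "(q^r)^2 / a^2" and j = 2])
      (simp_all add: power_mult_distrib)
  moreover have "countable (?O m n)" for m n
    by (intro countable_Un
        countable_qpoch_zeros[where C = "q^2 / (a*b*c*d)" and j = 2]
        countable_qpoch_zeros[where C = "q / (a^2 * c^2)" and j = 2]
        countable_qpoch_zeros[where C = "q^(m+2) / (a*b*c*d)" and j = 2]
        countable_qpoch_zeros[where C = "- q / (a*c)" and j = 1]
        countable_qpoch_zeros[where C = "q^(2*m+1) / (a^2 * c^2)" and j = 2])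
      simp_all
  ultimately have "countable ({0} \<union> (\<Union>k l r. ?E k l r) \<union> (\<Union>m n. ?O m n))"
    by (intro countable_Un countable_UN) auto
  moreover have "{s. \<not> aw_generic a b c d q s}
      \<subseteq> {0} \<union> (\<Union>k l r. ?E k l r) \<union> (\<Union>m n. ?O m n)"
    unfolding aw_generic_def by blast
  ultimately show ?thesis by (rule countable_subset[rotated])
qed

end

theory Submission
  imports Defs "HOL-Analysis.Continuum_Not_Denumerable"
begin

text \<open>
  Every Askey--Wilson operator whose first parameter is \<open>a\<close> is bidiagonal in the functions
  \<open>\<phi>\<^sub>\<sigma> = (ax, q\<sigma>x/a; q)\<^sub>\<infinity> / (ax/\<sigma>, qx/a; q)\<^sub>\<infinity>\<close>, so its eigenfunctions have explicit coefficients in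
  them as soon as a first-order recurrence is verified.  For the parameters \<open>(a, -a, c, -c)\<close> the
  eigenfunction is a power series in \<open>x\<^sup>2\<close>: it is expanded in the elementary functions belonging to
  \<open>(a, -a, q\<^sup>1\<^sup>/\<^sup>2, -q\<^sup>1\<^sup>/\<^sup>2)\<close>, with coefficients found by telescoping, and this is the part
  \<open>c\<^sub>e\<close>.  For \<open>(a, b, c, d)\<close> one expands in the even eigenfunctions with \<open>s\<close> replaced by \<open>q\<^sup>N s\<close>;
  the coefficients \<open>\<Sum>\<^sub>m\<^sub>+\<^sub>n\<^sub>=\<^sub>N c\<^sub>o(m, n; s)\<close> come from a product of two \<open>\<^sub>2\<phi>\<^sub>1\<close> series and, up to a factor, are
  Askey--Wilson polynomials in \<open>b + d\<close>.  Their three-term recurrence turns into the first-order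
  recurrence of the expansion in \<open>\<phi>\<close>.  This needs more non-vanishing than genericity provides;
  it holds off a countable set of \<open>s\<close>, and the coefficients are continuous in \<open>s\<close>.
\<close>

text \<open>The even functions can mediate because \<open>(a, b, c, d)\<close> and
  \<open>(a, -a, c, -c)\<close> share the parameter \<open>a\<close>: both operators are bidiagonal
  in the same functions, so the expansions compose. The obstacle is that the coefficients in the
  even functions obey a three-term recurrence, while the composed coefficients must obey a
  first-order one. The link is \<open>b + d\<close>. For fixed \<open>b*d\<close> it is the spectral
  variable of the three-term recurrence, and it enters the off-diagonal entry of the bidiagonal
  operator linearly. Eliminating it with the recurrence and reindexing leaves, for each coefficient
  separately, a rational identity without \<open>b + d\<close>. The parameters q^(1/2) and -q^(1/2)
  give elementary functions because they cancel a factor of each denominator, which leaves a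
  two-term recursion in x^2. For another \<open>c\<close> the operator produces an additional
  residual; it has no constant term and passes to \<open>q^2 * s\<close> with one more factor x^2,
  which is what telescopes. Uniqueness of the eigenfunction also replaces a series transformation:
  the two expansions of an even eigenfunction agree because they solve the same equation.\<close>

section \<open>q-shifted factorials\<close>

lemma qpoch_0 [simp]: "qpoch x p 0 = 1"
  by (simp add: qpoch_def)

lemma qpoch_Suc: "qpoch x p (Suc n) = qpoch x p n * (1 - p ^ n * x)"
  by (simp add: qpoch_def)

lemma qpoch_Suc_shift: "qpoch x p (Suc n) = (1 - x) * qpoch (p * x) p n"
  unfolding qpoch_def by (subst prod.lessThan_Suc_shift) (simp add: mult_ac)

lemma qpoch_add: "qpoch x p (m + n) = qpoch x p m * qpoch (p ^ m * x) p n"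
  by (induction n) (simp_all add: qpoch_Suc power_add mult_ac)

lemma qpoch_neq_0_iff: "qpoch x p n \<noteq> 0 \<longleftrightarrow> (\<forall>i<n. p ^ i * x \<noteq> 1)"
  by (auto simp: qpoch_def)

section \<open>Shifts and second-order q-difference operators on formal series\<close>

lemma fps_nth_qshift [simp]: "qshift q s F $ n = s * q ^ n * F $ n"
  by (simp add: qshift_def)

lemma qshift_add: "qshift q s (F + G) = qshift q s F + qshift q s G"
  by (rule fps_ext) (simp add: algebra_simps)

lemma qshift_diff: "qshift q s (F - G) = qshift q s F - qshift q s G"
  by (rule fps_ext) (simp add: algebra_simps)

lemma qshift_const_mult: "qshift q s (fps_const c * F) = fps_const c * qshift q s F"
  by (rule fps_ext) simp

lemma qshift_X_power_mult: "qshift q s (fps_X ^ k * F) = fps_X ^ k * qshift q (q ^ k * s) F"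
  by (rule fps_ext) (auto simp: fps_X_power_mult_nth power_add[symmetric] mult.assoc)

text \<open>The formal prefactors of the two series multiply, and so do their parameters; a factor
  with parameter 1 is an ordinary power series.\<close>

lemma qshift_mult: "qshift q (s * t) (F * G) = qshift q s F * qshift q t G"
  by (rule fps_ext)
     (auto simp: fps_mult_nth sum_distrib_left power_add[symmetric] mult_ac intro!: sum.cong)

text \<open>\<open>D\<close> takes the eigenvalue times the common denominator, so that an
  eigenvalue equation becomes membership in a kernel and all coefficients are power series.\<close>

definition qop :: "complex fps \<Rightarrow> complex fps \<Rightarrow> complex fps \<Rightarrow> complex \<Rightarrow> complex \<Rightarrow> complex fps \<Rightarrow> complex fps"
  where "qop A B D q s F =
    A * (qshift q s F - F) + B * (qshift (inverse q) (inverse s) F - F) - D * F"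

lemma qop_add: "qop A B D q s (F + G) = qop A B D q s F + qop A B D q s G"
  by (simp add: qop_def qshift_add algebra_simps)

lemma qop_diff: "qop A B D q s (F - G) = qop A B D q s F - qop A B D q s G"
  by (simp add: qop_def qshift_diff algebra_simps)

lemma qop_const_mult: "qop A B D q s (fps_const c * F) = fps_const c * qop A B D q s F"
  unfolding qop_def qshift_const_mult by algebra

text \<open>A power of \<open>fps_X\<close> can be moved into the formal prefactor, which turns
  \<open>s\<close> into \<open>q ^ k * s\<close>. This brings functions belonging to different
  \<open>q ^ k * s\<close> under one operator.\<close>

lemma qop_X_power_mult:
  "qop A B D q s (fps_X ^ k * F) = fps_X ^ k * qop A B D q (q ^ k * s) F"
  unfolding qop_def qshift_X_power_mult inverse_mult_distrib power_inverse [symmetric]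
  by (simp add: ring_distribs mult.left_commute)

lemma qop_nth:
  "qop A B D q s F $ n =
    (\<Sum>i\<le>n. (A $ (n-i) * (s * q ^ i - 1) + B $ (n-i) * (inverse s * inverse q ^ i - 1) - D $ (n-i)) * F $ i)"
proof -
  have c: "(P * G) $ n = (\<Sum>i\<le>n. P $ (n-i) * G $ i)" for P G :: "complex fps"
    by (subst mult.commute) (simp add: fps_mult_nth atLeast0AtMost mult.commute)
  show ?thesis
    by (simp add: qop_def c sum.distrib[symmetric] sum_subtractf[symmetric] algebra_simps)
qed

text \<open>Lets an infinite expansion be replaced by a partial sum in each coefficient, so that no
  convergence of series of series is needed.\<close>

lemma qop_nth_cong:
  assumes "\<And>i. i \<le> n \<Longrightarrow> F $ i = G $ i"
  shows "qop A B D q s F $ n = qop A B D q s G $ n"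
  using assms by (simp add: qop_nth)

text \<open>The operator is triangular on coefficients. The last assumption says that its diagonal
  entries after the zeroth do not vanish, so the coefficients are determined recursively.\<close>

lemma qop_kernel_trivial:
  assumes "qop A B D q s F = 0" and "F $ 0 = 0"
    and "\<And>n. n > 0 \<Longrightarrow> A $ 0 * (s * q ^ n - 1) + B $ 0 * (inverse s * inverse q ^ n - 1) - D $ 0 \<noteq> 0"
  shows "F = 0"
proof -
  have "F $ n = 0" for n
  proof (induction n rule: less_induct)
    case (less n)
    show ?case
    proof (cases "n = 0")
      case False
      have "0 = qop A B D q s F $ n" using assms(1) by simp
      also have "\<dots> = (\<Sum>i\<in>{n}. (A $ (n-i) * (s * q ^ i - 1) + B $ (n-i) * (inverse s * inverse q ^ i - 1) - D $ (n-i)) * F $ i)"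
        unfolding qop_nth using less by (intro sum.mono_neutral_right) auto
      finally show ?thesis using assms(3)[of n] False by simp
    qed (use assms(2) in simp)
  qed
  then show ?thesis by (intro fps_ext) simp
qed

section \<open>The eigenvalue equation with cleared denominators\<close>

definition aw_num :: "complex \<Rightarrow> complex \<Rightarrow> complex \<Rightarrow> complex \<Rightarrow> complex \<Rightarrow> complex fps" where
  "aw_num a b c d q = (1 - fps_const a * fps_X) * (1 - fps_const b * fps_X) *
     (1 - fps_const c * fps_X) * (1 - fps_const d * fps_X) * (fps_const q - fps_X ^ 2)"

definition aw_num' :: "complex \<Rightarrow> complex \<Rightarrow> complex \<Rightarrow> complex \<Rightarrow> complex \<Rightarrow> complex fps" where
  "aw_num' a b c d q = (fps_X - fps_const a) * (fps_X - fps_const b) *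
     (fps_X - fps_const c) * (fps_X - fps_const d) * (1 - fps_const q * fps_X ^ 2)"

definition aw_den :: "complex \<Rightarrow> complex fps" where
  "aw_den q = (1 - fps_X ^ 2) * (1 - fps_const q * fps_X ^ 2) * (fps_const q - fps_X ^ 2)"

text \<open>\<open>P\<close> is the product of the four parameters. The value is invariant under
  exchanging \<open>s\<close> with \<open>P / (q * s)\<close>, so for \<open>n > 0\<close> the
  values at \<open>s\<close> and \<open>q ^ n * s\<close> agree only if
  \<open>q ^ (n+1) * s^2 = P\<close>.\<close>

definition aw_eval :: "complex \<Rightarrow> complex \<Rightarrow> complex \<Rightarrow> complex" where
  "aw_eval P q s = s + P / (q * s) - 1 - P / q"

definition aw_cleared ::
  "complex \<Rightarrow> complex \<Rightarrow> complex \<Rightarrow> complex \<Rightarrow> complex \<Rightarrow> complex \<Rightarrow> complex fps \<Rightarrow> complex fps" where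
  "aw_cleared a b c d q s =
     qop (aw_num a b c d q) (aw_num' a b c d q) (fps_const (aw_eval (a*b*c*d) q s) * aw_den q) q s"

text \<open>The numerator and the denominator at \<open>1/x\<close> both carry the factor
  \<open>1/x^4\<close>; cancelling it leaves no negative powers of \<open>x\<close>.\<close>

lemma aw_coeff_inverse:
  assumes "x \<noteq> 0" "1 - x ^ 2 \<noteq> 0" "fls_const q - x ^ 2 \<noteq> 0"
  shows "aw_coeff a b c d q (inverse x) =
    (x - fls_const a) * (x - fls_const b) * (x - fls_const c) * (x - fls_const d)
    / ((1 - x ^ 2) * (fls_const q - x ^ 2))"
proof -
  have f: "1 - e * inverse x = (x - e) / x" for e
    using assms(1) by (simp add: field_simps)
  have g: "1 - e * inverse x ^ 2 = - (e - x ^ 2) / x ^ 2" for e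
    using assms(1) by (simp add: field_simps)
  have h: "A / x * (B / x) * (C / x) * (D / x) / ((- u / x ^ 2) * (- v / x ^ 2)) = A * B * C * D / (u * v)"
    for A B C D u v
    using assms(1) by (simp add: power2_eq_square)
  show ?thesis
    unfolding aw_coeff_def f g g[of 1, unfolded mult_1] h by (simp add: mult_ac)
qed

text \<open>The three factors of \<open>aw_den\<close> have constant terms 1, 1 and
  \<open>q\<close>, hence are nonzero in the field of Laurent series, and multiplying by them is an
  equivalence.\<close>

lemma aw_eigenseries_iff:
  assumes "q \<noteq> 0"
  shows "aw_eigenseries a b c d q s F \<longleftrightarrow> F $ 0 = 1 \<and> aw_cleared a b c d q s F = 0"
proof -
  let ?x = "fls_X :: complex fls" and ?c = "fls_const :: complex \<Rightarrow> complex fls"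
  let ?n = "fps_to_fls ((1 - fps_const a * fps_X) * (1 - fps_const b * fps_X) *
     (1 - fps_const c * fps_X) * (1 - fps_const d * fps_X))"
  let ?n' = "fps_to_fls ((fps_X - fps_const a) * (fps_X - fps_const b) *
     (fps_X - fps_const c) * (fps_X - fps_const d))"
  let ?d1 = "fps_to_fls (1 - fps_X ^ 2 :: complex fps)"
  let ?d2 = "fps_to_fls (1 - fps_const q * fps_X ^ 2)"
  let ?d3 = "fps_to_fls (fps_const q - fps_X ^ 2)"
  let ?U = "fps_to_fls (qshift q s F - F)"
  let ?V = "fps_to_fls (qshift (inverse q) (inverse s) F - F)"
  let ?E = "?c (aw_eval (a*b*c*d) q s)"
  have nz: "?d1 \<noteq> 0" "?d2 \<noteq> 0" "?d3 \<noteq> 0"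
  proof -
    have "(1 - fps_X ^ 2 :: complex fps) $ 0 \<noteq> 0" "(1 - fps_const q * fps_X ^ 2) $ 0 \<noteq> 0"
      "(fps_const q - fps_X ^ 2) $ 0 \<noteq> 0"
      using assms by (simp_all add: fps_X_power_nth)
    then show "?d1 \<noteq> 0" "?d2 \<noteq> 0" "?d3 \<noteq> 0"
      by (metis fps_to_fls_eq_0_iff fps_zero_nth)+
  qed
  note conv = fls_times_fps_to_fls fps_to_fls_power
  have 1: "aw_coeff a b c d q ?x = ?n / (?d1 * ?d2)"
    by (simp add: aw_coeff_def conv)
  have 2: "aw_coeff a b c d q fls_X_inv = ?n' / (?d1 * ?d3)"
    using aw_coeff_inverse[of ?x q a b c d] nz by (simp add: conv fls_inverse_X)
  have "aw_operator a b c d q s F = ?E * fps_to_fls F \<longleftrightarrow>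
    ?n / (?d1 * ?d2) * ?U + ?n' / (?d1 * ?d3) * ?V = ?E * fps_to_fls F"
    by (simp add: aw_operator_def 1 2)
  also have "\<dots> \<longleftrightarrow> ?n * ?d3 * ?U + ?n' * ?d2 * ?V - ?E * (?d1 * ?d2 * ?d3) * fps_to_fls F = 0"
  proof -
    have "(n / (d1 * d2) * u + n' / (d1 * d3) * v = e) \<longleftrightarrow> n * d3 * u + n' * d2 * v - e * (d1 * d2 * d3) = 0"
      if "d1 \<noteq> 0" "d2 \<noteq> 0" "d3 \<noteq> 0" for n d1 d2 u n' d3 v e :: "complex fls"
      using that by (simp add: field_simps)
    from this[OF nz] show ?thesis by (simp add: mult_ac)
  qed
  also have "\<dots> \<longleftrightarrow> fps_to_fls (aw_cleared a b c d q s F) = 0"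
    by (simp add: aw_cleared_def qop_def aw_num_def aw_num'_def aw_den_def conv fps_const_to_fls [symmetric] mult_ac del: fps_const_to_fls fps_to_fls_eq_0_iff)
  finally show ?thesis
    unfolding aw_eigenseries_def aw_eval_def[symmetric] by simp
qed

lemma power_neq_1:
  fixes q :: complex
  assumes "norm q < 1" "n > 0"
  shows "q ^ n \<noteq> 1"
proof
  assume "q ^ n = 1"
  then have "norm q ^ n = 1" by (metis norm_one norm_power)
  moreover have "norm q ^ n < 1" using assms by (simp add: power_less_one_iff)
  ultimately show False by simp
qed

lemma qpoch_self_neq_0:
  assumes "norm q < 1"
  shows "qpoch q q n \<noteq> 0"
  using power_neq_1[OF assms, of "Suc _"] by (simp add: qpoch_neq_0_iff power_Suc2 del: power_Suc)

section \<open>The even eigenfunctions\<close>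

text \<open>Coefficients of 2phi1(\<alpha>, s^2; q^2 s^2/\<alpha>; q^2, q^2 y/\<alpha>) with y = x^2
  and \<alpha> = a^2: the Rogers (continuous q-ultraspherical) case, with parameters a, -a, q^(1/2),
  -q^(1/2).\<close>

definition rogers_coeff :: "complex \<Rightarrow> complex \<Rightarrow> complex \<Rightarrow> nat \<Rightarrow> complex" where
  "rogers_coeff \<alpha> q s k = qpoch \<alpha> (q\<^sup>2) k * qpoch (s\<^sup>2) (q\<^sup>2) k
     / (qpoch (q\<^sup>2) (q\<^sup>2) k * qpoch (q\<^sup>2 * s\<^sup>2 / \<alpha>) (q\<^sup>2) k) * (q\<^sup>2 / \<alpha>) ^ k"

definition rogers :: "complex \<Rightarrow> complex \<Rightarrow> complex \<Rightarrow> complex fps" where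
  "rogers \<alpha> q s = Abs_fps (rogers_coeff \<alpha> q s)"

lemma rogers_coeff_0 [simp]: "rogers_coeff \<alpha> q s 0 = 1"
  by (simp add: rogers_coeff_def)

lemma rogers_coeff_Suc:
  "rogers_coeff \<alpha> q s (Suc m) = rogers_coeff \<alpha> q s m *
     (q\<^sup>2 / \<alpha> * (1 - (q\<^sup>2)^m * \<alpha>) * (1 - (q\<^sup>2)^m * s\<^sup>2))
     / ((1 - (q\<^sup>2)^m * q\<^sup>2) * (1 - (q\<^sup>2)^m * (q\<^sup>2 * s\<^sup>2 / \<alpha>)))"
  by (simp add: rogers_coeff_def qpoch_Suc divide_inverse mult_ac)

context
  fixes \<alpha> q s :: complex
  assumes q: "q \<noteq> 0" "norm q < 1" and \<alpha>: "\<alpha> \<noteq> 0" and s: "s \<noteq> 0"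
    and gen: "\<And>j. q^j * s\<^sup>2 \<noteq> \<alpha>" and gen1: "\<And>j. q^j * s\<^sup>2 \<noteq> 1"
begin

text \<open>For these parameters the factors 1 - q x^2 and 1 - q/x^2 cancel, so in y = x^2 the
  cleared equation has coefficients of degree one. It is then a two-term recurrence, solved by a
  product.\<close>

lemma rogers_eigen:
  "(1 - fps_const \<alpha> * fps_X) * (qshift (q\<^sup>2) s (rogers \<alpha> q s) - rogers \<alpha> q s)
   - (fps_X - fps_const \<alpha>) * (qshift (inverse (q\<^sup>2)) (inverse s) (rogers \<alpha> q s) - rogers \<alpha> q s)
   = fps_const (s + \<alpha> / s - 1 - \<alpha>) * (1 - fps_X) * rogers \<alpha> q s"
  (is "?L = ?R")
proof (rule fps_ext)
  fix n
  let ?r = "rogers_coeff \<alpha> q s"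
  have exp: "(1 - fps_const x * fps_X) * F = F - fps_const x * (fps_X * F)"
    "(fps_X - fps_const x) * F = fps_X * F - fps_const x * F"
    "fps_const y * (1 - fps_X) * F = fps_const y * F - fps_const y * (fps_X * F)"
    for x y :: complex and F :: "complex fps"
    by (simp_all add: algebra_simps)
  show "?L $ n = ?R $ n"
  proof (cases n)
    case 0
    then show ?thesis
      using s by (simp add: exp rogers_def field_simps)
  next
    case (Suc m)
    define J where "J = (q\<^sup>2)^m"
    have J: "J \<noteq> 0" "q^(2*m+2) = J * q\<^sup>2"
      using q by (simp add: J_def, simp only: J_def power_mult power_add)
    have nz: "1 - J * q\<^sup>2 \<noteq> 0" "\<alpha> - J * (q\<^sup>2 * s\<^sup>2) \<noteq> 0"
      using power_neq_1[OF q(2), of "2*m+2"] gen[of "2*m+2"] unfolding J by (auto simp: mult.assoc)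
    have e: "1 - J * (q\<^sup>2 * s\<^sup>2 / \<alpha>) = (\<alpha> - J * (q\<^sup>2 * s\<^sup>2)) / \<alpha>"
      using \<alpha> by (simp add: field_simps)
    have r: "?r (Suc m) = ?r m * (q\<^sup>2 * ((1 - J * \<alpha>) * (1 - J * s\<^sup>2))) / ((1 - J * q\<^sup>2) * (\<alpha> - J * (q\<^sup>2 * s\<^sup>2)))"
      unfolding rogers_coeff_Suc J_def[symmetric] e using \<alpha> by simp
    \<comment> \<open>\<open>A\<close> and \<open>B\<close> will be the diagonal and subdiagonal
      entries of the operator; they factor into exactly the denominator and numerator of the ratio
      in \<open>r\<close>.\<close>
    have c: "A * (x * (q\<^sup>2 * N) / D) + B * x = 0"
      if "A * (s * q\<^sup>2 * J) = D" "B * (s * J) = - N" "D \<noteq> 0" for A B D N x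
    proof -
      have "A = D / (s * q\<^sup>2 * J)" "B = - N / (s * J)"
        using that J(1) s q(1) by (simp_all add: field_simps)
      then show ?thesis using that(3) J(1) s q(1) by simp
    qed
    have "?L $ n - ?R $ n =
      ((s * (J * q\<^sup>2) - 1) + \<alpha> * (inverse s * inverse (J * q\<^sup>2) - 1) - (s + \<alpha> / s - 1 - \<alpha>)) * ?r (Suc m)
      + (- \<alpha> * (s * J - 1) - (inverse s * inverse J - 1) + (s + \<alpha> / s - 1 - \<alpha>)) * ?r m"
      by (simp add: exp Suc rogers_def J_def power_inverse[symmetric] algebra_simps)
    also have "\<dots> = 0"
      unfolding r
    proof (rule c)
      show "(1 - J * q\<^sup>2) * (\<alpha> - J * (q\<^sup>2 * s\<^sup>2)) \<noteq> 0" using nz by simp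
    qed (use s q(1) J(1) in \<open>simp_all add: field_simps power2_eq_square\<close>)
    finally show ?thesis by simp
  qed
qed

end

text \<open>
  The three identities below are the coefficients of \<open>x\<^sup>n\<close> in \<open>rogers_residual_step\<close> for \<open>n \<ge> 3\<close>, \<open>n = 2\<close>
  and \<open>n = 1\<close>, with \<open>\<theta> = s/\<alpha>\<close> and \<open>J = q\<^sup>2\<^sup>n\<^sup>-\<^sup>6\<close>; all common denominators are absorbed in \<open>U\<close>.
\<close>

lemma rogers_residual_identity_3:
  fixes q s \<theta> J U :: complex
  defines "o' \<equiv> \<lambda>K. 1 - K*J" and "g \<equiv> \<lambda>K. 1 - s*\<theta>*K*J" and "t \<equiv> \<lambda>K. 1 - s^2*K*J"
    and "n \<equiv> \<lambda>K. q^2*(\<theta> - s*K*J)*(1 - s^2*K*J)"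
  assumes "r1 = U*(s^2*n 1*o' (q^4)*g (q^4)*o' (q^6)*g (q^6)*g (q^8))"
    and "r2 = U*(s*n 1*n (q^2)*o' (q^6)*g (q^6)*g (q^8))"
    and "r3 = U*(n 1*n (q^2)*n (q^4)*g (q^8))"
    and "R0 = U*(s^3*o' (q^2)*o' (q^4)*o' (q^6)*g (q^6)*g (q^8)*t 1*t (q^2))"
    and "R1 = U*(s^2*n 1*o' (q^4)*o' (q^6)*g (q^8)*t (q^2)*t (q^4))"
    and "R2 = U*(s*n 1*n (q^2)*o' (q^6)*t (q^4)*t (q^6))"
  shows "q^3*((1+s)*(1+q*s))*(q*((s*(q^6*J)-1)*r3*\<theta>+(\<theta>-s)*(s*(q^4*J)-1)*r2-s*(s*(q^2*J)-1)*r1)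
      +(1-s)*(q*\<theta>*r3-(q^2*\<theta>+1)*r2+q*r1))
    = q^2*((1+q*\<theta>)*(1+q^2*\<theta>))*(q^3*((s*(q^6*J)-1)*R2*\<theta>+(\<theta>-s)*(s*(q^4*J)-1)*R1-s*(s*(q^2*J)-1)*R0)
      +(1-q^2*s)*(q^3*\<theta>*R2-(q^4*\<theta>+1)*R1+q*R0))
      - ((1+q*\<theta>)*(1+q^2*\<theta>))*(1-q^4*s*\<theta>)*(q*R2-(1+q^2)*R1+q*R0)*q^2"
  unfolding assms(5-) unfolding assms(1-4) by algebra

lemma rogers_residual_identity_2:
  fixes q s \<theta> U :: complex
  defines "o' \<equiv> \<lambda>K. 1 - K" and "g \<equiv> \<lambda>K. 1 - s*\<theta>*K" and "t \<equiv> \<lambda>K. 1 - s^2*K"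
    and "n \<equiv> \<lambda>K. q^2*(\<theta> - s*K)*(1 - s^2*K)"
  assumes "r1 = U*(s^2*o' (q^2)*g (q^2)*o' (q^4)*g (q^4)*g (q^6))"
    and "r2 = U*(s*n 1*o' (q^4)*g (q^4)*g (q^6))"
    and "r3 = U*(n 1*n (q^2)*g (q^6))"
    and "R1 = U*(s^2*o' (q^2)*o' (q^4)*g (q^6)*t 1*t (q^2))"
    and "R2 = U*(s*n 1*o' (q^4)*t (q^2)*t (q^4))"
  shows "q^3*((1+s)*(1+q*s))*(q*((s*q^4-1)*r3*\<theta>+(\<theta>-s)*(s*q^2-1)*r2-s*(s-1)*r1)
      +(1-s)*(q*\<theta>*r3-(q^2*\<theta>+1)*r2+q*r1))
    = q^2*((1+q*\<theta>)*(1+q^2*\<theta>))*(q^3*((s*q^4-1)*R2*\<theta>+(\<theta>-s)*(s*q^2-1)*R1)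
      +(1-q^2*s)*(q^3*\<theta>*R2-(q^4*\<theta>+1)*R1))
      - ((1+q*\<theta>)*(1+q^2*\<theta>))*(1-q^4*s*\<theta>)*(q*R2-(1+q^2)*R1)*q^2"
  unfolding assms(5-) unfolding assms(1-4) by algebra

lemma rogers_residual_identity_1:
  fixes q s \<theta> U :: complex
  defines "o' \<equiv> \<lambda>K. 1 - K" and "g \<equiv> \<lambda>K. 1 - s*\<theta>*K" and "t \<equiv> \<lambda>K. 1 - s^2*K"
    and "n \<equiv> \<lambda>K. q^2*(\<theta> - s*K)*(1 - s^2*K)"
  assumes "r2 = U*(s*o' (q^2)*g (q^2)*g (q^4))"
    and "r3 = U*(n 1*g (q^4))"
    and "R2 = U*(s*o' (q^2)*t 1*t (q^2))"
  shows "q^3*((1+s)*(1+q*s))*(q*((s*q^2-1)*r3*\<theta>+(\<theta>-s)*(s-1)*r2)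
      +(1-s)*(q*\<theta>*r3-(q^2*\<theta>+1)*r2))
    = q^2*((1+q*\<theta>)*(1+q^2*\<theta>))*(q^3*((s*q^2-1)*R2*\<theta>)
      +(1-q^2*s)*(q^3*\<theta>*R2))
      - ((1+q*\<theta>)*(1+q^2*\<theta>))*(1-q^4*s*\<theta>)*(q*R2)*q^2"
  unfolding assms(5-) unfolding assms(1-4) by algebra

text \<open>In base \<open>q^2\<close>, the step from \<open>s\<close> to \<open>q^2 * s\<close>
  moves the arguments of two factorials by two places each, so only boundary factors survive. The
  last fraction does not depend on \<open>m\<close>.\<close>

lemma rogers_coeff_shift:
  assumes "q \<noteq> 0" and "\<alpha> \<noteq> 0" and gen: "\<And>j. q^j * s\<^sup>2 \<noteq> \<alpha>" and gen1: "\<And>j. q^j * s\<^sup>2 \<noteq> 1"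
  shows "rogers_coeff \<alpha> q (q\<^sup>2 * s) m = rogers_coeff \<alpha> q s m
     * ((1 - s\<^sup>2*q^(2*m)) * (1 - s\<^sup>2*(q^2*q^(2*m))) / ((1 - s*(s/\<alpha>)*(q^2*q^(2*m))) * (1 - s*(s/\<alpha>)*(q^4*q^(2*m)))))
     * ((1 - s*(s/\<alpha>)*q^2) * (1 - s*(s/\<alpha>)*q^4) / ((1 - s\<^sup>2) * (1 - s\<^sup>2*q^2)))"
proof -
  \<comment> \<open>Both sides are \<open>qpoch x p (m + 2)\<close>, with two factors split off at
    the lower or at the upper end.\<close>
  have key: "qpoch (p\<^sup>2 * x) p m * ((1 - x) * (1 - p * x)) = qpoch x p m * ((1 - p^m*x) * (1 - p*p^m*x))" for p x :: complex
    using qpoch_add[of x p 2 m] qpoch_add[of x p m 2]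
    by (simp add: qpoch_Suc numeral_2_eq_2 mult_ac)
  have g: "1 - q^j * s\<^sup>2 \<noteq> 0" "1 - q^j * (s\<^sup>2 / \<alpha>) \<noteq> 0" for j
    using gen1[of j] gen[of j] \<open>\<alpha> \<noteq> 0\<close> by (auto simp: field_simps)
  have p: "(q\<^sup>2)^2 = q^4" "(q\<^sup>2)^m = q^(2*m)" "(q\<^sup>2 * s)\<^sup>2 = q^4 * s\<^sup>2" by (simp_all add: power_mult power_mult_distrib)
  have 1: "qpoch (q^4 * s\<^sup>2) (q\<^sup>2) m = qpoch (s\<^sup>2) (q\<^sup>2) m * ((1 - s\<^sup>2*q^(2*m)) * (1 - s\<^sup>2*(q^2*q^(2*m)))) / ((1 - s\<^sup>2) * (1 - s\<^sup>2*q^2))"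
    using key[of "q\<^sup>2" "s\<^sup>2"] g(1)[of 0] g(1)[of 2] by (simp add: p eq_divide_eq mult_ac)
  have 2: "qpoch (q^6 * (s\<^sup>2/\<alpha>)) (q\<^sup>2) m = qpoch (q\<^sup>2 * (s\<^sup>2/\<alpha>)) (q\<^sup>2) m * ((1 - s\<^sup>2/\<alpha>*(q^2*q^(2*m))) * (1 - s\<^sup>2/\<alpha>*(q^4*q^(2*m)))) / ((1 - s\<^sup>2/\<alpha>*q^2) * (1 - s\<^sup>2/\<alpha>*q^4))"
  proof -
    have "q^6 * (s\<^sup>2/\<alpha>) = (q\<^sup>2)\<^sup>2 * (q\<^sup>2 * (s\<^sup>2/\<alpha>))" by simp
    moreover have "1 - s\<^sup>2/\<alpha>*q^2 \<noteq> 0" "1 - s\<^sup>2/\<alpha>*q^4 \<noteq> 0"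
      using g(2)[of 2] g(2)[of 4] by (simp_all add: mult_ac)
    moreover note key[of "q\<^sup>2" "q\<^sup>2 * (s\<^sup>2/\<alpha>)"]
    ultimately show ?thesis
      by (simp add: p(1,2) nonzero_eq_divide_eq mult_ac del: times_divide_eq_right times_divide_eq_left)
  qed
  have e: "q\<^sup>2 * (q^4 * s\<^sup>2) / \<alpha> = q^6 * (s\<^sup>2/\<alpha>)" "q\<^sup>2 * s\<^sup>2 / \<alpha> = q\<^sup>2 * (s\<^sup>2/\<alpha>)" "s * (s / \<alpha>) = s\<^sup>2/\<alpha>"
    using power_add[of q 2 4] by (simp_all add: power2_eq_square)
  show ?thesis
    unfolding rogers_coeff_def p e 1 2 by (simp add: divide_inverse mult_ac)
qed

section \<open>The residual of the elementary functions and its shift relation\<close>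

text \<open>What the operator for (a, -a, c, -c) produces besides a multiple of the elementary
  function, once the inverse shift is eliminated (\<open>qop_rogers\<close>). The second summand is
  chosen so that the constant term vanishes.\<close>

definition rogers_residual :: "complex \<Rightarrow> complex \<Rightarrow> complex \<Rightarrow> complex fps" where
  "rogers_residual \<alpha> q s = fps_const q * (1 + fps_X) * (1 - fps_const \<alpha> * fps_X) *
       (qshift (q\<^sup>2) s (rogers \<alpha> q s) - rogers \<alpha> q s)
     + fps_const (1 - s) * (1 - fps_const q * fps_X) * (fps_const q - fps_const (\<alpha> / s) * fps_X) * rogers \<alpha> q s"

lemma rogers_residual_nth:
  "rogers_residual \<alpha> q s $ n = q * (s * (q\<^sup>2)^n - 1) * rogers_coeff \<alpha> q s n + (1 - s) * q * rogers_coeff \<alpha> q s n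
    + (if n = 0 then 0 else (q * (1 - \<alpha>) * (s * (q\<^sup>2)^(n-1) - 1) - (1 - s) * (q\<^sup>2 + \<alpha> / s)) * rogers_coeff \<alpha> q s (n-1))
    + (if n < 2 then 0 else ((1 - s) * q * (\<alpha> / s) - q * \<alpha> * (s * (q\<^sup>2)^(n-2) - 1)) * rogers_coeff \<alpha> q s (n-2))"
proof -
  have 1: "fps_const q * (1 + fps_X) * (1 - fps_const \<alpha> * fps_X) * F =
      fps_const q * F + fps_const (q * (1 - \<alpha>)) * (fps_X * F) - fps_const (q * \<alpha>) * (fps_X ^ 2 * F)" for F
    by (simp add: algebra_simps power2_eq_square fps_const_mult[symmetric] fps_const_sub[symmetric] del: fps_const_mult fps_const_sub)
  have 2: "fps_const (1 - s) * (1 - fps_const q * fps_X) * (fps_const q - fps_const \<beta> * fps_X) * F =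
      fps_const ((1 - s) * q) * F - fps_const ((1 - s) * (q\<^sup>2 + \<beta>)) * (fps_X * F)
      + fps_const ((1 - s) * q * \<beta>) * (fps_X ^ 2 * F)" for F \<beta>
    by (simp add: algebra_simps power2_eq_square fps_const_mult[symmetric] fps_const_add[symmetric] fps_const_sub[symmetric]
        del: fps_const_mult fps_const_add fps_const_sub)
  show ?thesis
    unfolding rogers_residual_def 1 2 by (simp add: fps_X_power_mult_nth rogers_def) (simp add: algebra_simps)
qed

text \<open>Since \<alpha> * \<theta> = s, the factor \<theta> removes the division by
  \<open>s\<close> and all occurrences of \<alpha>, as the polynomial identities above
  require.\<close>

lemma rogers_residual_nth_scaled:
  assumes "\<alpha> \<noteq> 0" "s \<noteq> 0" "\<theta> = s / \<alpha>"
  shows "\<theta> * rogers_residual \<alpha> q s $ n =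
    q * ((s * (q\<^sup>2)^n - 1) * rogers_coeff \<alpha> q s n * \<theta>
      + (\<theta> - s) * (if n = 0 then 0 else (s * (q\<^sup>2)^(n-1) - 1) * rogers_coeff \<alpha> q s (n-1))
      - s * (if n < 2 then 0 else (s * (q\<^sup>2)^(n-2) - 1) * rogers_coeff \<alpha> q s (n-2)))
    + (1 - s) * (q * \<theta> * rogers_coeff \<alpha> q s n
      - (q\<^sup>2 * \<theta> + 1) * (if n = 0 then 0 else rogers_coeff \<alpha> q s (n-1))
      + q * (if n < 2 then 0 else rogers_coeff \<alpha> q s (n-2)))"
proof -
  define \<beta> where "\<beta> = \<alpha> / s"
  have "\<beta> * \<theta> = 1" "\<alpha> * \<theta> = s" using assms by (simp_all add: \<beta>_def)
  then have "\<theta> * (q * (s * P0 - 1) * r0 + (1 - s) * q * r0 + (q * (1 - \<alpha>) * (s * P1 - 1) - (1 - s) * (q\<^sup>2 + \<beta>)) * r1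
      + ((1 - s) * q * \<beta> - q * \<alpha> * (s * P2 - 1)) * r2)
    = q * ((s * P0 - 1) * r0 * \<theta> + (\<theta> - s) * ((s * P1 - 1) * r1) - s * ((s * P2 - 1) * r2))
      + (1 - s) * (q * \<theta> * r0 - (q\<^sup>2 * \<theta> + 1) * r1 + q * r2)" for P0 r0 P1 r1 P2 r2
    by algebra
  note this[of "(q\<^sup>2)^n" "rogers_coeff \<alpha> q s n" "(q\<^sup>2)^(n-1)" "if n = 0 then 0 else rogers_coeff \<alpha> q s (n-1)"
      "(q\<^sup>2)^(n-2)" "if n < 2 then 0 else rogers_coeff \<alpha> q s (n-2)"]
  then show ?thesis
    unfolding rogers_residual_nth \<beta>_def[symmetric] by (simp cong: if_cong split: if_splits)
qed

definition residual_weight :: "complex \<Rightarrow> complex \<Rightarrow> complex \<Rightarrow> complex" where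
  "residual_weight \<alpha> q s = - (\<alpha> / (q * s)) * ((1 - s) * (1 - q * s) * (1 + q * s / \<alpha>) * (1 + q\<^sup>2 * s / \<alpha>)) / (1 - q\<^sup>2 * s\<^sup>2 / \<alpha>)"

definition residual_factor :: "complex \<Rightarrow> complex \<Rightarrow> complex \<Rightarrow> complex" where
  "residual_factor \<alpha> q s = q * ((1 - s) * (1 - q * s) * (1 + q * s / \<alpha>) * (1 + q\<^sup>2 * s / \<alpha>))
     / ((1 - q\<^sup>2 * s\<^sup>2 / \<alpha>) * (1 - q^4 * s\<^sup>2 / \<alpha>))"

text \<open>All coefficients involved are rational multiples of a single
  \<open>rogers_coeff\<close>, so comparing coefficients leaves polynomial identities. The point is
  the factor \<open>fps_X\<close> in the last term: iteration pushes the residual to arbitrarily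
  high order.\<close>

lemma rogers_residual_step:
  fixes \<alpha> q s :: complex
  assumes q: "q \<noteq> 0" "norm q < 1" and \<alpha>: "\<alpha> \<noteq> 0" and s: "s \<noteq> 0"
    and gen: "\<And>j. q^j * s\<^sup>2 \<noteq> \<alpha>" and gen1: "\<And>j. q^j * s\<^sup>2 \<noteq> 1"
  shows "rogers_residual \<alpha> q s =
    fps_const (residual_weight \<alpha> q s) * ((1 - fps_const q * fps_X) * (fps_const q - fps_X) * (fps_X * rogers \<alpha> q (q\<^sup>2 * s)))
    + fps_const (residual_factor \<alpha> q s) * (fps_X * rogers_residual \<alpha> q (q\<^sup>2 * s))"
    (is "_ = ?R")
proof (rule fps_ext)
  fix n
  define \<theta> where "\<theta> = s / \<alpha>"
  have \<theta>: "\<theta> \<noteq> 0" "\<alpha> = s / \<theta>" using \<alpha> s by (simp_all add: \<theta>_def)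
  \<comment> \<open>\<open>h\<close> completes the factors \<open>(1 - s) * (1 - q * s)\<close> of
    both weights to the denominator of \<open>c\<close>; \<open>w\<close> and \<open>v\<close> below
    are then free of denominators.\<close>
  define h where "h = (1 + s) * (1 + q * s)"
  define e where "e = (1 + q * \<theta>) * (1 + q\<^sup>2 * \<theta>)"
  define c where "c = (1 - s*\<theta>*q^2) * (1 - s*\<theta>*q^4) / ((1 - s\<^sup>2) * (1 - s\<^sup>2*q^2))"
  let ?r = "rogers_coeff \<alpha> q s" and ?r' = "rogers_coeff \<alpha> q (q\<^sup>2 * s)"
  have o: "1 - q^(j+1) \<noteq> 0" "1 - s*\<theta>*q^j \<noteq> 0" "1 - s\<^sup>2*q^j \<noteq> 0" for j
    using power_neq_1[OF q(2), of "j+1"] gen[of j] gen1[of j] \<alpha>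
    by (auto simp: \<theta>_def field_simps power2_eq_square)
  have o2: "1 - s \<noteq> 0" "1 + s \<noteq> 0" "1 - q * s \<noteq> 0" "1 + q * s \<noteq> 0"
  proof -
    have "s\<^sup>2 \<noteq> 1" "(q * s)\<^sup>2 \<noteq> 1" using o(3)[of 0] o(3)[of 2] by (simp_all add: power_mult_distrib mult.commute)
    then show "1 - s \<noteq> 0" "1 + s \<noteq> 0" "1 - q * s \<noteq> 0" "1 + q * s \<noteq> 0"
      by (auto simp: add_eq_0_iff)
  qed
  have c0: "c \<noteq> 0" and h0: "h \<noteq> 0"
    using o(2)[of 2] o(2)[of 4] o(3)[of 0] o(3)[of 2] o2 by (simp_all add: c_def h_def)
  have ch: "c * (h * ((1 - s) * (1 - q * s))) = (1 - s*\<theta>*q^2) * (1 - s*\<theta>*q^4)"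
  proof -
    have "h * ((1 - s) * (1 - q * s)) = (1 - s\<^sup>2) * (1 - s\<^sup>2*q^2)" unfolding h_def by algebra
    then show ?thesis using o(3)[of 0] o(3)[of 2] by (simp add: c_def)
  qed
  have w: "h * (residual_weight \<alpha> q s * c) * (q * \<theta>) = - e * (1 - q^4 * s * \<theta>)"
  proof -
    have "residual_weight \<alpha> q s * (q * \<theta>) = - ((1 - s) * (1 - q * s)) * e / (1 - s*\<theta>*q^2)"
      using q(1) s \<theta> by (simp add: residual_weight_def e_def power2_eq_square mult_ac)
    then have "h * (residual_weight \<alpha> q s * c) * (q * \<theta>) = - (c * (h * ((1 - s) * (1 - q * s)))) * e / (1 - s*\<theta>*q^2)"
      by (simp add: mult_ac)
    then show ?thesis unfolding ch using o(2)[of 2] by (simp add: mult_ac)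
  qed
  have v: "h * (residual_factor \<alpha> q s * c) = q * e"
  proof -
    have "residual_factor \<alpha> q s = q * ((1 - s) * (1 - q * s)) * e / ((1 - s*\<theta>*q^2) * (1 - s*\<theta>*q^4))"
      using q(1) s \<theta> by (simp add: residual_factor_def e_def power2_eq_square mult_ac)
    then have "h * (residual_factor \<alpha> q s * c) = q * (c * (h * ((1 - s) * (1 - q * s)))) * e / ((1 - s*\<theta>*q^2) * (1 - s*\<theta>*q^4))"
      by (simp add: mult_ac)
    then show ?thesis unfolding ch using o(2)[of 2] o(2)[of 4] by simp
  qed
  have rS: "?r (Suc m) = ?r m * (q^2*(\<theta> - s*J)*(1 - s^2*J)) / (s * ((1 - q^2*J) * (1 - s*\<theta>*(q^2*J))))"
    if "J = (q\<^sup>2)^m" for m J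
  proof -
    have "q\<^sup>2 / \<alpha> * (1 - J * \<alpha>) = q\<^sup>2 * (\<theta> - s * J) / s" "J * (q\<^sup>2 * s\<^sup>2 / \<alpha>) = s*\<theta>*(q^2*J)"
      using \<alpha> s by (simp_all add: \<theta>_def field_simps power2_eq_square)
    then show ?thesis
      unfolding rogers_coeff_Suc that[symmetric] by (simp add: mult_ac)
  qed
  have r': "?r' m = c * (?r m * ((1 - s\<^sup>2*J) * (1 - s\<^sup>2*(q^2*J)) / ((1 - s*\<theta>*(q^2*J)) * (1 - s*\<theta>*(q^4*J)))))"
    if "J = (q\<^sup>2)^m" for m J
    using rogers_coeff_shift[OF q(1) \<alpha> gen gen1, of m]
    unfolding power_mult that[symmetric] \<theta>_def[symmetric] c_def by (simp add: mult_ac)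
  have R: "h * (q^3 * \<theta>) * ?R $ n = q\<^sup>2 * (h * (residual_weight \<alpha> q s * c) * (q * \<theta>)) *
       ((if n = 0 then 0 else q * (?r' (n-1) / c)) - (if n < 2 then 0 else (1 + q\<^sup>2) * (?r' (n-2) / c))
        + (if n < 3 then 0 else q * (?r' (n-3) / c)))
      + (h * (residual_factor \<alpha> q s * c)) * (q^3 * \<theta>) * (if n = 0 then 0 else rogers_residual \<alpha> q (q\<^sup>2 * s) $ (n-1) / c)"
  proof -
    have "(1 - fps_const q * fps_X) * (fps_const q - fps_X) * (fps_X * F) =
        fps_const q * (fps_X * F) - fps_const (1 + q\<^sup>2) * (fps_X ^ 2 * F) + fps_const q * (fps_X ^ 3 * F)" for F
      by (simp add: algebra_simps power2_eq_square power3_eq_cube fps_const_mult[symmetric] fps_const_add[symmetric]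
          del: fps_const_mult fps_const_add)
    note P = this[of "rogers \<alpha> q (q\<^sup>2 * s)"]
    have "h * (q^3 * \<theta>) * (w * (q * u1 - (1 + q\<^sup>2) * u2 + q * u3) + v * k) =
        q\<^sup>2 * (h * (w * c) * (q * \<theta>)) * (q * (u1 / c) - (1 + q\<^sup>2) * (u2 / c) + q * (u3 / c))
        + (h * (v * c)) * (q^3 * \<theta>) * (k / c)" for w v u1 u2 u3 k
      using c0 by (simp add: field_simps power2_eq_square power3_eq_cube)
    note Q = this[of "residual_weight \<alpha> q s" "if n = 0 then 0 else ?r' (n-1)" "if n < 2 then 0 else ?r' (n-2)"
        "if n < 3 then 0 else ?r' (n-3)" "residual_factor \<alpha> q s" "if n = 0 then 0 else rogers_residual \<alpha> q (q\<^sup>2 * s) $ (n-1)"]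
    have RN: "?R $ n = residual_weight \<alpha> q s * (q * (if n = 0 then 0 else ?r' (n-1)) - (1 + q\<^sup>2) * (if n < 2 then 0 else ?r' (n-2))
         + q * (if n < 3 then 0 else ?r' (n-3)))
       + residual_factor \<alpha> q s * (if n = 0 then 0 else rogers_residual \<alpha> q (q\<^sup>2 * s) $ (n-1))"
      unfolding P by (simp add: fps_X_power_mult_nth rogers_def)
    have d: "(if b then 0 else x) / c = (if b then 0 else x / c)" "q * (if b then 0 else x) = (if b then 0 else q * x)"
        "(1 + q\<^sup>2) * (if b then 0 else x) = (if b then 0 else (1 + q\<^sup>2) * x)" for b x
      by simp_all
    show ?thesis using Q unfolding RN d by assumption
  qed
  note K = rogers_residual_nth_scaled[OF \<alpha> s \<theta>_def, of q n]
  have K': "q\<^sup>2 * \<theta> * rogers_residual \<alpha> q (q\<^sup>2 * s) $ j = q * ((q\<^sup>2 * s * (q\<^sup>2)^j - 1) * ?r' j * (q\<^sup>2 * \<theta>)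
      + (q\<^sup>2 * \<theta> - q\<^sup>2 * s) * (if j = 0 then 0 else (q\<^sup>2 * s * (q\<^sup>2)^(j-1) - 1) * ?r' (j-1))
      - q\<^sup>2 * s * (if j < 2 then 0 else (q\<^sup>2 * s * (q\<^sup>2)^(j-2) - 1) * ?r' (j-2)))
    + (1 - q\<^sup>2 * s) * (q * (q\<^sup>2 * \<theta>) * ?r' j
      - (q\<^sup>2 * (q\<^sup>2 * \<theta>) + 1) * (if j = 0 then 0 else ?r' (j-1))
      + q * (if j < 2 then 0 else ?r' (j-2)))" for j
    by (rule rogers_residual_nth_scaled) (use \<alpha> s q(1) in \<open>simp_all add: \<theta>_def\<close>)
  define T where "T j = ?r' j / c" for j
  have T: "?r' j = c * T j" for j using c0 by (simp add: T_def)
  have rT: "T m = ?r m * ((1 - s\<^sup>2*J) * (1 - s\<^sup>2*(q^2*J))) / ((1 - s*\<theta>*(q^2*J)) * (1 - s*\<theta>*(q^4*J)))"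
    if "J = (q\<^sup>2)^m" for m J
    unfolding T_def r'[OF that] using c0 by simp
  have scale: "x = U * V" if "x = y * N / D" "y = U * P" "D \<noteq> 0" "P * N = V * D" for x y N D U P V :: complex
  proof -
    have "x = U * (P * N) / D" using that(1,2) by (simp add: mult.assoc)
    then show ?thesis using that(3) unfolding that(4) by simp
  qed
  \<comment> \<open>The coefficients of the residual for \<open>q^2 * s\<close>, scaled as in
    \<open>rogers_residual_nth_scaled\<close>; there \<theta> becomes \<open>q^2 * \<theta>\<close>.
    Division by \<open>c\<close> makes them commensurable with the coefficients for
    \<open>s\<close>.\<close>
  define X where "X = (\<lambda>j. q\<^sup>2 * \<theta> * rogers_residual \<alpha> q (q\<^sup>2 * s) $ j / c)"
  have X: "X j = q^3 * ((s * (q\<^sup>2)^(Suc j) - 1) * T j * \<theta>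
      + (\<theta> - s) * (if j = 0 then 0 else (s * (q\<^sup>2)^j - 1) * T (j-1))
      - s * (if j < 2 then 0 else (s * (q\<^sup>2)^(j-1) - 1) * T (j-2)))
    + (1 - q\<^sup>2 * s) * (q^3 * \<theta> * T j
      - (q^4 * \<theta> + 1) * (if j = 0 then 0 else T (j-1))
      + q * (if j < 2 then 0 else T (j-2)))" for j
  proof -
    have q34: "q^3 = q * q\<^sup>2" "q^4 = q\<^sup>2 * q\<^sup>2" by (simp_all add: power2_eq_square power3_eq_cube power4_eq_xxxx)
    consider "j = 0" | "j = 1" | i where "j = Suc (Suc i)"
      by (metis One_nat_def not0_implies_Suc)
    then show ?thesis
      unfolding X_def K' T q34 by cases (use c0 in \<open>simp_all add: field_simps\<close>)
  qed
  have R': "h * (q^3 * \<theta>) * ?R $ n =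
      q\<^sup>2 * e * (if n = 0 then 0 else X (n - 1))
      - e * (1 - q^4 * s * \<theta>) * ((if n = 0 then 0 else q * T (n-1)) - (if n < 2 then 0 else (1 + q\<^sup>2) * T (n-2))
        + (if n < 3 then 0 else q * T (n-3))) * q\<^sup>2"
    unfolding R w v T_def X_def by (simp add: power2_eq_square power3_eq_cube)
  have main: "q^3 * h * (\<theta> * rogers_residual \<alpha> q s $ n) = h * (q^3 * \<theta>) * ?R $ n"
  proof -
    have p: "(q\<^sup>2)^2 = q^4" "(q\<^sup>2)^3 = q^6" by simp_all
    have nz: "1 - K * (q\<^sup>2)^m \<noteq> 0" "1 - s * \<theta> * K * (q\<^sup>2)^m \<noteq> 0"
      if "K \<in> {q^2, q^4, q^6, q^8}" for K m
    proof -
      have "K * (q\<^sup>2)^m = q^(2*m+1+1) \<or> K * (q\<^sup>2)^m = q^(2*m+3+1)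
          \<or> K * (q\<^sup>2)^m = q^(2*m+5+1) \<or> K * (q\<^sup>2)^m = q^(2*m+7+1)"
        using that by (auto simp: power_mult[symmetric] power_add[symmetric] add_ac simp del: power_Suc)
      then show "1 - K * (q\<^sup>2)^m \<noteq> 0" "1 - s * \<theta> * K * (q\<^sup>2)^m \<noteq> 0"
        using o(1,2) by (metis, metis mult.assoc)
    qed
    \<comment> \<open>For \<open>n < 3\<close> some coefficients have a negative index and drop out,
      so these cases need separate identities; at \<open>n = 0\<close> both sides vanish.\<close>
    consider "n = 0" | "n = 1" | "n = 2" | m where "n = m + 3"
      by (metis One_nat_def Suc_1 add.commute add_2_eq_Suc' less_2_cases_iff less_Suc_eq nat_less_le not_less numeral_3_eq_3 le_Suc_ex)
    then show ?thesis
    proof cases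
      case 1
      then show ?thesis unfolding K R' by (simp add: algebra_simps)
    next
      case 2
      note nz' = s nz[of "q^2" 0] nz[of "q^4" 0]
      define U where "U = ?r 0 / (s * (1 - q^2) * (1 - s*\<theta>*q^2) * (1 - s*\<theta>*q^4))"
      have r: "?r 0 = U * (s * (1 - q^2) * (1 - s*\<theta>*q^2) * (1 - s*\<theta>*q^4))"
        using nz' by (simp add: U_def)
      have r1: "?r (Suc 0) = U * (q^2*(\<theta> - s*1)*(1 - s^2*1) * (1 - s*\<theta>*q^4))"
        by (rule scale[OF rS[of 1 0] r]) (use nz' in \<open>simp_all add: mult_ac\<close>)
      have T0: "T 0 = U * (s * (1 - q^2) * (1 - s^2*1) * (1 - s^2*q^2))"
        by (rule scale[OF rT[of 1 0] r]) (use nz' in \<open>simp_all add: mult_ac\<close>)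
      from rogers_residual_identity_1[OF r r1 T0] show ?thesis
        unfolding K R' X unfolding 2 h_def e_def by (simp add: p)
    next
      case 3
      note nz' = s nz[of "q^2" 0] nz[of "q^4" 0] nz[of "q^6" 0]
      have N: "q^2 * q^2 = q^4" "q^2 * q^4 = q^6" "q^4 * q^2 = q^6" by (simp_all flip: power_add)
      define U where "U = ?r 0 / (s^2 * (1 - q^2) * (1 - s*\<theta>*q^2) * (1 - q^4) * (1 - s*\<theta>*q^4) * (1 - s*\<theta>*q^6))"
      have r: "?r 0 = U * (s^2 * (1 - q^2) * (1 - s*\<theta>*q^2) * (1 - q^4) * (1 - s*\<theta>*q^4) * (1 - s*\<theta>*q^6))"
        using nz' by (simp add: U_def)
      have r1: "?r (Suc 0) = U * (s * (q^2*(\<theta> - s*1)*(1 - s^2*1)) * (1 - q^4) * (1 - s*\<theta>*q^4) * (1 - s*\<theta>*q^6))"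
        by (rule scale[OF rS[of 1 0] r]) (use nz' in \<open>simp_all add: mult_ac power2_eq_square\<close>)
      have T0: "T 0 = U * (s^2 * (1 - q^2) * (1 - q^4) * (1 - s*\<theta>*q^6) * (1 - s^2*1) * (1 - s^2*q^2))"
        by (rule scale[OF rT[of 1 0] r]) (use nz' in \<open>simp_all add: mult_ac power2_eq_square\<close>)
      have r2: "?r (Suc (Suc 0)) = U * ((q^2*(\<theta> - s*1)*(1 - s^2*1)) * (q^2*(\<theta> - s*q^2)*(1 - s^2*q^2)) * (1 - s*\<theta>*q^6))"
        by (rule scale[OF rS[of "q^2" 1, unfolded N One_nat_def] r1]) (use nz' in \<open>simp_all add: mult_ac\<close>)
      have T1: "T (Suc 0) = U * (s * (q^2*(\<theta> - s*1)*(1 - s^2*1)) * (1 - q^4) * (1 - s^2*q^2) * (1 - s^2*q^4))"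
        by (rule scale[OF rT[of "q^2" 1, unfolded N One_nat_def] r1]) (use nz' in \<open>simp_all add: mult_ac\<close>)
      from rogers_residual_identity_2[OF r r1 r2 T0 T1] show ?thesis
        unfolding K R' X unfolding 3 h_def e_def by (simp add: p numeral_2_eq_2 power4_eq_xxxx mult.assoc)
    next
      case (4 m)
      define J where "J = (q\<^sup>2)^m"
      have J: "q^2 * J = (q\<^sup>2)^(Suc m)" "q^4 * J = (q\<^sup>2)^(Suc (Suc m))" "q^6 * J = (q\<^sup>2)^(Suc (Suc (Suc m)))"
        unfolding J_def by (simp_all only: power_Suc power2_eq_square) (simp_all add: power_numeral_reduce mult_ac)
      have N: "q^2 * (q^2 * J) = q^4 * J" "q^2 * (q^4 * J) = q^6 * J" "q^4 * (q^2 * J) = q^6 * J" "q^4 * (q^4 * J) = q^8 * J"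
        by (simp_all flip: power_add mult.assoc)
      note nz' = s nz[of "q^2" m, folded J_def] nz[of "q^4" m, folded J_def] nz[of "q^6" m, folded J_def] nz[of "q^8" m, folded J_def]
      define U where "U = ?r m / (s^3 * (1 - q^2*J) * (1 - s*\<theta>*q^2*J) * (1 - q^4*J) * (1 - s*\<theta>*q^4*J)
          * (1 - q^6*J) * (1 - s*\<theta>*q^6*J) * (1 - s*\<theta>*q^8*J))"
      have r: "?r m = U * (s^3 * (1 - q^2*J) * (1 - s*\<theta>*q^2*J) * (1 - q^4*J) * (1 - s*\<theta>*q^4*J)
          * (1 - q^6*J) * (1 - s*\<theta>*q^6*J) * (1 - s*\<theta>*q^8*J))"
        using nz' by (simp add: U_def)
      have r1: "?r (Suc m) = U * (s^2 * (q^2*(\<theta> - s*1*J)*(1 - s^2*1*J)) * (1 - q^4*J) * (1 - s*\<theta>*q^4*J)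
          * (1 - q^6*J) * (1 - s*\<theta>*q^6*J) * (1 - s*\<theta>*q^8*J))"
        by (rule scale[OF rS[OF J_def] r])
          (use nz' in \<open>simp_all add: mult_ac power2_eq_square power3_eq_cube\<close>)
      have T0: "T m = U * (s^3 * (1 - q^2*J) * (1 - q^4*J) * (1 - q^6*J) * (1 - s*\<theta>*q^6*J) * (1 - s*\<theta>*q^8*J)
          * (1 - s^2*1*J) * (1 - s^2*q^2*J))"
        by (rule scale[OF rT[OF J_def] r]) (use nz' in \<open>simp_all add: mult_ac\<close>)
      have r2: "?r (Suc (Suc m)) = U * (s * (q^2*(\<theta> - s*1*J)*(1 - s^2*1*J)) * (q^2*(\<theta> - s*q^2*J)*(1 - s^2*q^2*J))
          * (1 - q^6*J) * (1 - s*\<theta>*q^6*J) * (1 - s*\<theta>*q^8*J))"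
        by (rule scale[OF rS[OF J(1), unfolded N] r1])
          (use nz' in \<open>simp_all add: mult_ac power2_eq_square\<close>)
      have T1: "T (Suc m) = U * (s^2 * (q^2*(\<theta> - s*1*J)*(1 - s^2*1*J)) * (1 - q^4*J) * (1 - q^6*J) * (1 - s*\<theta>*q^8*J)
          * (1 - s^2*q^2*J) * (1 - s^2*q^4*J))"
        by (rule scale[OF rT[OF J(1), unfolded N] r1]) (use nz' in \<open>simp_all add: mult_ac\<close>)
      have r3: "?r (Suc (Suc (Suc m))) = U * ((q^2*(\<theta> - s*1*J)*(1 - s^2*1*J)) * (q^2*(\<theta> - s*q^2*J)*(1 - s^2*q^2*J))
          * (q^2*(\<theta> - s*q^4*J)*(1 - s^2*q^4*J)) * (1 - s*\<theta>*q^8*J))"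
        by (rule scale[OF rS[OF J(2), unfolded N] r2]) (use nz' in \<open>simp_all add: mult_ac\<close>)
      have T2: "T (Suc (Suc m)) = U * (s * (q^2*(\<theta> - s*1*J)*(1 - s^2*1*J)) * (q^2*(\<theta> - s*q^2*J)*(1 - s^2*q^2*J))
          * (1 - q^6*J) * (1 - s^2*q^4*J) * (1 - s^2*q^6*J))"
        by (rule scale[OF rT[OF J(2), unfolded N] r2]) (use nz' in \<open>simp_all add: mult_ac\<close>)
      have n: "n = Suc (Suc (Suc m))" using 4 by simp
      from rogers_residual_identity_3[OF r1 r2 r3 T0 T1 T2] show ?thesis
        unfolding K R' X unfolding h_def e_def n
        by (simp add: J[symmetric] J_def[symmetric] mult.assoc del: power_Suc)
    qed
  qed
  then show "rogers_residual \<alpha> q s $ n = ?R $ n"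
    using h0 q(1) \<theta> by simp
qed

section \<open>From the elementary functions to the even eigenfunctions\<close>

definition even_conn :: "complex \<Rightarrow> complex \<Rightarrow> complex \<Rightarrow> complex \<Rightarrow> nat \<Rightarrow> complex" where
  "even_conn \<alpha> \<gamma> q s l =
     (qpoch (\<gamma> / q) (q\<^sup>2) l * qpoch (s\<^sup>2 / \<alpha>) (q\<^sup>2) l)
        / (qpoch (q\<^sup>2) (q\<^sup>2) l * qpoch (q^3 * s\<^sup>2 / (\<alpha> * \<gamma>)) (q\<^sup>2) l)
     * ((qpoch s q (2*l) * qpoch (q\<^sup>2 * s\<^sup>2 / \<alpha>\<^sup>2) (q\<^sup>2) (2*l))
        / (qpoch (q * s / \<alpha>) q (2*l) * qpoch (s\<^sup>2 / \<alpha>) (q\<^sup>2) (2*l)))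
     * (q\<^sup>2 / \<gamma>) ^ l"

text \<open>The coefficient, up to sign, of the residual that is left when the expansion is
  truncated after index \<open>l\<close>.\<close>

definition even_tele :: "complex \<Rightarrow> complex \<Rightarrow> complex \<Rightarrow> complex \<Rightarrow> nat \<Rightarrow> complex" where
  "even_tele \<alpha> \<gamma> q s l = - even_conn \<alpha> \<gamma> q s l * (1 - \<gamma> * (q\<^sup>2)^l / q) * (1 - (q\<^sup>2)^l * s\<^sup>2 / \<alpha>)
     / (1 - ((q\<^sup>2)^l)\<^sup>2 * s\<^sup>2 / \<alpha>)"

text \<open>Coefficientwise form of the sum over \<open>l\<close> of
  \<open>even_conn \<alpha> \<gamma> q s l\<close> times \<open>fps_X ^ l\<close> times
  \<open>rogers\<close> at \<open>q^(2*l) * s\<close>; \<open>fps_X\<close> stands for x^2.\<close>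

definition even_series :: "complex \<Rightarrow> complex \<Rightarrow> complex \<Rightarrow> complex \<Rightarrow> complex fps" where
  "even_series \<alpha> \<gamma> q s = Abs_fps (\<lambda>j. \<Sum>l\<le>j. even_conn \<alpha> \<gamma> q s l * rogers_coeff \<alpha> q ((q\<^sup>2)^l * s) (j - l))"

context
  fixes \<alpha> \<gamma> q s :: complex
  assumes q: "q \<noteq> 0" "norm q < 1" and \<alpha>: "\<alpha> \<noteq> 0" and \<gamma>: "\<gamma> \<noteq> 0" and s: "s \<noteq> 0"
    and gen: "\<And>j. q^j * s\<^sup>2 \<noteq> \<alpha>" "\<And>j. q^j * s\<^sup>2 \<noteq> 1" "\<And>j. q^j * s \<noteq> \<alpha>" "\<And>j. q^j * s\<^sup>2 \<noteq> \<alpha> * \<gamma>"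
begin

text \<open>\<open>rogers_eigen\<close> expresses the inverse shift by the forward one, and after
  this substitution a factor \<open>1 - fps_X\<close> splits off. At \<gamma> = q the residual drops
  out and only a multiple of the function remains.\<close>

lemma qop_rogers:
  fixes E :: complex
  assumes "\<sigma> \<noteq> 0" "\<And>j. q^j * \<sigma>\<^sup>2 \<noteq> \<alpha>" "\<And>j. q^j * \<sigma>\<^sup>2 \<noteq> 1"
  shows "qop ((1 - fps_const \<alpha> * fps_X) * (1 - fps_const \<gamma> * fps_X) * (fps_const q - fps_X))
      ((fps_X - fps_const \<alpha>) * (fps_X - fps_const \<gamma>) * (1 - fps_const q * fps_X))
      (fps_const E * ((1 - fps_X) * (1 - fps_const q * fps_X) * (fps_const q - fps_X))) (q\<^sup>2) \<sigma> (rogers \<alpha> q \<sigma>)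
    = (1 - fps_X) * (fps_const (\<gamma> / q * (\<sigma> + \<alpha> / \<sigma> - 1 - \<alpha>) - E - (1 - \<gamma> / q) * (1 - \<sigma>))
          * ((1 - fps_const q * fps_X) * (fps_const q - fps_X) * rogers \<alpha> q \<sigma>)
        + fps_const (1 - \<gamma> / q) * rogers_residual \<alpha> q \<sigma>)"
proof -
  define U where "U = qshift (q\<^sup>2) \<sigma> (rogers \<alpha> q \<sigma>) - rogers \<alpha> q \<sigma>"
  define V where "V = qshift (inverse (q\<^sup>2)) (inverse \<sigma>) (rogers \<alpha> q \<sigma>) - rogers \<alpha> q \<sigma>"
  define R where "R = rogers \<alpha> q \<sigma>"
  define g where "g = fps_const (\<gamma> / q)"
  define b where "b = fps_const (\<alpha> / \<sigma>)"
  have eqs: "fps_const \<gamma> = g * fps_const q" "b * fps_const \<sigma> = fps_const \<alpha>"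
    using q assms(1) by (simp_all add: g_def b_def)
  have c: "fps_const (\<gamma> / q * (\<sigma> + \<alpha> / \<sigma> - 1 - \<alpha>) - E - (1 - \<gamma> / q) * (1 - \<sigma>)) =
      g * (fps_const \<sigma> + b - 1 - fps_const \<alpha>) - fps_const E - (1 - g) * (1 - fps_const \<sigma>)"
    "fps_const (1 - \<gamma> / q) = 1 - g" "fps_const (\<sigma> + \<alpha> / \<sigma> - 1 - \<alpha>) = fps_const \<sigma> + b - 1 - fps_const \<alpha>"
    "fps_const (1 - \<sigma>) = 1 - fps_const \<sigma>"
    by (simp_all add: g_def b_def flip: fps_const_mult fps_const_add fps_const_sub fps_const_1_eq_1)
  have "(fps_X - fps_const \<alpha>) * V = (1 - fps_const \<alpha> * fps_X) * U -
      (fps_const \<sigma> + b - 1 - fps_const \<alpha>) * (1 - fps_X) * R"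
    using rogers_eigen[OF q \<alpha> assms] unfolding U_def V_def R_def c by (simp add: algebra_simps)
  note VV = this
  have id: "(1 - b * S * X) * (1 - g * Q * X) * (Q - X) * U + (X - g * Q) * (1 - Q * X) * VV
      - E' * ((1 - X) * (1 - Q * X) * (Q - X)) * R
    = (1 - X) * ((g * (S + b - 1 - b * S) - E' - (1 - g) * (1 - S)) * ((1 - Q * X) * (Q - X) * R)
        + (1 - g) * (Q * (1 + X) * (1 - b * S * X) * U + (1 - S) * (1 - Q * X) * (Q - b * X) * R))"
    if "VV = (1 - b * S * X) * U - (S + b - 1 - b * S) * (1 - X) * R"
    for X S Q E' U R VV :: "complex fps"
    unfolding that by algebra
  show ?thesis
    using id[OF VV[folded eqs(2)], of "fps_const q" "fps_const E", unfolded eqs(2)]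
    unfolding qop_def rogers_residual_def c U_def[symmetric] V_def[symmetric]
    unfolding R_def[symmetric] b_def[symmetric] eqs
    by (simp add: mult_ac)
qed

lemma even_conn_0 [simp]: "even_conn \<alpha> \<gamma> q s 0 = 1"
  by (simp add: even_conn_def)

lemma even_conn_Suc:
  defines "L \<equiv> \<lambda>l. (q\<^sup>2)^l" and "\<theta> \<equiv> \<lambda>l. (q\<^sup>2)^l * s / \<alpha>"
  shows "even_conn \<alpha> \<gamma> q s (Suc l) = even_conn \<alpha> \<gamma> q s l *
    ((1 - \<gamma> * L l / q) * (1 - s * \<theta> l) * (1 - L l * s) * (1 - q * (L l * s)) * (1 + q * \<theta> l) * (1 + q\<^sup>2 * \<theta> l) * (q\<^sup>2 / \<gamma>))
    / ((1 - q\<^sup>2 * L l) * (1 - q^3 * s * \<theta> l / \<gamma>) * (1 - L l * s * \<theta> l) * (1 - q\<^sup>2 * (L l * s * \<theta> l)))"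
proof -
  \<comment> \<open>These factors occur both in the numerator, where
    \<open>1 - q^2 * \<theta>^2\<close> and \<open>1 - q^4 * \<theta>^2\<close> split, and in the
    denominator. Cancelling them leaves \<open>1 + q * \<theta>\<close> and
    \<open>1 + q^2 * \<theta>\<close>.\<close>
  have th: "1 - q * \<theta> l \<noteq> 0" "1 - q\<^sup>2 * \<theta> l \<noteq> 0"
  proof -
    have "q * \<theta> l = q^(2*l+1) * s / \<alpha>" "q\<^sup>2 * \<theta> l = q^(2*l+2) * s / \<alpha>"
      by (simp_all add: \<theta>_def power_mult power_add power2_eq_square)
    moreover have "q^(2*l+1) * s / \<alpha> \<noteq> 1" "q^(2*l+2) * s / \<alpha> \<noteq> 1"
      using gen(3)[of "2*l+1"] gen(3)[of "2*l+2"] \<alpha> by (simp_all add: divide_eq_1_iff)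
    ultimately show "1 - q * \<theta> l \<noteq> 0" "1 - q\<^sup>2 * \<theta> l \<noteq> 0"
      by simp_all
  qed
  have S2: "qpoch x p (2 * Suc l) = qpoch x p (2*l) * ((1 - (p^l)\<^sup>2 * x) * (1 - p * ((p^l)\<^sup>2 * x)))" for x p
    by (simp add: qpoch_Suc power_even_eq mult.assoc)
  have L: "(q ^ l)\<^sup>2 = L l" by (simp add: L_def mult.commute flip: power_mult)
  have f: "(1 - (L l)\<^sup>2 * (q\<^sup>2 * s\<^sup>2 / \<alpha>\<^sup>2)) = (1 - q * \<theta> l) * (1 + q * \<theta> l)"
    "(1 - q\<^sup>2 * ((L l)\<^sup>2 * (q\<^sup>2 * s\<^sup>2 / \<alpha>\<^sup>2))) = (1 - q\<^sup>2 * \<theta> l) * (1 + q\<^sup>2 * \<theta> l)"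
    "L l * (q * s / \<alpha>) = q * \<theta> l" "q * (q * \<theta> l) = q\<^sup>2 * \<theta> l" "L l * (s\<^sup>2 / \<alpha>) = s * \<theta> l"
    "L l * (q^3 * s\<^sup>2 / (\<alpha> * \<gamma>)) = q^3 * s * \<theta> l / \<gamma>" "L l * (\<gamma> / q) = \<gamma> * L l / q" "L l * q\<^sup>2 = q\<^sup>2 * L l"
    "(L l)\<^sup>2 * (s\<^sup>2 / \<alpha>) = L l * s * \<theta> l"
    by (simp_all add: \<theta>_def L_def power2_eq_square algebra_simps)
  have r: "A1 * n1 * (A2 * n2) / (B1 * d1 * (B2 * d2)) * (C1 * (n3 * n4) * (C2 * ((t1 * n5) * (t2 * n6))) / (D1 * (t1 * t2) * (D2 * (d3 * d4)))) * (p * e)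
     = A1 * A2 / (B1 * B2) * (C1 * C2 / (D1 * D2)) * e * (n1 * n2 * n3 * n4 * n5 * n6 * p) / (d1 * d2 * d3 * d4)"
    if "t1 \<noteq> 0" "t2 \<noteq> 0" for A1 n1 A2 n2 B1 d1 B2 d2 C1 n3 n4 C2 t1 n5 t2 n6 D1 D2 d3 d4 p e :: complex
    using that by (simp add: divide_inverse mult_ac)
  show ?thesis
    unfolding even_conn_def S2 qpoch_Suc power_Suc L L_def[symmetric] f by (rule r[OF th])
qed

text \<open>The two conditions for telescoping: the first cancels the elementary function at
  \<open>Suc l\<close>, the second collects its residual. They determine \<open>even_conn\<close>
  and \<open>even_tele\<close> at \<open>Suc l\<close> from the values at \<open>l\<close>; the
  closed forms are the solution.\<close>

lemma even_tele_conn: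
  defines "\<sigma> \<equiv> \<lambda>l. (q\<^sup>2)^l * s"
  shows "even_conn \<alpha> \<gamma> q s (Suc l) *
      (\<gamma> / q * (\<sigma> (Suc l) + \<alpha> / \<sigma> (Suc l) - 1 - \<alpha>) - aw_eval (\<alpha> * \<gamma>) q s - (1 - \<gamma> / q) * (1 - \<sigma> (Suc l)))
    = even_tele \<alpha> \<gamma> q s l * residual_weight \<alpha> q (\<sigma> l)" (is ?A)
  and "even_tele \<alpha> \<gamma> q s (Suc l) + even_conn \<alpha> \<gamma> q s (Suc l) * (1 - \<gamma> / q) = even_tele \<alpha> \<gamma> q s l * residual_factor \<alpha> q (\<sigma> l)" (is ?B)
proof -
  define L where "L = (q\<^sup>2)^l"
  define \<theta> where "\<theta> = L * s / \<alpha>"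
  have L0: "L \<noteq> 0" using q by (simp add: L_def)
  have \<theta>0: "\<theta> \<noteq> 0" using L0 s \<alpha> by (simp add: \<theta>_def)
  have \<alpha>_eq: "\<alpha> = L * s / \<theta>" using L0 s \<alpha> by (simp add: \<theta>_def)
  define AA where "AA = (1 - L * s) * (1 - q * (L * s)) * (1 + q * \<theta>) * (1 + q\<^sup>2 * \<theta>)"
  define t where "t = 1 - q^3 * s * \<theta> / \<gamma>"
  define x where "x = even_conn \<alpha> \<gamma> q s l"
  define n1 where "n1 = (1 - \<gamma> * L / q) * (1 - s * \<theta>)"
  have L_eq: "q^(2*l) = L" by (simp add: L_def power_mult)
  have LL: "L * L = q^(4*l)" by (simp add: L_def flip: power_mult power_add)
  have p3: "L * s * \<theta> = q^(4*l) * s\<^sup>2 / \<alpha>"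
    unfolding LL[symmetric] by (simp add: \<theta>_def power2_eq_square mult_ac)
  have p: "q\<^sup>2 * L = q^(2*l+1+1)" "q^3 * s * \<theta> = q^(2*l+3) * s\<^sup>2 / \<alpha>" "L * s * \<theta> = q^(4*l) * s\<^sup>2 / \<alpha>"
    "q\<^sup>2 * (L * s * \<theta>) = q^(4*l+2) * s\<^sup>2 / \<alpha>" "q^4 * (L * s * \<theta>) = q^(4*l+4) * s\<^sup>2 / \<alpha>"
    by (simp_all add: p3 power_add L_eq) (simp_all add: \<theta>_def power2_eq_square power3_eq_cube mult_ac)
  have d: "1 - q\<^sup>2 * L \<noteq> 0" "1 - L * s * \<theta> \<noteq> 0" "1 - q\<^sup>2 * (L * s * \<theta>) \<noteq> 0" "1 - q^4 * (L * s * \<theta>) \<noteq> 0" "t \<noteq> 0"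
    using power_neq_1[OF q(2), of "2*l+1+1"] gen(1)[of "4*l"] gen(1)[of "4*l+2"] gen(1)[of "4*l+4"] gen(4)[of "2*l+3"] \<alpha> \<gamma>
    unfolding t_def p(4,5) unfolding p by (simp_all add: divide_eq_1_iff)
  have S: "even_conn \<alpha> \<gamma> q s (Suc l) = x * (n1 * AA * (q\<^sup>2 / \<gamma>)) / ((1 - q\<^sup>2 * L) * t * (1 - L * s * \<theta>) * (1 - q\<^sup>2 * (L * s * \<theta>)))"
    using even_conn_Suc[of l] unfolding L_def[symmetric] \<theta>_def[symmetric] t_def[symmetric] x_def[symmetric] n1_def AA_def
    by (simp add: mult_ac)
  have T: "even_tele \<alpha> \<gamma> q s l = - x * n1 / (1 - L * s * \<theta>)"
    unfolding even_tele_def L_def[symmetric] x_def[symmetric] n1_def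
    by (simp add: \<theta>_def power2_eq_square mult_ac)
  have C: "\<gamma> / q * (q\<^sup>2 * (L * s) + \<alpha> / (q\<^sup>2 * (L * s)) - 1 - \<alpha>) - aw_eval (\<alpha> * \<gamma>) q s - (1 - \<gamma> / q) * (1 - q\<^sup>2 * (L * s))
      = (1 - q\<^sup>2 * L) * (\<gamma> / (q^3 * \<theta>)) * t"
    unfolding aw_eval_def t_def \<alpha>_eq using q s L0 \<theta>0 \<gamma> by (simp add: field_simps power2_eq_square power3_eq_cube)
  have w: "residual_weight \<alpha> q (L * s) = - AA / (q * \<theta>) / (1 - q\<^sup>2 * (L * s * \<theta>))"
    and v: "residual_factor \<alpha> q (L * s) = q * AA / ((1 - q\<^sup>2 * (L * s * \<theta>)) * (1 - q^4 * (L * s * \<theta>)))"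
    unfolding residual_weight_def residual_factor_def AA_def by (simp_all add: \<theta>_def power2_eq_square)
  have \<sigma>: "\<sigma> l = L * s" "\<sigma> (Suc l) = q\<^sup>2 * (L * s)" by (simp_all add: \<sigma>_def L_def)
  show ?A
    unfolding \<sigma> C w T S using d q \<theta>0 \<gamma> by (simp add: power2_eq_square power3_eq_cube mult_ac)
  have T': "even_tele \<alpha> \<gamma> q s (Suc l) = - even_conn \<alpha> \<gamma> q s (Suc l) * ((1 - q * \<gamma> * L) * (1 - q\<^sup>2 * s * \<theta>)) / (1 - q^4 * (L * s * \<theta>))"
    unfolding even_tele_def power_Suc L_def[symmetric] using q
    by (simp add: \<theta>_def power2_eq_square power4_eq_xxxx mult_ac)
  have id: "(1 - \<gamma> / q) * (1 - q^4 * (L * s * \<theta>)) - (1 - q * \<gamma> * L) * (1 - q\<^sup>2 * s * \<theta>) = - (\<gamma> / q) * (1 - q\<^sup>2 * L) * t"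
    unfolding t_def using q \<gamma> by (simp add: field_simps power2_eq_square power3_eq_cube power4_eq_xxxx)
  have "even_tele \<alpha> \<gamma> q s (Suc l) + even_conn \<alpha> \<gamma> q s (Suc l) * (1 - \<gamma> / q) =
      even_conn \<alpha> \<gamma> q s (Suc l) * ((1 - \<gamma> / q) * (1 - q^4 * (L * s * \<theta>)) - (1 - q * \<gamma> * L) * (1 - q\<^sup>2 * s * \<theta>)) / (1 - q^4 * (L * s * \<theta>))"
    unfolding T' using d(4) by (simp add: divide_simps) (simp add: algebra_simps)
  also have "\<dots> = even_tele \<alpha> \<gamma> q s l * residual_factor \<alpha> q (\<sigma> l)"
    unfolding id \<sigma> v T S using d q \<gamma> by (simp add: power2_eq_square mult_ac)
  finally show ?B .
qed

lemma even_series_kernel: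
  "qop ((1 - fps_const \<alpha> * fps_X) * (1 - fps_const \<gamma> * fps_X) * (fps_const q - fps_X))
      ((fps_X - fps_const \<alpha>) * (fps_X - fps_const \<gamma>) * (1 - fps_const q * fps_X))
      (fps_const (aw_eval (\<alpha> * \<gamma>) q s) * ((1 - fps_X) * (1 - fps_const q * fps_X) * (fps_const q - fps_X)))
      (q\<^sup>2) s (even_series \<alpha> \<gamma> q s) = 0" (is "qop ?A ?B ?D _ _ _ = 0")
proof -
  let ?L = "qop ?A ?B ?D (q\<^sup>2) s"
  let ?M = "(1 - fps_const q * fps_X) * (fps_const q - fps_X)"
  define \<sigma> where "\<sigma> = (\<lambda>l. (q\<^sup>2)^l * s)"
  define R where "R = (\<lambda>l. fps_X ^ l * rogers \<alpha> q (\<sigma> l))"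
  define K where "K = (\<lambda>l. fps_X ^ l * rogers_residual \<alpha> q (\<sigma> l))"
  define S where "S = (\<lambda>n. \<Sum>l<n. fps_const (even_conn \<alpha> \<gamma> q s l) * R l)"
  define C where "C = (\<lambda>l. \<gamma> / q * (\<sigma> l + \<alpha> / \<sigma> l - 1 - \<alpha>) - aw_eval (\<alpha> * \<gamma>) q s - (1 - \<gamma> / q) * (1 - \<sigma> l))"
  have \<sigma>: "\<sigma> l \<noteq> 0" "q^j * (\<sigma> l)\<^sup>2 \<noteq> \<alpha>" "q^j * (\<sigma> l)\<^sup>2 \<noteq> 1" for l j
  proof -
    have "q^j * (\<sigma> l)\<^sup>2 = q^(j + 2*l + 2*l) * s\<^sup>2"
      by (simp only: \<sigma>_def power_add power_mult power_mult_distrib power2_eq_square[of "(q\<^sup>2)^l"] mult.assoc)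
    then show "\<sigma> l \<noteq> 0" "q^j * (\<sigma> l)\<^sup>2 \<noteq> \<alpha>" "q^j * (\<sigma> l)\<^sup>2 \<noteq> 1"
      using gen(1,2) s q by (simp_all add: \<sigma>_def)
  qed
  have C: "\<gamma> / q * (\<sigma> l + \<alpha> / \<sigma> l - 1 - \<alpha>) - aw_eval (\<alpha> * \<gamma>) q s - (1 - \<gamma> / q) * (1 - \<sigma> l) = C l" for l
    by (simp add: C_def)
  have LR: "?L (R l) = (1 - fps_X) * (fps_const (C l) * (?M * R l) + fps_const (1 - \<gamma> / q) * K l)" for l
  proof -
    have sg: "(q\<^sup>2)^l * s = \<sigma> l" by (simp add: \<sigma>_def)
    show ?thesis
      unfolding R_def qop_X_power_mult sg qop_rogers[OF \<sigma>] C K_def by algebra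
  qed
  have KR: "fps_const (residual_weight \<alpha> q (\<sigma> l)) * (?M * R (Suc l)) = K l - fps_const (residual_factor \<alpha> q (\<sigma> l)) * K (Suc l)" for l
  proof -
    have sg: "\<sigma> (Suc l) = q\<^sup>2 * \<sigma> l" by (simp add: \<sigma>_def)
    have k: "w * (M * (X ^ Suc l * R)) = X ^ l * k - v * (X ^ Suc l * k')"
      if "k = w * (M * (X * R)) + v * (X * k')" for w M X R k v k' :: "complex fps"
      unfolding that by (simp add: algebra_simps)
    show ?thesis
      unfolding K_def R_def sg by (rule k[OF rogers_residual_step[OF q \<alpha> \<sigma>]])
  qed
  \<comment> \<open>Every partial sum leaves only its last residual. The induction starts because
    \<open>C 0 = 0\<close>, that is, because the eigenvalue fits the leading exponent.\<close>
  have LS: "?L (S (Suc n)) = - fps_const (even_tele \<alpha> \<gamma> q s n) * ((1 - fps_X) * K n)" for n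
  proof (induction n)
    case 0
    have "C 0 = 0" "even_tele \<alpha> \<gamma> q s 0 = - (1 - \<gamma> / q)"
      using q s \<sigma>(2)[of 0 0] gen(1)[of 0] \<alpha> by (simp_all add: C_def \<sigma>_def aw_eval_def even_tele_def field_simps)
    then show ?case by (simp add: S_def LR)
  next
    case (Suc n)
    have "?L (S (Suc (Suc n))) = ?L (S (Suc n)) + fps_const (even_conn \<alpha> \<gamma> q s (Suc n)) * ?L (R (Suc n))"
      by (simp add: S_def qop_add qop_const_mult)
    also have "fps_const (even_conn \<alpha> \<gamma> q s (Suc n)) * ?L (R (Suc n)) =
        (1 - fps_X) * (fps_const (even_conn \<alpha> \<gamma> q s (Suc n) * C (Suc n)) * (?M * R (Suc n))
           + fps_const (even_conn \<alpha> \<gamma> q s (Suc n) * (1 - \<gamma> / q)) * K (Suc n))"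
      unfolding LR fps_const_mult[symmetric] by (simp only: ring_distribs mult_ac)
    also have "fps_const (even_conn \<alpha> \<gamma> q s (Suc n) * C (Suc n)) * (?M * R (Suc n)) =
        fps_const (even_tele \<alpha> \<gamma> q s n) * (fps_const (residual_weight \<alpha> q (\<sigma> n)) * (?M * R (Suc n)))"
      using even_tele_conn(1)[of n] unfolding C_def \<sigma>_def by simp
    also have "\<dots> = fps_const (even_tele \<alpha> \<gamma> q s n) * K n - fps_const (even_tele \<alpha> \<gamma> q s n * residual_factor \<alpha> q (\<sigma> n)) * K (Suc n)"
      unfolding KR by (simp add: right_diff_distrib mult.assoc flip: fps_const_mult)
    also have "even_tele \<alpha> \<gamma> q s n * residual_factor \<alpha> q (\<sigma> n) =
        even_tele \<alpha> \<gamma> q s (Suc n) + even_conn \<alpha> \<gamma> q s (Suc n) * (1 - \<gamma> / q)"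
      unfolding \<sigma>_def by (rule even_tele_conn(2)[symmetric])
    finally have "?L (S (Suc (Suc n))) = - fps_const (even_tele \<alpha> \<gamma> q s n) * ((1 - fps_X) * K n) +
      (1 - fps_X) * (fps_const (even_tele \<alpha> \<gamma> q s n) * K n
        - fps_const (even_tele \<alpha> \<gamma> q s (Suc n) + even_conn \<alpha> \<gamma> q s (Suc n) * (1 - \<gamma> / q)) * K (Suc n)
        + fps_const (even_conn \<alpha> \<gamma> q s (Suc n) * (1 - \<gamma> / q)) * K (Suc n))"
      unfolding Suc.IH .
    then show ?case
      unfolding fps_const_add[symmetric] by (rule trans) algebra
  qed
  show ?thesis
  proof (rule fps_ext)
    fix n
    have "even_series \<alpha> \<gamma> q s $ i = S (Suc n) $ i" if "i \<le> n" for i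
    proof -
      have "S (Suc n) $ i = (\<Sum>l<Suc n. if l \<le> i then even_conn \<alpha> \<gamma> q s l * rogers_coeff \<alpha> q (\<sigma> l) (i - l) else 0)"
        unfolding S_def fps_sum_nth R_def rogers_def
        by (intro sum.cong) (auto simp: fps_X_power_mult_nth not_le)
      also have "\<dots> = (\<Sum>l\<le>i. even_conn \<alpha> \<gamma> q s l * rogers_coeff \<alpha> q (\<sigma> l) (i - l))"
        using that by (intro sum.mono_neutral_cong_right) auto
      finally show ?thesis by (simp add: even_series_def \<sigma>_def)
    qed
    then have "?L (even_series \<alpha> \<gamma> q s) $ n = ?L (S (Suc n)) $ n"
      by (intro qop_nth_cong)
    also have "\<dots> = 0"
    proof -
      \<comment> \<open>The missing constant term gives the error order at least
        \<open>n + 1\<close>, just enough for coefficient \<open>n\<close>.\<close>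
      have "rogers_residual \<alpha> q (\<sigma> n) $ 0 = 0" by (simp add: rogers_residual_nth algebra_simps)
      then have "(fps_X ^ n * (- fps_const (even_tele \<alpha> \<gamma> q s n) * ((1 - fps_X) * rogers_residual \<alpha> q (\<sigma> n)))) $ n = 0"
        by (simp add: fps_X_power_mult_nth)
      then show ?thesis unfolding LS K_def by (simp only: mult_ac)
    qed
    finally show "?L (even_series \<alpha> \<gamma> q s) $ n = 0 $ n" by simp
  qed
qed

end

section \<open>Return from x^2 in base q^2 to x\<close>

text \<open>Replacing x by q x multiplies x^2 by q^2, while the prefactor, and with it
  \<open>s\<close>, is the same in both variables.\<close>

lemma qshift_compose_X2: "qshift q s (F oo fps_X ^ 2) = qshift (q\<^sup>2) s F oo fps_X ^ 2"
proof (rule fps_ext)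
  fix n
  have "q ^ n = (q\<^sup>2) ^ (n div 2)" if "even n"
    using that by (simp flip: power_mult)
  then show "qshift q s (F oo fps_X ^ 2) $ n = (qshift (q\<^sup>2) s F oo fps_X ^ 2) $ n"
    by (simp add: fps_nth_compose_X_power)
qed

lemma qop_compose_X2:
  "qop (A oo fps_X ^ 2) (B oo fps_X ^ 2) (D oo fps_X ^ 2) q s (F oo fps_X ^ 2) = qop A B D (q\<^sup>2) s F oo fps_X ^ 2"
  by (simp add: qop_def qshift_compose_X2 fps_compose_mult_distrib fps_compose_add_distrib fps_compose_sub_distrib power_inverse)

text \<open>Parameters in pairs of opposite sign make all coefficients of the operator even in x, so
  it acts on functions of x^2.\<close>

lemma aw_cleared_even_series:
  assumes "a \<noteq> 0" "c \<noteq> 0" "q \<noteq> 0" "norm q < 1" "s \<noteq> 0"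
    and "\<And>j. q^j * s\<^sup>2 \<noteq> a\<^sup>2" "\<And>j. q^j * s\<^sup>2 \<noteq> 1" "\<And>j. q^j * s \<noteq> a\<^sup>2" "\<And>j. q^j * s\<^sup>2 \<noteq> a\<^sup>2 * c\<^sup>2"
  shows "aw_cleared a (-a) c (-c) q s (even_series (a\<^sup>2) (c\<^sup>2) q s oo fps_X ^ 2) = 0"
proof -
  have e: "aw_eval (a * - a * c * - c) q s = aw_eval (a\<^sup>2 * c\<^sup>2) q s"
    by (simp add: power2_eq_square mult_ac)
  have X2: "(fps_X ^ 2 :: complex fps) $ 0 = 0" by simp
  have sq: "fps_const (x\<^sup>2) = fps_const x * fps_const x" for x :: complex by (simp add: power2_eq_square)
  note comp = fps_compose_mult_distrib[OF X2] fps_compose_sub_distrib fps_const_compose fps_compose_1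
    fps_X_fps_compose_startby0[OF X2] sq fps_const_neg[symmetric]
  have A: "aw_num a (-a) c (-c) q =
      ((1 - fps_const (a\<^sup>2) * fps_X) * (1 - fps_const (c\<^sup>2) * fps_X) * (fps_const q - fps_X)) oo fps_X ^ 2"
    by (simp only: aw_num_def comp) algebra
  have B: "aw_num' a (-a) c (-c) q =
      ((fps_X - fps_const (a\<^sup>2)) * (fps_X - fps_const (c\<^sup>2)) * (1 - fps_const q * fps_X)) oo fps_X ^ 2"
    by (simp only: aw_num'_def comp) algebra
  have D: "fps_const (aw_eval (a\<^sup>2 * c\<^sup>2) q s) * aw_den q =
      (fps_const (aw_eval (a\<^sup>2 * c\<^sup>2) q s) * ((1 - fps_X) * (1 - fps_const q * fps_X) * (fps_const q - fps_X))) oo fps_X ^ 2"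
    by (simp add: aw_den_def fps_compose_mult_distrib fps_compose_sub_distrib)
  show ?thesis
    unfolding aw_cleared_def e A B D qop_compose_X2
    by (subst even_series_kernel) (use assms in simp_all)
qed

section \<open>The bidiagonalising functions\<close>

text \<open>Euler's expansion of (z x; q)_\<infinity>. As a formal series it stands for the infinite
  product through the functional equation \<open>qexp_fps_rec\<close>.\<close>

definition qexp_fps :: "complex \<Rightarrow> complex \<Rightarrow> complex fps" where
  "qexp_fps q z = Abs_fps (\<lambda>n. (-1) ^ n * q ^ (n * (n - 1) div 2) * z ^ n / qpoch q q n)"

lemma qexp_fps_nth_0 [simp]: "qexp_fps q z $ 0 = 1"
  by (simp add: qexp_fps_def)

lemma qexp_fps_nonzero [simp]: "qexp_fps q z \<noteq> 0"
  by (metis qexp_fps_nth_0 fps_zero_nth zero_neq_one)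

lemma triangle_Suc: "Suc n * (Suc n - 1) div 2 = n * (n - 1) div 2 + n"
proof -
  have "Suc n * n = n * (n - 1) + 2 * n" by (cases n) (simp_all add: algebra_simps)
  then show ?thesis by simp
qed

lemma qexp_fps_rec:
  assumes "norm q < 1"
  shows "qexp_fps q z = (1 - fps_const z * fps_X) * qexp_fps q (q * z)"
proof (rule fps_ext)
  fix n
  have e: "(1 - fps_const z * fps_X) * F = F - fps_const z * (fps_X * F)" for F
    by (simp add: algebra_simps)
  show "qexp_fps q z $ n = ((1 - fps_const z * fps_X) * qexp_fps q (q * z)) $ n"
  proof (cases n)
    case (Suc m)
    have nz: "qpoch q q m \<noteq> 0" "1 - q ^ Suc m \<noteq> 0"
      using qpoch_self_neq_0[OF assms] power_neq_1[OF assms, of "Suc m"] by auto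
    have S: "qpoch q q (Suc m) = qpoch q q m * (1 - q ^ Suc m)" by (simp add: qpoch_Suc mult_ac)
    show ?thesis
      unfolding Suc e using nz
      by (simp add: qexp_fps_def S triangle_Suc[simplified] power_add power_mult_distrib divide_simps del: power_Suc)
         (simp add: algebra_simps)
  qed (simp add: e)
qed

lemma qshift_qexp_fps: "qshift q s (qexp_fps q z) = fps_const s * qexp_fps q (q * z)"
  by (rule fps_ext) (simp add: qexp_fps_def power_mult_distrib)

lemma qshift_inverse_qexp_fps:
  "qshift (inverse q) s (qexp_fps q z) = fps_const s * qexp_fps q (z / q)"
  by (rule fps_ext) (simp add: qexp_fps_def divide_inverse power_mult_distrib power_inverse mult_ac)

text \<open>
  \<open>x\<^sup>-\<^sup>\<lambda> (ax, q\<sigma>x/a; q)\<^sub>\<infinity> / (ax/\<sigma>, qx/a; q)\<^sub>\<infinity>\<close>, the formal counterpart for \<open>\<sigma> = q\<^sup>-\<^sup>k\<close> of the Askey--Wilson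
  basis \<open>(ax, a/x; q)\<^sub>k\<close>, on which every \<open>D\<close> with first parameter \<open>a\<close> is bidiagonal.
\<close>

definition aw_phi :: "complex \<Rightarrow> complex \<Rightarrow> complex \<Rightarrow> complex fps" where
  "aw_phi a q \<sigma> = qexp_fps q a * qexp_fps q (q * \<sigma> / a) * inverse (qexp_fps q (a / \<sigma>) * qexp_fps q (q / a))"

lemma aw_phi_nth_0 [simp]: "aw_phi a q \<sigma> $ 0 = 1"
  by (simp add: aw_phi_def)

lemma aw_phi_mult: "aw_phi a q \<sigma> * (qexp_fps q (a / \<sigma>) * qexp_fps q (q / a)) = qexp_fps q a * qexp_fps q (q * \<sigma> / a)"
  by (simp add: aw_phi_def mult.assoc inverse_mult_eq_1)

text \<open>The off-diagonal entry of the operator in \<open>qop_aw_phi\<close>. Apart from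
  \<open>\<sigma> - 1\<close> its zeros are at \<open>t = b\<close>, \<open>t = c\<close> and
  \<open>t = d\<close>; it is symmetric in the three parameters other than \<open>a\<close>.\<close>

definition aw_lower :: "complex \<Rightarrow> complex \<Rightarrow> complex \<Rightarrow> complex \<Rightarrow> complex \<Rightarrow> complex \<Rightarrow> complex" where
  "aw_lower a b c d q \<sigma> = (let t = q * \<sigma> / a in (\<sigma> - 1) * t * (1 - b / t) * (1 - c / t) * (1 - d / t))"

context
  fixes a q \<sigma> :: complex
  assumes a: "a \<noteq> 0" and q: "q \<noteq> 0" "norm q < 1" and \<sigma>: "\<sigma> \<noteq> 0"
begin

text \<open>Each infinite product changes by one linear factor, so the function and its two shifts
  are all polynomial multiples of \<open>aw_phi a q (q * \<sigma>)\<close>. The linear factors on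
  the left keep the equations free of division.\<close>

lemma aw_phi_step:
  "aw_phi a q \<sigma> = (1 - fps_const (q * \<sigma> / a) * fps_X) * (1 - fps_const (a / (q * \<sigma>)) * fps_X) * aw_phi a q (q * \<sigma>)"
  and qshift_aw_phi: "(1 - fps_const a * fps_X) * qshift q \<sigma> (aw_phi a q \<sigma>) =
    fps_const \<sigma> * (1 - fps_const (a / \<sigma>) * fps_X) * (1 - fps_const (q / a) * fps_X) * (1 - fps_const (a / (q * \<sigma>)) * fps_X) * aw_phi a q (q * \<sigma>)"
  and qshift_inverse_aw_phi: "(1 - fps_const (1 / a) * fps_X) * qshift (inverse q) (inverse \<sigma>) (aw_phi a q \<sigma>) =
    fps_const (inverse \<sigma>) * (1 - fps_const (a / q) * fps_X) * (1 - fps_const (\<sigma> / a) * fps_X) * (1 - fps_const (q * \<sigma> / a) * fps_X) * aw_phi a q (q * \<sigma>)"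
proof -
  note rec = qexp_fps_rec[OF q(2)]
  define Z where "Z = qexp_fps q (a / \<sigma>) * qexp_fps q (q / a)"
  define Z' where "Z' = qexp_fps q (a / (q * \<sigma>)) * qexp_fps q (q / a)"
  have Z0: "Z \<noteq> 0" "Z' \<noteq> 0" by (simp_all add: Z_def Z'_def)
  have r1: "qexp_fps q (a / (q * \<sigma>)) = (1 - fps_const (a / (q * \<sigma>)) * fps_X) * qexp_fps q (a / \<sigma>)"
    using rec[of "a / (q * \<sigma>)"] q by simp
  have r2: "qexp_fps q (q * \<sigma> / a) = (1 - fps_const (q * \<sigma> / a) * fps_X) * qexp_fps q (q * (q * \<sigma>) / a)"
    using rec[of "q * \<sigma> / a"] by (simp add: mult.assoc)
  have r3: "qexp_fps q (a / \<sigma>) = (1 - fps_const (a / \<sigma>) * fps_X) * qexp_fps q (q * (a / \<sigma>))"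
    "qexp_fps q (q / a) = (1 - fps_const (q / a) * fps_X) * qexp_fps q (q * (q / a))"
    "qexp_fps q a = (1 - fps_const a * fps_X) * qexp_fps q (q * a)"
    by (rule rec)+
  have r4: "qexp_fps q (a / q) = (1 - fps_const (a / q) * fps_X) * qexp_fps q a"
    "qexp_fps q (\<sigma> / a) = (1 - fps_const (\<sigma> / a) * fps_X) * qexp_fps q (q * \<sigma> / a)"
    "qexp_fps q (1 / a) = (1 - fps_const (1 / a) * fps_X) * qexp_fps q (q / a)"
    using rec[of "a / q"] rec[of "\<sigma> / a"] rec[of "1 / a"] q by simp_all
  have m: "aw_phi a q \<sigma> * Z = qexp_fps q a * qexp_fps q (q * \<sigma> / a)"
    unfolding Z_def by (rule aw_phi_mult)
  have m': "aw_phi a q (q * \<sigma>) * Z' = qexp_fps q a * qexp_fps q (q * (q * \<sigma>) / a)"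
    unfolding Z'_def by (rule aw_phi_mult)
  have Z': "Z' = (1 - fps_const (a / (q * \<sigma>)) * fps_X) * Z"
    unfolding Z_def Z'_def r1 by (simp add: mult.assoc)
  have "aw_phi a q \<sigma> * Z = (1 - fps_const (q * \<sigma> / a) * fps_X) * (aw_phi a q (q * \<sigma>) * Z')"
    unfolding m m' r2 by (simp only: mult_ac)
  then show "aw_phi a q \<sigma> = (1 - fps_const (q * \<sigma> / a) * fps_X) * (1 - fps_const (a / (q * \<sigma>)) * fps_X) * aw_phi a q (q * \<sigma>)"
    unfolding Z' using Z0 by (simp add: mult_ac)
  have "qshift q (\<sigma> * 1) (aw_phi a q \<sigma> * Z) = qshift q (\<sigma> * 1) (qexp_fps q a * qexp_fps q (q * \<sigma> / a))"
    unfolding m ..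
  then have "qshift q \<sigma> (aw_phi a q \<sigma>) * (qexp_fps q (q * (a / \<sigma>)) * qexp_fps q (q * (q / a)))
      = fps_const \<sigma> * (qexp_fps q (q * a) * qexp_fps q (q * (q * \<sigma>) / a))"
    unfolding qshift_mult Z_def using qshift_mult[of q 1 1 "qexp_fps q (a / \<sigma>)" "qexp_fps q (q / a)"]
    by (simp add: qshift_qexp_fps mult_ac)
  then have "(1 - fps_const a * fps_X) * qshift q \<sigma> (aw_phi a q \<sigma>) * Z =
      fps_const \<sigma> * (1 - fps_const (a / \<sigma>) * fps_X) * (1 - fps_const (q / a) * fps_X) * (aw_phi a q (q * \<sigma>) * Z')"
    unfolding m' Z_def r3 by (simp add: mult_ac)
  then show "(1 - fps_const a * fps_X) * qshift q \<sigma> (aw_phi a q \<sigma>) =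
    fps_const \<sigma> * (1 - fps_const (a / \<sigma>) * fps_X) * (1 - fps_const (q / a) * fps_X) * (1 - fps_const (a / (q * \<sigma>)) * fps_X) * aw_phi a q (q * \<sigma>)"
    unfolding Z' using Z0 by (simp add: mult_ac)
  have "qshift (inverse q) (inverse \<sigma> * 1) (aw_phi a q \<sigma> * Z) = qshift (inverse q) (inverse \<sigma> * 1) (qexp_fps q a * qexp_fps q (q * \<sigma> / a))"
    unfolding m ..
  then have "qshift (inverse q) (inverse \<sigma>) (aw_phi a q \<sigma>) * (qexp_fps q (a / (q * \<sigma>)) * qexp_fps q (1 / a))
      = fps_const (inverse \<sigma>) * (qexp_fps q (a / q) * qexp_fps q (\<sigma> / a))"
    unfolding qshift_mult Z_def using q qshift_mult[of "inverse q" 1 1 "qexp_fps q (a / \<sigma>)" "qexp_fps q (q / a)"]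
    by (simp add: qshift_inverse_qexp_fps mult_ac)
  then have "(1 - fps_const (1 / a) * fps_X) * qshift (inverse q) (inverse \<sigma>) (aw_phi a q \<sigma>) * Z' =
      fps_const (inverse \<sigma>) * (1 - fps_const (a / q) * fps_X) * (1 - fps_const (\<sigma> / a) * fps_X) *
        (1 - fps_const (q * \<sigma> / a) * fps_X) * (aw_phi a q (q * \<sigma>) * Z')"
    unfolding m' unfolding Z'_def r4 r2 by (simp only: mult_ac)
  then show "(1 - fps_const (1 / a) * fps_X) * qshift (inverse q) (inverse \<sigma>) (aw_phi a q \<sigma>) =
    fps_const (inverse \<sigma>) * (1 - fps_const (a / q) * fps_X) * (1 - fps_const (\<sigma> / a) * fps_X) * (1 - fps_const (q * \<sigma> / a) * fps_X) * aw_phi a q (q * \<sigma>)"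
    using Z0 by (simp add: mult_ac)
qed

text \<open>After multiplication by the numerator factors belonging to \<open>a\<close>, the two
  differences acquire the factors \<open>1 - q x^2\<close> and \<open>q - x^2\<close>. This makes
  \<open>aw_den\<close> split off, and \<open>b\<close>, \<open>c\<close>, \<open>d\<close> enter
  only through a polynomial identity.\<close>

lemma qop_aw_phi:
  "qop (aw_num a b c d q) (aw_num' a b c d q) (fps_const E * aw_den q) q \<sigma> (aw_phi a q \<sigma>) =
    aw_den q * (fps_const (aw_eval (a*b*c*d) q \<sigma> - E) * aw_phi a q \<sigma>
      + fps_const (aw_lower a b c d q \<sigma>) * (fps_X * aw_phi a q (q * \<sigma>)))"
proof -
  let ?c = "fps_const :: complex \<Rightarrow> complex fps" and ?X = "fps_X :: complex fps"
  define P where "P = aw_phi a q \<sigma>"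
  define Y where "Y = aw_phi a q (q * \<sigma>)"
  define t where "t = q * \<sigma> / a"
  define \<tau> where "\<tau> = a / (q * \<sigma>)"
  have t\<tau>: "t * \<tau> = 1" "t \<noteq> 0" using a q \<sigma> by (simp_all add: t_def \<tau>_def)
  have tt: "?c t * ?c \<tau> = 1" using t\<tau> by simp
  define U where "U = qshift q \<sigma> P - P"
  define V where "V = qshift (inverse q) (inverse \<sigma>) P - P"
  have P: "P = (1 - ?c t * ?X) * (1 - ?c \<tau> * ?X) * Y"
    unfolding P_def Y_def t_def \<tau>_def by (rule aw_phi_step)
  have U: "(1 - ?c a * ?X) * U = ?c (\<sigma> - 1) * (1 - ?c q * ?X ^ 2) * (1 - ?c \<tau> * ?X) * Y"
  proof -
    define u where "u = ?c (a / \<sigma>)"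
    define v where "v = ?c (q / a)"
    have c: "?c a = ?c \<sigma> * u" "?c t = ?c \<sigma> * v" "?c q = ?c \<sigma> * u * v" "?c (\<sigma> - 1) = ?c \<sigma> - 1"
      using a \<sigma> by (simp_all add: u_def v_def t_def flip: fps_const_sub)
    have h: "(1 - ?c a * ?X) * qshift q \<sigma> P = ?c \<sigma> * (1 - u * ?X) * (1 - v * ?X) * (1 - ?c \<tau> * ?X) * Y"
      unfolding P_def Y_def u_def v_def \<tau>_def by (rule qshift_aw_phi)
    have "(1 - ?c a * ?X) * U = ?c \<sigma> * (1 - u * ?X) * (1 - v * ?X) * (1 - ?c \<tau> * ?X) * Y
        - (1 - ?c a * ?X) * P"
      unfolding U_def h[symmetric] by (rule right_diff_distrib)
    then show ?thesis unfolding P c by algebra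
  qed
  have V: "(1 - ?c (1 / a) * ?X) * V = ?c (inverse \<sigma> - 1) * (1 - ?c (1 / q) * ?X ^ 2) * (1 - ?c t * ?X) * Y"
  proof -
    define u where "u = ?c (a / q)"
    define v where "v = ?c (\<sigma> / a)"
    have c: "?c (1 / a) = ?c (inverse \<sigma>) * v" "?c \<tau> = ?c (inverse \<sigma>) * u" "?c (1 / q) = ?c (inverse \<sigma>) * u * v"
      "?c (inverse \<sigma> - 1) = ?c (inverse \<sigma>) - 1"
      using a \<sigma> by (simp_all add: u_def v_def \<tau>_def inverse_eq_divide flip: fps_const_sub)
    have h: "(1 - ?c (1 / a) * ?X) * qshift (inverse q) (inverse \<sigma>) P = ?c (inverse \<sigma>) * (1 - u * ?X) * (1 - v * ?X) * (1 - ?c t * ?X) * Y"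
      unfolding P_def Y_def u_def v_def t_def by (rule qshift_inverse_aw_phi)
    have "(1 - ?c (1 / a) * ?X) * V = ?c (inverse \<sigma>) * (1 - u * ?X) * (1 - v * ?X) * (1 - ?c t * ?X) * Y
        - (1 - ?c (1 / a) * ?X) * P"
      unfolding V_def h[symmetric] by (rule right_diff_distrib)
    then show ?thesis unfolding P c by algebra
  qed
  have V': "(?X - ?c a) * V = ?c (\<sigma> - 1) * ?c \<tau> * (?c q - ?X ^ 2) * (1 - ?c t * ?X) * Y"
  proof -
    have x: "?X - ?c a = - ?c a * (1 - ?c (1 / a) * ?X)"
    proof -
      have "?c a * ?c (1 / a) = 1" using a by simp
      then show ?thesis by algebra
    qed
    have "(?X - ?c a) * V = - ?c a * (?c (inverse \<sigma> - 1) * (1 - ?c (1 / q) * ?X ^ 2) * (1 - ?c t * ?X) * Y)"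
      unfolding x mult.assoc unfolding V[unfolded mult.assoc] by simp
    also have "1 - ?c (1 / q) * ?X ^ 2 = ?c (1 / q) * (?c q - ?X ^ 2)"
      using q by (simp add: right_diff_distrib)
    also have "- ?c a * (?c (inverse \<sigma> - 1) * (?c (1 / q) * (?c q - ?X ^ 2)) * (1 - ?c t * ?X) * Y)
       = ?c (- a * (inverse \<sigma> - 1) * (1 / q)) * (?c q - ?X ^ 2) * (1 - ?c t * ?X) * Y"
      unfolding fps_const_mult[symmetric] fps_const_neg[symmetric] by algebra
    also have "- a * (inverse \<sigma> - 1) * (1 / q) = (\<sigma> - 1) * \<tau>"
      using q \<sigma> by (simp add: \<tau>_def field_simps)
    finally show ?thesis by simp
  qed
  have e: "aw_eval (a*b*c*d) q \<sigma> = (\<sigma> - 1) * (1 - b * c * d * \<tau>)"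
    using a q \<sigma> by (simp add: aw_eval_def \<tau>_def field_simps)
  have w: "aw_lower a b c d q \<sigma> = (\<sigma> - 1) * t * (1 - b * \<tau>) * (1 - c * \<tau>) * (1 - d * \<tau>)"
    using a q \<sigma> by (simp add: aw_lower_def t_def \<tau>_def Let_def)
  have id: "(1 - b * X) * (1 - c * X) * (1 - d * X) * (Q - X ^ 2) * (s' * (1 - Q * X ^ 2) * (1 - \<tau> * X) * Y)
      + (X - b) * (X - c) * (X - d) * (1 - Q * X ^ 2) * (s' * \<tau> * (Q - X ^ 2) * (1 - t * X) * Y)
    = (1 - X ^ 2) * (1 - Q * X ^ 2) * (Q - X ^ 2) * (s' * (1 - b * c * d * \<tau>) * ((1 - t * X) * (1 - \<tau> * X) * Y)
        + s' * t * (1 - b * \<tau>) * (1 - c * \<tau>) * (1 - d * \<tau>) * (X * Y))"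
    if "t * \<tau> = 1" for b c d t \<tau> X Q Y s' :: "complex fps"
  proof -
    \<comment> \<open>The left side vanishes at \<open>X = 1\<close> and \<open>X = - 1\<close>. The
      two constants on the right are read off at \<open>X = 0\<close> and, since
      \<open>t * \<tau> = 1\<close>, at \<open>X = \<tau>\<close>.\<close>
    have "(1 - b * X) * (1 - c * X) * (1 - d * X) * (1 - \<tau> * X) + \<tau> * ((X - b) * (X - c) * (X - d) * (1 - t * X))
      = (1 - X ^ 2) * ((1 - b * c * d * \<tau>) * ((1 - t * X) * (1 - \<tau> * X)) + t * (1 - b * \<tau>) * (1 - c * \<tau>) * (1 - d * \<tau>) * X)"
      using that by algebra
    then show ?thesis by algebra
  qed
  have N: "aw_num a b c d q * U = (1 - ?c b * ?X) * (1 - ?c c * ?X) * (1 - ?c d * ?X) * (?c q - ?X ^ 2) * ((1 - ?c a * ?X) * U)"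
    by (simp only: aw_num_def mult_ac)
  have N': "aw_num' a b c d q * V = (?X - ?c b) * (?X - ?c c) * (?X - ?c d) * (1 - ?c q * ?X ^ 2) * ((?X - ?c a) * V)"
    by (simp only: aw_num'_def mult_ac)
  have "aw_num a b c d q * U + aw_num' a b c d q * V =
    aw_den q * (?c ((\<sigma> - 1) * (1 - b * c * d * \<tau>)) * P + ?c ((\<sigma> - 1) * t * (1 - b * \<tau>) * (1 - c * \<tau>) * (1 - d * \<tau>)) * (?X * Y))"
    unfolding N N' U V' P aw_den_def
    using id[OF tt, of "?c b" ?X "?c c" "?c d" "?c q" "?c (\<sigma> - 1)" Y]
    by (simp flip: fps_const_mult fps_const_sub)
  then show ?thesis
    unfolding qop_def P_def[symmetric] Y_def[symmetric] U_def[symmetric] V_def[symmetric] e[symmetric] w[symmetric] fps_const_sub[symmetric]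
    by algebra
qed

end

section \<open>Series in the bidiagonalising functions\<close>

definition phi_series :: "complex \<Rightarrow> complex \<Rightarrow> complex \<Rightarrow> (nat \<Rightarrow> complex) \<Rightarrow> complex fps" where
  "phi_series a q s A = Abs_fps (\<lambda>n. \<Sum>k\<le>n. A k * aw_phi a q (q ^ k * s) $ (n - k))"

text \<open>By \<open>qop_aw_phi\<close> at \<open>q ^ k * s\<close> the recurrence cancels all
  functions but the last in the image of a partial sum, and that one starts at
  \<open>fps_X ^ Suc n\<close>.\<close>

lemma phi_series_kernel:
  assumes a: "a \<noteq> 0" and q: "q \<noteq> 0" "norm q < 1" and s: "s \<noteq> 0"
    and A: "\<And>k. A (Suc k) * (aw_eval (a*b*c*d) q (q ^ Suc k * s) - aw_eval (a*b*c*d) q s)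
              + A k * aw_lower a b c d q (q ^ k * s) = 0"
  shows "aw_cleared a b c d q s (phi_series a q s A) = 0"
proof -
  let ?L = "aw_cleared a b c d q s"
  define F where "F = (\<lambda>k. fps_X ^ k * aw_phi a q (q ^ k * s))"
  define S where "S = (\<lambda>n. \<Sum>k<n. fps_const (A k) * F k)"
  have LF: "?L (F k) = aw_den q * (fps_const (aw_eval (a*b*c*d) q (q ^ k * s) - aw_eval (a*b*c*d) q s) * F k
      + fps_const (aw_lower a b c d q (q ^ k * s)) * F (Suc k))" for k
  proof -
    have m: "q * (q ^ k * s) = q ^ Suc k * s" "q ^ k * s \<noteq> 0" using q s by simp_all
    show ?thesis
      unfolding aw_cleared_def F_def qop_X_power_mult qop_aw_phi[OF a q m(2)] m(1) power_Suc2[of fps_X] by algebra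
  qed
  have LS: "?L (S (Suc n)) = aw_den q * (fps_const (A n * aw_lower a b c d q (q ^ n * s)) * F (Suc n))" for n
  proof (induction n)
    case 0
    have "?L (S (Suc 0)) = fps_const (A 0) * ?L (F 0)"
      by (simp add: S_def aw_cleared_def qop_const_mult)
    then show ?case unfolding LF by (simp add: mult_ac flip: fps_const_mult)
  next
    case (Suc n)
    have "?L (S (Suc (Suc n))) = ?L (S (Suc n)) + fps_const (A (Suc n)) * ?L (F (Suc n))"
      by (simp add: S_def aw_cleared_def qop_add qop_const_mult)
    also have "\<dots> = aw_den q * (fps_const (A (Suc n) * (aw_eval (a*b*c*d) q (q ^ Suc n * s) - aw_eval (a*b*c*d) q s)
        + A n * aw_lower a b c d q (q ^ n * s)) * F (Suc n)
        + fps_const (A (Suc n) * aw_lower a b c d q (q ^ Suc n * s)) * F (Suc (Suc n)))"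
      unfolding Suc.IH LF fps_const_add[symmetric] fps_const_mult[symmetric] by algebra
    finally show ?case unfolding A by simp
  qed
  show ?thesis
  proof (rule fps_ext)
    fix n
    have "phi_series a q s A $ i = S (Suc n) $ i" if "i \<le> n" for i
    proof -
      have "S (Suc n) $ i = (\<Sum>k<Suc n. if k \<le> i then A k * aw_phi a q (q ^ k * s) $ (i - k) else 0)"
        unfolding S_def fps_sum_nth F_def
        by (intro sum.cong) (auto simp: fps_X_power_mult_nth not_le)
      also have "\<dots> = (\<Sum>k\<le>i. A k * aw_phi a q (q ^ k * s) $ (i - k))"
        using that by (intro sum.mono_neutral_cong_right) auto
      finally show ?thesis by (simp add: phi_series_def)
    qed
    then have "?L (phi_series a q s A) $ n = ?L (S (Suc n)) $ n"
      unfolding aw_cleared_def by (intro qop_nth_cong)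
    also have "\<dots> = (fps_X ^ Suc n * (aw_den q * (fps_const (A n * aw_lower a b c d q (q ^ n * s)) * aw_phi a q (q ^ Suc n * s)))) $ n"
      unfolding LS F_def by (simp only: mult_ac)
    also have "\<dots> = 0"
      by (simp add: fps_X_power_mult_nth del: power_Suc)
    finally show "?L (phi_series a q s A) $ n = 0 $ n" by simp
  qed
qed

section \<open>The coefficients connecting general and even parameters\<close>

text \<open>
  \<open>P1\<close>, \<open>P2\<close>, \<open>P3\<close> are the coefficients of the rational certificate that creative telescoping produces
  for the three-term recurrence below; the second identity is its boundary term.
\<close>

lemma two_phi_certificate:
  fixes \<beta> \<delta> w \<kappa> q Q r z P1 P2 P3 S :: complex
  assumes z: "z = q*Q*r"
    and P: "P1 = \<kappa>*q*\<beta>*(1-w)*(1-w^2*z^2)+(1-q*w*z)*(\<beta>*\<delta>*(\<kappa>+w*z)-q*w*(1+w*\<kappa>*z))"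
      "P2 = q^2*w^2*z*(1-w)*((\<kappa>-q)+w*z*(1-q*\<kappa>)) + q*w*(1-q*w*z)*(1-w^2*z^2)*(\<kappa>*q*\<beta>-\<delta>)
         - q*w*z*(1-w)*\<beta>*\<delta>*((1-q*\<kappa>)+w*z*(\<kappa>-q))"
      "P3 = q^3*w^3*(\<kappa>+w*z)*(1-q*w*z)-\<delta>*q^3*w^2*(1-w)*(1-w^2*z^2)-q^2*w^2*\<beta>*\<delta>*(1-q*w*z)*(1+w*\<kappa>*z)"
    and S: "S = (\<kappa>+\<delta>)*(1+\<beta>)*(1-q*z^2*w^2)*(1-q*z*w)*(1-z^2*w^2) - (1-\<beta>*\<delta>*z)*(\<kappa>+q*z*w)*(1-q*z*w^2)*(1-z^2*w^2)
        - (1-z)*(1+z*w*\<kappa>)*(\<beta>*\<delta>-q*z*w^2)*(1+z*w)*(1-q*z*w)"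
  shows "- q * ((1-q*z)*(1+q*z*w)*(1-q*z*w^2)*(1-z^2*w^2)) * ((1+\<delta>*r)*(\<kappa>*\<beta>-q*w*r)) * ((1+\<delta>*(q*r))*(\<kappa>*\<beta>-q*w*(q*r)))
   + q * S * ((1+\<delta>*r)*(\<kappa>*\<beta>-q*w*r)) * ((1-q*(q*r))*(1+w*(q*(q*r))))
   - (1+z*w*\<kappa>)*(\<kappa>+z*w)*(\<beta>*\<delta>-q*z*w^2)*(q-\<beta>*\<delta>*z)*(1-q*z*w) * ((1-q*r)*(1+w*(q*r)))*((1-q*(q*r))*(1+w*(q*(q*r))))
   = q * (((1+\<beta>*Q)*(\<delta>-q*w*\<kappa>*Q))*((1-q*(q*r))*(1+w*(q*(q*r)))) * (r*P1 + r^2*P2 + r^3*z*P3)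
     - ((1+\<delta>*r)*(\<kappa>*\<beta>-q*w*r))*((1-Q)*(1+w*Q)) * (q*r*P1 + (q*r)^2*P2 + (q*r)^3*z*P3))"
  unfolding S P unfolding z by algebra

lemma two_phi_certificate_edge:
  fixes \<beta> \<delta> w \<kappa> q z P1 P2 P3 S :: complex
  assumes P: "P1 = \<kappa>*q*\<beta>*(1-w)*(1-w^2*z^2)+(1-q*w*z)*(\<beta>*\<delta>*(\<kappa>+w*z)-q*w*(1+w*\<kappa>*z))"
      "P2 = q^2*w^2*z*(1-w)*((\<kappa>-q)+w*z*(1-q*\<kappa>)) + q*w*(1-q*w*z)*(1-w^2*z^2)*(\<kappa>*q*\<beta>-\<delta>)
         - q*w*z*(1-w)*\<beta>*\<delta>*((1-q*\<kappa>)+w*z*(\<kappa>-q))"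
      "P3 = q^3*w^3*(\<kappa>+w*z)*(1-q*w*z)-\<delta>*q^3*w^2*(1-w)*(1-w^2*z^2)-q^2*w^2*\<beta>*\<delta>*(1-q*w*z)*(1+w*\<kappa>*z)"
    and S: "S = (\<kappa>+\<delta>)*(1+\<beta>)*(1-q*z^2*w^2)*(1-q*z*w)*(1-z^2*w^2) - (1-\<beta>*\<delta>*z)*(\<kappa>+q*z*w)*(1-q*z*w^2)*(1-z^2*w^2)
        - (1-z)*(1+z*w*\<kappa>)*(\<beta>*\<delta>-q*z*w^2)*(1+z*w)*(1-q*z*w)"
  shows "- ((1-q*z)*(1+q*z*w)*(1-q*z*w^2)*(1-z^2*w^2)) * ((1+\<delta>)*(\<kappa>*\<beta>-q*w))
   - (1-q*z*w^2)*(1-z^2*w^2) * ((1+\<beta>*z)*(\<delta>-q*w*\<kappa>*z)) * ((1-q)*(1+w*q)) + S * ((1-q)*(1+w*q))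
   + (1-z)*(1+w*z) * (P1 + P2 + z*P3) = 0"
  unfolding S P by algebra

text \<open>Coefficients of 2phi1(-b/a, q s/(c d); -q s/(a c); q, q x/b).\<close>

definition two_phi_coeff :: "complex \<Rightarrow> complex \<Rightarrow> complex \<Rightarrow> complex \<Rightarrow> complex \<Rightarrow> complex \<Rightarrow> nat \<Rightarrow> complex" where
  "two_phi_coeff a b c d q s m = qpoch (- b / a) q m * qpoch (q * s / (c * d)) q m
     / (qpoch q q m * qpoch (- (q * s) / (a * c)) q m) * (q / b) ^ m"

text \<open>Coefficients of a product of two 2phi1 series. With r^2 = b d it is the generating
  function of Askey-Wilson polynomials with parameters -r/a, q s/(c r), -r/c, q s/(a r) at the point
  e^(i\<theta>) = b/r, where 2 cos \<theta> = (b + d)/r.\<close>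

definition two_phi_conv :: "complex \<Rightarrow> complex \<Rightarrow> complex \<Rightarrow> complex \<Rightarrow> complex \<Rightarrow> complex \<Rightarrow> nat \<Rightarrow> complex" where
  "two_phi_conv a b c d q s N = (\<Sum>m\<le>N. two_phi_coeff a b c d q s m * two_phi_coeff c d a b q s (N - m))"

lemma two_phi_coeff_0 [simp]: "two_phi_coeff a b c d q s 0 = 1"
  by (simp add: two_phi_coeff_def)

lemma two_phi_coeff_Suc:
  "two_phi_coeff a b c d q s (Suc m) = two_phi_coeff a b c d q s m *
     ((1 + b / a * q ^ m) * (1 - q * s / (c * d) * q ^ m) * (q / b))
     / ((1 - q * q ^ m) * (1 + s / (a * c) * (q * q ^ m)))"
  by (simp add: two_phi_coeff_def qpoch_Suc divide_inverse mult_ac)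

text \<open>Creative telescoping: the summands satisfy the recurrence up to the difference
  \<open>g (Suc m) - g m\<close>. Upper limits that depend on \<open>N\<close> leave boundary terms,
  which \<open>two_phi_certificate_edge\<close> balances against \<open>g N\<close>.\<close>

lemma two_phi_conv_three_term:
  fixes a b c d q s :: complex and N :: nat
  defines "w \<equiv> s / (a * c)" and "\<beta> \<equiv> b / a" and "\<delta> \<equiv> d / c" and "\<kappa> \<equiv> a / c" and "z \<equiv> q ^ N"
    and "\<mu> \<equiv> q * c / (b * d)"
  assumes nz: "a \<noteq> 0" "b \<noteq> 0" "c \<noteq> 0" "d \<noteq> 0" "q \<noteq> 0" and q: "norm q < 1"
    and gen: "\<And>j. 1 + w * q ^ j \<noteq> 0"
  shows "((1-q*z)*(1+q*z*w)*(1-q*z*w^2)*(1-z^2*w^2)) * two_phi_conv a b c d q s (Suc N) =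
     \<mu> * ((\<kappa>+\<delta>)*(1+\<beta>)*(1-q*z^2*w^2)*(1-q*z*w)*(1-z^2*w^2) - (1-\<beta>*\<delta>*z)*(\<kappa>+q*z*w)*(1-q*z*w^2)*(1-z^2*w^2)
        - (1-z)*(1+z*w*\<kappa>)*(\<beta>*\<delta>-q*z*w^2)*(1+z*w)*(1-q*z*w)) * two_phi_conv a b c d q s N
     - \<mu>^2 / q * ((1+z*w*\<kappa>)*(\<kappa>+z*w)*(\<beta>*\<delta>-q*z*w^2)*(q-\<beta>*\<delta>*z)*(1-q*z*w))
       * (if N = 0 then 0 else two_phi_conv a b c d q s (N - 1))"
    (is "?E0 * _ = \<mu> * ?S * _ - \<mu>^2 / q * ?G * _")
proof -
  define A where "A = two_phi_coeff a b c d q s"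
  define B where "B = two_phi_coeff c d a b q s"
  define P1 where "P1 = \<kappa>*q*\<beta>*(1-w)*(1-w^2*z^2)+(1-q*w*z)*(\<beta>*\<delta>*(\<kappa>+w*z)-q*w*(1+w*\<kappa>*z))"
  define P2 where "P2 = q^2*w^2*z*(1-w)*((\<kappa>-q)+w*z*(1-q*\<kappa>)) + q*w*(1-q*w*z)*(1-w^2*z^2)*(\<kappa>*q*\<beta>-\<delta>)
         - q*w*z*(1-w)*\<beta>*\<delta>*((1-q*\<kappa>)+w*z*(\<kappa>-q))"
  define P3 where "P3 = q^3*w^3*(\<kappa>+w*z)*(1-q*w*z)-\<delta>*q^3*w^2*(1-w)*(1-w^2*z^2)-q^2*w^2*\<beta>*\<delta>*(1-q*w*z)*(1+w*\<kappa>*z)"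
  define Y where "Y = (\<lambda>x. x * P1 + x^2 * P2 + x^3 * z * P3)"
  define E where "E = ?E0"
  define S where "S = ?S"
  define G where "G = ?G"
  \<comment> \<open>The rational certificate times the summand. Its factor \<open>1 - q^m\<close>
    gives \<open>g 0 = 0\<close>.\<close>
  define g where "g = (\<lambda>m. (1 - q^m) * (1 + w * q^m) * Y (q^(N-m)) * (A m * B (N-m)) / ((1 - q * q^(N-m)) * (1 + w * (q * q^(N-m)))))"
  have \<mu>0: "\<mu> \<noteq> 0" using nz by (simp add: \<mu>_def)
  have d0: "1 - q * q^j \<noteq> 0" "1 + w * (q * q^j) \<noteq> 0" for j
    using power_neq_1[OF q, of "Suc j"] gen[of "Suc j"] by simp_all
  have A_Suc: "A (Suc m) = A m * (\<mu> * ((1 + \<beta> * q^m) * (\<delta> - q * w * \<kappa> * q^m))) / ((1 - q * q^m) * (1 + w * (q * q^m)))" for m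
  proof -
    have "(1 - q * s / (c * d) * q ^ m) * (q / b) = \<mu> * (\<delta> - q * w * \<kappa> * q^m)"
      using nz by (simp add: \<mu>_def \<delta>_def w_def \<kappa>_def field_simps)
    then have "(1 + b / a * q ^ m) * (1 - q * s / (c * d) * q ^ m) * (q / b) = \<mu> * ((1 + \<beta> * q^m) * (\<delta> - q * w * \<kappa> * q^m))"
      unfolding \<beta>_def by (simp only: mult.assoc mult.left_commute[of \<mu>])
    then show ?thesis unfolding A_def two_phi_coeff_Suc by (simp only: w_def)
  qed
  have B_Suc: "B (Suc n) = B n * (\<mu> * ((1 + \<delta> * q^n) * (\<kappa> * \<beta> - q * w * q^n))) / ((1 - q * q^n) * (1 + w * (q * q^n)))" for n
  proof -
    have "(1 - q * s / (a * b) * q ^ n) * (q / d) = \<mu> * (\<kappa> * \<beta> - q * w * q^n)"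
      using nz by (simp add: \<mu>_def \<beta>_def w_def \<kappa>_def field_simps)
    then have "(1 + d / c * q ^ n) * (1 - q * s / (a * b) * q ^ n) * (q / d) = \<mu> * ((1 + \<delta> * q^n) * (\<kappa> * \<beta> - q * w * q^n))"
      unfolding \<delta>_def by (simp only: mult.assoc mult.left_commute[of \<mu>])
    then show ?thesis unfolding B_def two_phi_coeff_Suc by (simp only: w_def mult.commute[of c a])
  qed
  \<comment> \<open>The bound \<open>m < N\<close> keeps all three differences of natural numbers
    from being truncated.\<close>
  have step: "- (q / \<mu>^2) * E * (A m * B (Suc N - m)) + (q / \<mu>) * S * (A m * B (N - m)) - G * (A m * B (N - 1 - m))
      = (q / \<mu>) * (g (Suc m) - g m)" if m: "m < N" for m
  proof -
    define n where "n = N - 1 - m"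
    have n: "N - m = Suc n" "Suc N - m = Suc (Suc n)" "N - Suc m = n" "N = Suc (m + n)" using m by (auto simp: n_def)
    define Q where "Q = q^m"
    define r where "r = q^n"
    have zQr: "z = q * Q * r" by (simp add: z_def Q_def r_def n(4) power_add)
    have pw: "q^Suc m = q * Q" "q^Suc n = q * r" by (simp_all add: Q_def r_def)
    define a1 where "a1 = (1+\<beta>*Q)*(\<delta>-q*w*\<kappa>*Q)"
    define b1 where "b1 = (1+\<delta>*r)*(\<kappa>*\<beta>-q*w*r)"
    define b2 where "b2 = (1+\<delta>*(q*r))*(\<kappa>*\<beta>-q*w*(q*r))"
    define h1 where "h1 = (1 - q*Q)*(1 + w*(q*Q))"
    define d1 where "d1 = (1-q*r)*(1+w*(q*r))"
    define d2 where "d2 = (1-q*(q*r))*(1+w*(q*(q*r)))"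
    have nz': "h1 \<noteq> 0" "d1 \<noteq> 0" "d2 \<noteq> 0"
      using d0[of m] d0[of n] d0[of "Suc n"] by (simp_all add: h1_def d1_def d2_def Q_def r_def)
    have Am: "A (Suc m) = A m * (\<mu> * a1) / h1"
      unfolding A_Suc a1_def h1_def Q_def ..
    have B1: "B (Suc n) = B n * (\<mu> * b1) / d1"
      unfolding B_Suc b1_def d1_def r_def ..
    have B2: "B (Suc (Suc n)) = B n * (\<mu> * b1) / d1 * (\<mu> * b2) / d2"
      unfolding B_Suc[of "Suc n"] B1 pw b2_def d2_def ..
    have cert: "- q * E * b1 * b2 + q * S * b1 * d2 - G * d1 * d2 = q * (a1 * d2 * Y r - b1 * ((1-Q)*(1+w*Q)) * Y (q*r))"
      using two_phi_certificate[OF zQr P1_def P2_def P3_def refl]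
      unfolding E_def S_def G_def a1_def b1_def b2_def d1_def d2_def Y_def by simp
    have L: "- (q / \<mu>^2) * E * (A m * (B n * (\<mu> * b1) / d1 * (\<mu> * b2) / d2)) + (q / \<mu>) * S * (A m * (B n * (\<mu> * b1) / d1)) - G * (A m * B n)
       = (A m * B n) / (d1 * d2) * (- q * E * b1 * b2 + q * S * b1 * d2 - G * d1 * d2)"
      using nz' \<mu>0 by (simp add: field_simps power2_eq_square)
    have R: "(q / \<mu>) * (h1 * Y r * (A m * (\<mu> * a1) / h1 * B n) / d1 - (1-Q)*(1+w*Q) * Y (q*r) * (A m * (B n * (\<mu> * b1) / d1)) / d2)
       = (A m * B n) / (d1 * d2) * (q * (a1 * d2 * Y r - b1 * ((1-Q)*(1+w*Q)) * Y (q*r)))"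
      using nz' \<mu>0 by (simp add: field_simps)
    have "g (Suc m) = h1 * Y r * (A m * (\<mu> * a1) / h1 * B n) / d1"
      "g m = (1-Q)*(1+w*Q) * Y (q*r) * (A m * (B n * (\<mu> * b1) / d1)) / d2"
      unfolding g_def n(1-3) pw Am B1 h1_def d1_def d2_def Q_def r_def by simp_all
    then show ?thesis
      unfolding n(1,2) B2 B1 n_def[symmetric] using L R cert by simp
  qed
  define v2 where "v2 = (\<Sum>m<N. A m * B (Suc N - m))"
  define v1 where "v1 = (\<Sum>m<N. A m * B (N - m))"
  define v0 where "v0 = (\<Sum>m<N. A m * B (N - 1 - m))"
  have "- (q / \<mu>^2) * E * v2 + (q / \<mu>) * S * v1 - G * v0
      = (\<Sum>m<N. - (q / \<mu>^2) * E * (A m * B (Suc N - m)) + (q / \<mu>) * S * (A m * B (N - m)) - G * (A m * B (N - 1 - m)))"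
    unfolding v2_def v1_def v0_def sum_distrib_left sum_subtractf sum.distrib by simp
  also have "\<dots> = (q / \<mu>) * (\<Sum>m<N. g (Suc m) - g m)"
    unfolding sum_distrib_left by (intro sum.cong refl step) simp
  also have "(\<Sum>m<N. g (Suc m) - g m) = g N"
    by (simp add: sum_lessThan_telescope) (simp add: g_def)
  finally have sum: "- (q / \<mu>^2) * E * v2 + (q / \<mu>) * S * v1 - G * v0 = (q / \<mu>) * g N" .
  define e where "e = (1-q)*(1+w*q)"
  define b1 where "b1 = (1+\<delta>)*(\<kappa>*\<beta>-q*w)"
  define a1 where "a1 = (1+\<beta>*z)*(\<delta>-q*w*\<kappa>*z)"
  define h1 where "h1 = (1 - q*z)*(1 + w*(q*z))"
  define E' where "E' = (1-q*z*w^2)*(1-z^2*w^2)"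
  have e0: "e \<noteq> 0" "h1 \<noteq> 0" using d0[of 0] d0[of N] by (simp_all add: e_def h1_def z_def)
  have gN: "g N = (1-z)*(1+w*z) * (P1 + P2 + z*P3) * A N / e"
    by (simp add: g_def Y_def z_def e_def B_def)
  have B1: "B (Suc 0) = \<mu> * b1 / e" and AN: "A (Suc N) = A N * (\<mu> * a1) / h1"
    unfolding A_Suc B_Suc by (simp_all add: B_def b1_def e_def a1_def h1_def z_def)
  have E: "E = E' * h1" unfolding E_def E'_def h1_def by (simp only: mult_ac)
  have edge: "- E * b1 - E' * a1 * e + S * e + (1-z)*(1+w*z) * (P1 + P2 + z*P3) = 0"
    using two_phi_certificate_edge[OF P1_def P2_def P3_def refl]
    unfolding E_def E'_def a1_def b1_def e_def S_def by simp
  \<comment> \<open>The terms left out of \<open>v1\<close> and \<open>v2\<close> are those with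
    \<open>m = N\<close> and, in \<open>v2\<close>, also \<open>m = Suc N\<close>; \<open>v0\<close>
    is already complete.\<close>
  have edge': "- (q / \<mu>^2) * E * (A N * B (Suc 0) + A (Suc N)) + (q / \<mu>) * S * A N + (q / \<mu>) * g N = 0"
  proof -
    have "- (q / \<mu>^2) * E * (A N * B (Suc 0) + A (Suc N)) + (q / \<mu>) * S * A N + (q / \<mu>) * g N
      = q / \<mu> * A N / e * (- E * b1 - E' * a1 * e + S * e + (1-z)*(1+w*z) * (P1 + P2 + z*P3))"
      unfolding B1 AN gN E using e0 \<mu>0 by (simp add: field_simps power2_eq_square)
    then show ?thesis unfolding edge by simp
  qed
  have "two_phi_conv a b c d q s (Suc N) = v2 + A N * B (Suc 0) + A (Suc N)"
    by (simp add: two_phi_conv_def v2_def A_def B_def lessThan_Suc_atMost[symmetric] Suc_diff_le)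
  moreover have "two_phi_conv a b c d q s N = v1 + A N"
    by (simp add: two_phi_conv_def v1_def A_def B_def lessThan_Suc_atMost[symmetric])
  moreover have "(if N = 0 then 0 else two_phi_conv a b c d q s (N - 1)) = v0"
    by (cases N) (simp_all add: two_phi_conv_def v0_def A_def B_def lessThan_Suc_atMost)
  moreover have "E * (v2 + A N * B (Suc 0) + A (Suc N)) = \<mu> * S * (v1 + A N) - \<mu>^2 / q * G * v0"
  proof -
    have "- (q / \<mu>^2) * E * (v2 + (A N * B (Suc 0) + A (Suc N))) + (q / \<mu>) * S * (v1 + A N) - G * v0 = 0"
    proof -
      have "x * (u2 + t) + y * (u1 + u) - h * u0 = 0"
        if "x * u2 + y * u1 - h * u0 = k" "x * t + y * u + k = 0" for x y t k h u u0 u1 u2 :: complex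
      proof -
        have "x * (u2 + t) + y * (u1 + u) - h * u0 = (x * t + y * u) + (x * u2 + y * u1 - h * u0)"
          by (simp add: algebra_simps)
        then show ?thesis unfolding that by simp
      qed
      from this[OF sum edge'] show ?thesis .
    qed
    moreover have "\<mu>^2 / q * (- (q / \<mu>^2) * E * T + (q / \<mu>) * S * V - G * v0) = \<mu> * S * V - \<mu>^2 / q * G * v0 - E * T" for T V
      using \<mu>0 nz(5) by (simp add: field_simps power2_eq_square)
    ultimately have "\<mu> * S * (v1 + A N) - \<mu>^2 / q * G * v0 - E * (v2 + (A N * B (Suc 0) + A (Suc N))) = 0"
      by (metis mult_zero_right)
    then show ?thesis by (simp add: add.assoc)
  qed
  ultimately show ?thesis
    unfolding E_def S_def G_def by simp
qed

section \<open>The normalised connection coefficients\<close>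

text \<open>Collects the factors of \<open>c_o m n s\<close> that depend on \<open>m + n\<close>
  only, so that this is the sum of \<open>c_o m n s\<close> over \<open>m + n = N\<close>
  (\<open>aw_conn_eq_sum_c_o\<close>).\<close>

definition aw_conn :: "complex \<Rightarrow> complex \<Rightarrow> complex \<Rightarrow> complex \<Rightarrow> complex \<Rightarrow> complex \<Rightarrow> nat \<Rightarrow> complex" where
  "aw_conn a b c d q s N =
     qpoch s q N * qpoch (q * s\<^sup>2 / (a\<^sup>2 * c\<^sup>2)) q N * qpoch (- (q * s) / (a * c)) q N
     / (qpoch (q\<^sup>2 * s\<^sup>2 / (a * b * c * d)) q N * qpoch (q * s\<^sup>2 / (a\<^sup>2 * c\<^sup>2)) (q\<^sup>2) N)
     * two_phi_conv a b c d q s N"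

text \<open>Solved for the term with \<open>b + d\<close>: on the right side \<open>b\<close> and
  \<open>d\<close> enter the coefficients only through \<open>b * d\<close>, hidden in
  \<open>p\<close> and \<mu>.\<close>

lemma aw_conn_three_term:
  fixes a b c d q s :: complex and N :: nat
  defines "w \<equiv> s / (a * c)" and "p \<equiv> b * d / (a * c)" and "\<kappa> \<equiv> a / c" and "z \<equiv> q ^ N"
    and "\<mu> \<equiv> q * c / (b * d)"
  assumes nz: "a \<noteq> 0" "b \<noteq> 0" "c \<noteq> 0" "d \<noteq> 0" "q \<noteq> 0" and q: "norm q < 1"
    and gen: "\<And>j. 1 + w * q ^ j \<noteq> 0" "\<And>j. 1 - w * q ^ j \<noteq> 0" "\<And>j. 1 - w\<^sup>2 * q ^ j \<noteq> 0"
      "\<And>j. 1 - w\<^sup>2 / p * q ^ j \<noteq> 0" "\<And>j. 1 - s * q ^ j \<noteq> 0"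
  shows "(b + d) / c * aw_conn a b c d q s N =
      (1-q*z)*(1-w^2/p*q^2*z)/(\<mu>*(1-s*z)*(1-w*q*z)) * aw_conn a b c d q s (Suc N)
    + (- (\<kappa>+p) + (1-p*z)*(\<kappa>+q*z*w)*(1-w^2*q*z)/((1-w^2*q*z^2)*(1-w*q*z))
        + (1-z)*(1+z*w*\<kappa>)*(p-q*z*w^2)/((1-w^2*q*z^2)*(1-w*z))) * aw_conn a b c d q s N
    + (if N = 0 then 0 else
        \<mu>/q*p*(1+z*w*\<kappa>)*(\<kappa>+z*w)*(q-p*z)*(1-s*q^(N-1))*(1-w^2*z)/((1-w^2*(q*(q^(N-1))^2))*(1-w^2*q*z^2)*(1-w*z))
        * aw_conn a b c d q s (N-1))"
proof -
  define K where "K = (\<lambda>N. qpoch s q N * qpoch (q * s\<^sup>2 / (a\<^sup>2 * c\<^sup>2)) q N * qpoch (- (q * s) / (a * c)) q N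
     / (qpoch (q\<^sup>2 * s\<^sup>2 / (a * b * c * d)) q N * qpoch (q * s\<^sup>2 / (a\<^sup>2 * c\<^sup>2)) (q\<^sup>2) N))"
  define v where "v = two_phi_conv a b c d q s"
  have U: "aw_conn a b c d q s N = K N * v N" for N
    by (simp add: aw_conn_def K_def v_def)
  have p0: "p \<noteq> 0" "\<mu> \<noteq> 0" using nz by (simp_all add: p_def \<mu>_def)
  have K_Suc: "K (Suc N) = K N * ((1 - s * q^N) * (1 - w^2*(q*q^N)) * (1 + w*(q*q^N)))
      / ((1 - w^2/p*(q^2*q^N)) * (1 - w^2*(q*(q^N)^2)))" for N
  proof -
    have e: "q^N * (q * s\<^sup>2 / (a\<^sup>2 * c\<^sup>2)) = w^2*(q*q^N)" "1 - q^N * (- (q * s) / (a * c)) = 1 + w*(q*q^N)"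
      "q^N * (q\<^sup>2 * s\<^sup>2 / (a * b * c * d)) = w^2/p*(q^2*q^N)" "(q\<^sup>2)^N * (q * s\<^sup>2 / (a\<^sup>2 * c\<^sup>2)) = w^2*(q*(q^N)^2)"
      using nz by (simp_all add: w_def p_def power2_eq_square power_mult_distrib mult_ac)
    show ?thesis
      unfolding K_def qpoch_Suc e by (simp add: divide_inverse mult_ac)
  qed
  have bd: "b / a * (d / c) = p" using nz by (simp add: p_def)
  \<comment> \<open>The one coefficient in which \<open>b\<close> and \<open>d\<close> do not occur
    only as a product; expanding it isolates \<open>b + d\<close>.\<close>
  have bd': "(a / c + d / c) * (1 + b / a) = (b + d) / c + (\<kappa> + p)"
    using nz by (simp add: p_def \<kappa>_def field_simps)
  define D where "D = (1-w^2*q*z^2)*(1-w*q*z)*(1-w*z)*(1+w*z)"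
  have D0: "1-w^2*q*z^2 \<noteq> 0" "1-w*q*z \<noteq> 0" "1-w*z \<noteq> 0" "1+w*z \<noteq> 0" "1-w^2/p*q^2*z \<noteq> 0" "1-s*z \<noteq> 0" "1+w*q*z \<noteq> 0" "1-w^2*q*z \<noteq> 0"
    using gen(3)[of "2*N+1"] gen(2)[of "N+1"] gen(2)[of N] gen(1)[of N] gen(4)[of "N+2"] gen(5)[of N] gen(1)[of "N+1"] gen(3)[of "N+1"]
    by (simp_all add: z_def power_add power_mult power_even_eq mult_ac power2_eq_square)
  have three: "((1-q*z)*(1+w*q*z)*(1-w^2*q*z)*((1-w*z)*(1+w*z))) * v (Suc N) =
     \<mu> * ((b + d) / c * D + (\<kappa> + p) * D - (1-p*z)*(\<kappa>+q*z*w)*(1-w^2*q*z)*((1-w*z)*(1+w*z))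
        - (1-z)*(1+z*w*\<kappa>)*(p-q*z*w^2)*(1+w*z)*(1-w*q*z)) * v N
     - \<mu>^2 / q * ((1+z*w*\<kappa>)*(\<kappa>+z*w)*(p-q*z*w^2)*(q-p*z)*(1-w*q*z)) * (if N = 0 then 0 else v (N - 1))"
  proof -
    have f: "1-z^2*w^2 = (1-w*z)*(1+w*z)" "1+q*z*w = 1+w*q*z" "1-q*z*w^2 = 1-w^2*q*z" "1-q*z^2*w^2 = 1-w^2*q*z^2"
       "1-q*z*w = 1-w*q*z" "1+z*w = 1+w*z" by algebra+
    have D: "(a / c + d / c) * (1 + b / a) * (1-w^2*q*z^2)*(1-w*q*z)*((1-w*z)*(1+w*z)) = (b + d) / c * D + (\<kappa> + p) * D"
      unfolding bd' D_def by (simp only: mult.assoc distrib_right)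
    note T = two_phi_conv_three_term[OF nz q gen(1)[unfolded w_def], of N]
    show ?thesis
      using T unfolding w_def[symmetric] \<kappa>_def[symmetric] \<mu>_def[symmetric] z_def[symmetric] v_def[symmetric] bd f
      unfolding \<kappa>_def D unfolding \<kappa>_def[symmetric] .
  qed
  define t where "t = (if N = 0 then 0 else v (N - 1))"
  have div: "X * (K0 * v0) = n*t5/(\<mu>*t6*t2) * (K0 * (t6*t8*t7) / (t5*t1) * v1) + (- k + M1*t8/(t1*t2) + M2/(t1*t3)) * (K0 * v0)
      + \<mu>/q*G1*G3*G2/(t1*t3*t4) * K0 * vm"
    if three: "(n*t7*t8*(t3*t4)) * v1 = \<mu> * (X * (t1*t2*t3*t4) + k * (t1*t2*t3*t4) - M1*t8*(t3*t4) - M2*t4*t2) * v0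
        - \<mu>^2 / q * (G1*G3*G2*t2) * vm"
      and "t1 \<noteq> 0" "t2 \<noteq> 0" "t3 \<noteq> 0" "t4 \<noteq> 0" "t5 \<noteq> 0" "t6 \<noteq> 0"
    for X K0 v0 v1 vm n t1 t2 t3 t4 t5 t6 t7 t8 k M1 M2 G1 G2 G3 :: complex
  proof -
    have "n*t5/(\<mu>*t6*t2) * (K0 * (t6*t8*t7) / (t5*t1) * v1) = K0 / (\<mu>*t1*t2*(t3*t4)) * ((n*t7*t8*(t3*t4)) * v1)"
      using that(2-) p0 by (simp add: mult_ac)
    also have "\<dots> = X * (K0 * v0) + k * (K0 * v0) - M1*t8/(t1*t2) * (K0 * v0) - M2/(t1*t3) * (K0 * v0) - \<mu>/q*G1*G3*G2/(t1*t3*t4) * K0 * vm"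
    proof -
      have "K0 / (\<mu>*t1*t2*(t3*t4)) * (\<mu> * (X * (t1*t2*t3*t4) + k * (t1*t2*t3*t4) - m1 - m2) * v0 - \<mu>^2 / q * g * vm)
         = X * (K0 * v0) + k * (K0 * v0) - m1/(t1*t2*(t3*t4)) * (K0 * v0) - m2/(t1*t2*(t3*t4)) * (K0 * v0) - \<mu>/q*g/(t1*t2*(t3*t4)) * K0 * vm" for m1 m2 g
        using that p0 nz(5) by (simp add: field_simps power2_eq_square)
      from this[of "M1*t8*(t3*t4)" "M2*t4*t2" "G1*G3*G2*t2"] show ?thesis
        unfolding three using that by (simp add: mult_ac)
    qed
    finally show ?thesis by (simp add: algebra_simps)
  qed
  have g: "\<mu>/q*((1+z*w*\<kappa>)*(\<kappa>+z*w))*(p-q*z*w^2)*(q-p*z)/((1-w^2*q*z^2)*(1-w*z)*(1+w*z)) * K N * t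
    = (if N = 0 then 0 else
        \<mu>/q*p*(1+z*w*\<kappa>)*(\<kappa>+z*w)*(q-p*z)*(1-s*q^(N-1))*(1-w^2*z)/((1-w^2*(q*(q^(N-1))^2))*(1-w^2*q*z^2)*(1-w*z))
        * aw_conn a b c d q s (N-1))"
  proof (cases N)
    case (Suc n)
    have zn: "z = q * q^n" by (simp add: z_def Suc)
    have d: "1 - w^2/p*(q^2*q^n) \<noteq> 0" "1 - w^2*(q*(q^n)^2) \<noteq> 0"
    proof -
      have "q^(n+2) = q^2*q^n" "q^(2*n+1) = q*(q^n)^2" by (simp_all add: power_even_eq power2_eq_square)
      then show "1 - w^2/p*(q^2*q^n) \<noteq> 0" "1 - w^2*(q*(q^n)^2) \<noteq> 0"
        using gen(4)[of "n+2"] gen(3)[of "2*n+1"] by metis+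
    qed
    have e: "p-q*z*w^2 = p*(1 - w^2/p*(q^2*q^n))"
      using p0 by (simp add: zn field_simps power2_eq_square)
    have "x * y * (p * d1) * u / (t1*t3*t4) * (K0 * (s1*s2*t4) / (d1*d2)) * vm = x*p*y*u*s1*s2/(d2*t1*t3) * (K0 * vm)"
      if "d1 \<noteq> 0" "d2 \<noteq> 0" "t4 \<noteq> 0" for x y d1 d2 u t1 t3 t4 K0 s1 s2 vm :: complex
      using that by (simp add: mult_ac)
    from this[OF d D0(4), of "\<mu>/q" "(1+z*w*\<kappa>)*(\<kappa>+z*w)" "q-p*z" "1-w^2*q*z^2" "1-w*z" "K n" "1-s*q^n" "1-w^2*z" "v n"]
    show ?thesis
      unfolding U e t_def by (simp add: Suc K_Suc zn mult.assoc)
  qed (simp add: t_def)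
  have K1: "K (Suc N) = K N * ((1-s*z)*(1-w^2*q*z)*(1+w*q*z)) / ((1-w^2/p*q^2*z)*(1-w^2*q*z^2))"
    unfolding K_Suc z_def by (simp add: mult.assoc)
  show ?thesis
    using div[OF three[folded t_def, unfolded D_def] D0(1-6), of "K N", folded K1 U, unfolded g]
    by simp
qed

section \<open>The even eigenfunctions in the bidiagonalising functions\<close>

text \<open>Solution with value 1 at 0 of the recurrence in \<open>phi_series_kernel\<close> for (a,
  -a, c, -c). The off-diagonal entry has \<open>q^(2*k)\<close> in its denominator and the
  eigenvalue difference only \<open>q^k\<close>; the quotients accumulate to the triangular power of
  \<open>q\<close>.\<close>

definition aw_phi_coeff :: "complex \<Rightarrow> complex \<Rightarrow> complex \<Rightarrow> complex \<Rightarrow> nat \<Rightarrow> complex" where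
  "aw_phi_coeff a c q s k = qpoch s q k * qpoch (q * s / (a * c)) q k * qpoch (- (q * s) / (a * c)) q k * qpoch (- (q * s) / a\<^sup>2) q k
     / (qpoch q q k * qpoch (q\<^sup>2 * s\<^sup>2 / (a * c)\<^sup>2) q k) * (- a / s) ^ k / q ^ (k * (k - 1) div 2)"

text \<open>The relation that makes a single coefficient vanish in
  \<open>aw_conn_phi_recurrence\<close>; there \<open>z = q ^ N\<close>,
  \<open>\<phi> = w * z\<close> and \<open>Y = q ^ (Suc M - N)\<close>. With denominators cleared it
  is polynomial.\<close>

lemma bracket_identity:
  fixes \<kappa> \<phi> Y q z p :: complex
  assumes "1 - \<phi> \<noteq> 0" "1 - q*\<phi> \<noteq> 0" "1 - q*\<phi>^2 \<noteq> 0" "\<kappa> \<noteq> 0" "\<phi> \<noteq> 0" "Y \<noteq> 0" "q \<noteq> 0" "z \<noteq> 0"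
  shows "\<kappa>*(Y*z-1)*(\<phi>/z-p/(q*Y*\<phi>))*(1+Y*\<phi>)*(1+Y*\<phi>/\<kappa>)
    = 1/(Y*\<phi>) * (((Y*\<phi>+\<kappa>)*(1+p/(Y*\<phi>)) - (1-p*z)*(\<kappa>+q*\<phi>)*(1-q*\<phi>^2/z)/((1-q*\<phi>^2)*(1-q*\<phi>))
          - (1-z)*(1+\<phi>*\<kappa>)*(p-q*\<phi>^2/z)/((1-\<phi>)*(1-q*\<phi>^2))) * ((1-Y)*(1-q*Y*\<phi>^2)*Y*\<phi>/q)
        + \<kappa>/q*(1-z)*(p-q*\<phi>^2/z)*(1+\<phi>/\<kappa>)*(1-Y*\<phi>^2)*(1-q*Y*\<phi>^2)*Y/((1-\<phi>)*(1-q*\<phi>^2))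
        + (1+q*\<phi>*\<kappa>)*(1-p*z)*(1-q*\<phi>^2/z)*(1-Y)*(1-Y/q)*Y*\<phi>^2/((1-q*\<phi>)*(1-q*\<phi>^2)))"
proof -
  have "\<kappa>*(Y*z-1)*(q*Y*\<phi>^2-p*z)*(1+Y*\<phi>)*(\<kappa>+Y*\<phi>)*((1-\<phi>)*(1-q*\<phi>)*(1-q*\<phi>^2))
    = \<kappa>*(((Y*\<phi>+\<kappa>)*(Y*\<phi>+p)*z*((1-\<phi>)*(1-q*\<phi>)*(1-q*\<phi>^2)) - (1-p*z)*(\<kappa>+q*\<phi>)*(z-q*\<phi>^2)*Y*\<phi>*(1-\<phi>)
          - (1-z)*(1+\<phi>*\<kappa>)*(p*z-q*\<phi>^2)*Y*\<phi>*(1-q*\<phi>)) * ((1-Y)*(1-q*Y*\<phi>^2))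
        + (1-z)*(p*z-q*\<phi>^2)*(\<kappa>+\<phi>)*(1-Y*\<phi>^2)*(1-q*Y*\<phi>^2)*Y*(1-q*\<phi>)
        + (1+q*\<phi>*\<kappa>)*(1-p*z)*(z-q*\<phi>^2)*(1-Y)*(q-Y)*Y*\<phi>^2*(1-\<phi>))"
    by algebra
  note poly = this
  let ?D = "\<kappa>*q*Y*\<phi>*z*((1-\<phi>)*(1-q*\<phi>)*(1-q*\<phi>^2))"
  have e: "\<phi>/z-p/(q*Y*\<phi>) = (q*Y*\<phi>^2-p*z)/(q*Y*\<phi>*z)" "1+Y*\<phi>/\<kappa> = (\<kappa>+Y*\<phi>)/\<kappa>"
    "(Y*\<phi>+\<kappa>)*(1+p/(Y*\<phi>)) = (Y*\<phi>+\<kappa>)*(Y*\<phi>+p)/(Y*\<phi>)" "1-q*\<phi>^2/z = (z-q*\<phi>^2)/z" "p-q*\<phi>^2/z = (p*z-q*\<phi>^2)/z"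
    "1+\<phi>/\<kappa> = (\<kappa>+\<phi>)/\<kappa>" "1-Y/q = (q-Y)/q"
    using assms(4-) by (simp_all add: field_simps power2_eq_square)
  have R: "1/(Y*\<phi>) * ((A1/(Y*\<phi>) - A2*(A6/z)/(w3*w2) - A3*(A7/z)/(w1*w3)) * (B1*Y*\<phi>/q)
      + \<kappa>/q*A8*(A7/z)*(A9/\<kappa>)*A10*B2*Y/(w1*w3) + A11*A12*(A6/z)*A13*(A14/q)*Y*\<phi>^2/(w2*w3))
    = \<kappa>*((A1*z*(w1*w2*w3) - A2*A6*Y*\<phi>*w1 - A3*A7*Y*\<phi>*w2)*B1 + A8*A7*A9*A10*B2*Y*w2 + A11*A12*A6*A13*A14*Y*\<phi>^2*w1)
      / (\<kappa>*q*Y*\<phi>*z*(w1*w2*w3))"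
    if "w1 \<noteq> 0" "w2 \<noteq> 0" "w3 \<noteq> 0" for A1 A2 A3 A6 A7 A8 A9 A10 A11 A12 A13 A14 B1 B2 w1 w2 w3
    using that assms(4-) by (simp add: field_simps power2_eq_square)
  have "\<kappa>*(Y*z-1)*((q*Y*\<phi>^2-p*z)/(q*Y*\<phi>*z))*(1+Y*\<phi>)*((\<kappa>+Y*\<phi>)/\<kappa>)
      = \<kappa>*(Y*z-1)*(q*Y*\<phi>^2-p*z)*(1+Y*\<phi>)*(\<kappa>+Y*\<phi>)*((1-\<phi>)*(1-q*\<phi>)*(1-q*\<phi>^2)) / ?D"
    using assms by (simp add: mult_ac)
  then show ?thesis
    unfolding e poly R[OF assms(1-3), of "(Y*\<phi>+\<kappa>)*(Y*\<phi>+p)" "(1-p*z)*(\<kappa>+q*\<phi>)" "z-q*\<phi>^2" "(1-z)*(1+\<phi>*\<kappa>)" "p*z-q*\<phi>^2"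
      "(1-Y)*(1-q*Y*\<phi>^2)" "1-z" "\<kappa>+\<phi>" "1-Y*\<phi>^2" "1-q*Y*\<phi>^2" "1+q*\<phi>*\<kappa>" "1-p*z" "1-Y" "q-Y"]
    by (rule trans) (simp add: mult_ac)
qed

context
  fixes a c q s :: complex
  assumes nz: "a \<noteq> 0" "c \<noteq> 0" "q \<noteq> 0" "s \<noteq> 0" and q: "norm q < 1"
    and gen: "\<And>j. q ^ j * s \<noteq> 1" "\<And>j. q ^ j * s \<noteq> a * c" "\<And>j. q ^ j * s \<noteq> - (a * c)" "\<And>j. q ^ j * s \<noteq> - a\<^sup>2"
      "\<And>j. q ^ j * s\<^sup>2 \<noteq> (a * c)\<^sup>2"
begin

lemma aw_phi_coeff_0 [simp]: "aw_phi_coeff a c q s 0 = 1"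
  by (simp add: aw_phi_coeff_def)

lemma aw_phi_coeff_Suc:
  "aw_phi_coeff a c q s (Suc k) = aw_phi_coeff a c q s k *
     ((1 - q^k * s) * (1 - q^k * (q * s / (a * c))) * (1 + q^k * (q * s / (a * c))) * (1 + q^k * (q * s / a\<^sup>2)) * (- a / s))
     / ((1 - q^k * q) * (1 - q^k * (q\<^sup>2 * (s / (a * c))\<^sup>2)) * q^k)"
  unfolding aw_phi_coeff_def qpoch_Suc power_divide triangle_Suc by (simp add: power_add divide_inverse mult_ac)

lemma shifted_factors_nonzero:
  "1 - q^j * s \<noteq> 0" "1 - q^j * (s / (a*c)) \<noteq> 0" "1 + q^j * (s / (a*c)) \<noteq> 0" "1 + q^j * (s / a\<^sup>2) \<noteq> 0" "1 - q^j * (s/(a*c))\<^sup>2 \<noteq> 0"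
proof -
  show "1 - q^j * s \<noteq> 0" "1 - q^j * (s / (a*c)) \<noteq> 0" "1 - q^j * (s/(a*c))\<^sup>2 \<noteq> 0"
    using gen(1,2,5)[of j] nz by (simp_all add: power_divide divide_eq_1_iff)
  have "q^j * (s / (a*c)) \<noteq> - 1" "q^j * (s / a\<^sup>2) \<noteq> - 1"
    using gen(3,4)[of j] nz by (simp_all add: divide_eq_minus_1_iff)
  then show "1 + q^j * (s / (a*c)) \<noteq> 0" "1 + q^j * (s / a\<^sup>2) \<noteq> 0"
    by (simp_all add: add_eq_0_iff)
qed

text \<open>The step relation solved for the lower index. The factor \<open>1 - q^k\<close> accounts
  for the value 0 at \<open>k = 0\<close>.\<close>

lemma aw_phi_coeff_lower:
  "(if k = 0 then 0 else aw_phi_coeff a c q s (k - 1)) =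
     - ((1 - q^k) * (1 - q * q^k * (s/(a*c))\<^sup>2) * q^k * (s / a)) / (q * ((1 - q^k * s / q) * (1 - (q^k)\<^sup>2 * (s/(a*c))\<^sup>2) * (1 + q^k * s / a\<^sup>2)))
     * aw_phi_coeff a c q s k"
proof (cases k)
  case (Suc j)
  define J where "J = q^j"
  have J: "J \<noteq> 0" "q^k = q * J" using nz by (simp_all add: J_def Suc)
  have d: "1 - J * s \<noteq> 0" "1 - J * (q * s / (a*c)) \<noteq> 0" "1 + J * (q * s / (a*c)) \<noteq> 0" "1 + J * (q * s / a\<^sup>2) \<noteq> 0"
    "1 - J * q \<noteq> 0" "1 - J * (q\<^sup>2 * (s / (a*c))\<^sup>2) \<noteq> 0"
    using shifted_factors_nonzero(1)[of j] shifted_factors_nonzero(2-4)[of "Suc j"] shifted_factors_nonzero(5)[of "j+2"] power_neq_1[OF q, of "Suc j"]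
    by (simp_all add: J_def power_add mult_ac del: add_2_eq_Suc')
  have e: "1 - q * J * s / q = 1 - J * s" "1 - (q * J)\<^sup>2 * (s/(a*c))\<^sup>2 = (1 - J * (q * s / (a*c))) * (1 + J * (q * s / (a*c)))"
    "1 + q * J * s / a\<^sup>2 = 1 + J * (q * s / a\<^sup>2)" "1 - q * (q * J) * (s/(a*c))\<^sup>2 = 1 - J * (q\<^sup>2 * (s / (a*c))\<^sup>2)" "1 - q * J = 1 - J * q"
    using nz by (simp_all add: power2_eq_square algebra_simps)
  have "x = - (d5 * d6 * (q * J) * (s / a)) / (q * (d1 * (d2 * d3) * d4)) * (x * (d1 * d2 * d3 * d4 * (- a / s)) / (d5 * d6 * J))"
    if "d1 \<noteq> 0" "d2 \<noteq> 0" "d3 \<noteq> 0" "d4 \<noteq> 0" "d5 \<noteq> 0" "d6 \<noteq> 0" for x d1 d2 d3 d4 d5 d6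
    using that J nz by simp
  from this[OF d, of "aw_phi_coeff a c q s j"] show ?thesis
    unfolding J e unfolding Suc aw_phi_coeff_Suc J_def[symmetric] by simp
qed simp

text \<open>In \<open>aw_conn_phi_recurrence\<close> the index is \<open>M - N\<close> at
  \<open>q ^ N * s\<close>: raising \<open>N\<close> multiplies \<open>s\<close> by \<open>q\<close>
  and lowers the index by one, hence \<open>Suc k\<close> on the right.\<close>

lemma aw_phi_coeff_shift:
  "aw_phi_coeff a c q (q * s) k = aw_phi_coeff a c q s (Suc k) * ((1 - q^k * q) * (1 - q^3 * (s/(a*c))\<^sup>2) * (- s / a))
     / ((1 - q^k * (q^3 * (s/(a*c))\<^sup>2)) * (1 - s) * (1 + q * (s / a\<^sup>2)))"
proof -
  define x where "x = (s/(a*c))\<^sup>2"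
  have d: "1 - s \<noteq> 0" "1 - q * (s / (a*c)) \<noteq> 0" "1 + q * (s / (a*c)) \<noteq> 0" "1 + q * (s / a\<^sup>2) \<noteq> 0"
    "1 - q * q^k \<noteq> 0" "1 - q^2 * x \<noteq> 0" "1 - q * (q^2 * x) \<noteq> 0" "1 - q^k * (q^3 * x) \<noteq> 0"
    using shifted_factors_nonzero(1)[of 0] shifted_factors_nonzero(2-4)[of 1] shifted_factors_nonzero(5)[of 2] shifted_factors_nonzero(5)[of 3] shifted_factors_nonzero(5)[of "k+3"] power_neq_1[OF q, of "Suc k"]
    by (simp_all add: x_def power_add power2_eq_square power3_eq_cube mult_ac)
  have S: "qpoch (y) q (Suc k) = (1 - y) * qpoch (q * y) q k" for y by (rule qpoch_Suc_shift)
  have Q: "qpoch (q^4 * x) q k = qpoch (q^2 * x) q (Suc k) * (1 - q^k * (q^3 * x)) / ((1 - q^2 * x) * (1 - q * (q^2 * x)))"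
  proof -
    have "qpoch (q^2*x) q (Suc k) * (1 - q^k * (q^3 * x)) = qpoch (q^2*x) q (Suc (Suc k))"
      by (simp add: qpoch_Suc[of _ _ "Suc k"] power2_eq_square power3_eq_cube mult_ac)
    also have "\<dots> = (1 - q^2*x) * ((1 - q * (q^2 * x)) * qpoch (q * (q * (q^2 * x))) q k)"
      by (simp only: qpoch_Suc_shift)
    also have "q * (q * (q^2 * x)) = q^4 * x" by (simp add: power2_eq_square power4_eq_xxxx mult_ac)
    finally show ?thesis using d(6,7) by (simp add: eq_divide_eq mult_ac)
  qed
  have P: "qpoch q q (Suc k) = qpoch q q k * (1 - q^k * q)" by (rule qpoch_Suc)
  \<comment> \<open>The power \<open>q ^ k\<close> from replacing \<open>s\<close> by
    \<open>q * s\<close> raises the triangular exponent to that of \<open>Suc k\<close>.\<close>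
  have tri: "(- a / (q * s)) ^ k / q ^ (k * (k - 1) div 2) = (- a / s) ^ Suc k / q ^ (Suc k * (Suc k - 1) div 2) * (- s / a)"
  proof -
    have "(- a / (q * s)) ^ k * q ^ k = (- a / s) ^ k"
      using nz by (simp flip: power_mult_distrib)
    then have h: "(- a / (q * s)) ^ k = (- a / s) ^ k / q ^ k"
      using nz by (simp add: eq_divide_eq)
    have "(- a / s) * (- s / a) = 1" using nz by simp
    then have C: "(- a / s) ^ Suc k / m * (- s / a) = (- a / s) ^ k / m" for m
      by (simp only: power_Suc2 times_divide_eq_left mult.assoc mult_1_right)
    then show ?thesis unfolding h triangle_Suc power_add C by (simp add: mult.commute)
  qed
  have c1: "qpoch (q * s) q k = qpoch s q (Suc k) / (1 - s)"
    "qpoch (q * (q * s) / (a * c)) q k = qpoch (q * s / (a * c)) q (Suc k) / (1 - q * (s / (a*c)))"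
    "qpoch (- (q * (q * s)) / (a * c)) q k = qpoch (- (q * s) / (a * c)) q (Suc k) / (1 + q * (s / (a*c)))"
    "qpoch (- (q * (q * s)) / a\<^sup>2) q k = qpoch (- (q * s) / a\<^sup>2) q (Suc k) / (1 + q * (s / a\<^sup>2))"
    using d(1-4) unfolding S by simp_all
  have c2: "q\<^sup>2 * (q * s)\<^sup>2 / (a * c)\<^sup>2 = q^4 * x" "q\<^sup>2 * s\<^sup>2 / (a * c)\<^sup>2 = q\<^sup>2 * x"
    by (simp_all add: x_def power_divide power2_eq_square power4_eq_xxxx)
  have f: "1 - q^2 * x = (1 - q * (s / (a*c))) * (1 + q * (s / (a*c)))" "q * (q^2 * x) = q^3 * x"
    by (simp_all add: x_def power2_eq_square power3_eq_cube algebra_simps)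
  have "p1/e1 * (p2/e2) * (p3/e3) * (p4/e4) / (p5 * (p6 * e8 / (e2 * e3 * e7))) * t = p1*p2*p3*p4 / (p5 * e5 * p6) * u * (e5 * e7 * v) / (e8 * e1 * e4)"
    if "e2 \<noteq> 0" "e3 \<noteq> 0" "e5 \<noteq> 0" "t = u * v" for p1 p2 p3 p4 p5 p6 e1 e2 e3 e4 e5 e7 e8 t u v :: complex
    using that by (simp add: mult_ac)
  from this[OF d(2,3) _ tri, of "1 - q^k * q" "qpoch s q (Suc k)" "1 - s" "qpoch (q * s / (a * c)) q (Suc k)" "qpoch (- (q * s) / (a * c)) q (Suc k)"
      "qpoch (- (q * s) / a\<^sup>2) q (Suc k)" "1 + q * (s / a\<^sup>2)" "qpoch q q k" "qpoch (q^2*x) q (Suc k)" "1 - q^k * (q^3 * x)" "1 - q^3 * x"]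
  show ?thesis
    unfolding aw_phi_coeff_def c1 c2 Q f P x_def[symmetric] using d(5) by (simp add: mult.commute)
qed

end

section \<open>From the three-term to the first-order recurrence\<close>

text \<open>\<open>T M\<close> is the coefficient obtained by composing the two expansions. The
  recurrence \<open>three\<close> removes \<open>b + d\<close> from \<open>aw_lower\<close>; after
  reindexing, the factor of each \<open>aw_conn a b c d q s N\<close> vanishes by itself.\<close>

lemma aw_conn_phi_recurrence:
  fixes a b c d q s :: complex and M :: nat
  defines "T \<equiv> \<lambda>M. \<Sum>N\<le>M. aw_conn a b c d q s N * aw_phi_coeff a c q (q ^ N * s) (M - N)"
  assumes nz: "a \<noteq> 0" "b \<noteq> 0" "c \<noteq> 0" "d \<noteq> 0" "q \<noteq> 0" "s \<noteq> 0" and q: "norm q < 1"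
    and gen: "\<And>j. q ^ j * s \<noteq> 1" "\<And>j. q ^ j * s \<noteq> a * c" "\<And>j. q ^ j * s \<noteq> - (a * c)" "\<And>j. q ^ j * s \<noteq> - a\<^sup>2"
      "\<And>j. q ^ j * s\<^sup>2 \<noteq> (a * c)\<^sup>2" "\<And>j. q ^ j * s\<^sup>2 \<noteq> a * b * c * d"
  shows "T (Suc M) * (aw_eval (a*b*c*d) q (q ^ Suc M * s) - aw_eval (a*b*c*d) q s) + T M * aw_lower a b c d q (q ^ M * s) = 0"
proof -
  define w where "w = s / (a * c)"
  define p where "p = b * d / (a * c)"
  define \<kappa> where "\<kappa> = a / c"
  define \<mu> where "\<mu> = q * c / (b * d)"
  have nz': "w \<noteq> 0" "p \<noteq> 0" "\<kappa> \<noteq> 0" "\<mu> \<noteq> 0" using nz by (simp_all add: w_def p_def \<kappa>_def \<mu>_def)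
  define U where "U = aw_conn a b c d q s"
  define al where "al = (\<lambda>N. (1-q*q^N)*(1-w^2/p*q^2*q^N)/(\<mu>*(1-s*q^N)*(1-w*q*q^N)))"
  define be where "be = (\<lambda>N. - (\<kappa>+p) + (1-p*q^N)*(\<kappa>+q*q^N*w)*(1-w^2*q*q^N)/((1-w^2*q*(q^N)^2)*(1-w*q*q^N))
        + (1-q^N)*(1+q^N*w*\<kappa>)*(p-q*q^N*w^2)/((1-w^2*q*(q^N)^2)*(1-w*q^N)))"
  define ga where "ga = (\<lambda>N. \<mu>/q*p*(1+q^N*w*\<kappa>)*(\<kappa>+q^N*w)*(q-p*q^N)*(1-s*q^(N-1))*(1-w^2*q^N)/((1-w^2*(q*(q^(N-1))^2))*(1-w^2*q*(q^N)^2)*(1-w*q^N)))"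
  have genw: "1 + w * q ^ j \<noteq> 0" "1 - w * q ^ j \<noteq> 0" "1 - w\<^sup>2 * q ^ j \<noteq> 0" "1 - w\<^sup>2 / p * q ^ j \<noteq> 0" "1 - s * q ^ j \<noteq> 0" for j
  proof -
    have "w * q^j \<noteq> - 1" "w * q^j \<noteq> 1" "w\<^sup>2 * q^j \<noteq> 1" "w\<^sup>2 / p * q^j \<noteq> 1" "s * q^j \<noteq> 1"
      using gen(3,2,5,6,1)[of j] nz
      by (simp_all add: w_def p_def power_divide divide_eq_1_iff divide_eq_minus_1_iff mult_ac power_mult_distrib power2_eq_square)
    then show "1 + w * q ^ j \<noteq> 0" "1 - w * q ^ j \<noteq> 0" "1 - w\<^sup>2 * q ^ j \<noteq> 0" "1 - w\<^sup>2 / p * q ^ j \<noteq> 0" "1 - s * q ^ j \<noteq> 0"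
      by (simp_all add: add_eq_0_iff)
  qed
  have three: "(b + d) / c * U N = al N * U (Suc N) + be N * U N + (if N = 0 then 0 else ga N * U (N - 1))" for N
    using aw_conn_three_term[OF nz(1-5) q genw[unfolded w_def p_def], of N]
    unfolding U_def al_def be_def ga_def w_def p_def \<kappa>_def \<mu>_def by simp
  have genN: "q ^ j * (q ^ N * s) \<noteq> 1" "q ^ j * (q ^ N * s) \<noteq> a * c" "q ^ j * (q ^ N * s) \<noteq> - (a * c)" "q ^ j * (q ^ N * s) \<noteq> - a\<^sup>2"
      "q ^ j * (q ^ N * s)\<^sup>2 \<noteq> (a * c)\<^sup>2" for j N
  proof -
    have "q ^ j * (q ^ N * s) = q ^ (j + N) * s" "q ^ j * (q ^ N * s)\<^sup>2 = q ^ (j + 2 * N) * s\<^sup>2"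
      by (simp_all add: power_add power_mult_distrib power_even_eq)
    then show "q ^ j * (q ^ N * s) \<noteq> 1" "q ^ j * (q ^ N * s) \<noteq> a * c" "q ^ j * (q ^ N * s) \<noteq> - (a * c)" "q ^ j * (q ^ N * s) \<noteq> - a\<^sup>2"
      "q ^ j * (q ^ N * s)\<^sup>2 \<noteq> (a * c)\<^sup>2"
      using gen by metis+
  qed
  have nzN: "q ^ N * s \<noteq> 0" for N using nz by simp
  note lower = aw_phi_coeff_lower[OF nz(1,3,5) nzN q genN]
  note shift = aw_phi_coeff_shift[OF nz(1,3,5) nzN q genN]
  note Suc_k = aw_phi_coeff_Suc[OF nz(1,3,5) nzN q genN]
  note gs = shifted_factors_nonzero[OF nz(1,3,5) nzN q genN]
  define e where "e = aw_eval (a*b*c*d) q (q ^ Suc M * s) - aw_eval (a*b*c*d) q s"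
  define t where "t = q * (q ^ M * s) / a"
  define w0 where "w0 = (q ^ M * s - 1) * (1 - c / t)"
  have t0: "t \<noteq> 0" using nz by (simp add: t_def)
  \<comment> \<open>From \<open>t * (1 - b/t) * (1 - d/t) = t + b*d/t - (b + d)\<close>, so
    \<open>b + d\<close> occurs linearly.\<close>
  have low: "aw_lower a b c d q (q ^ M * s) = w0 * (t + b * d / t - c * ((b + d) / c))"
    unfolding aw_lower_def Let_def t_def[symmetric] w0_def using t0 nz by (simp add: field_simps)
  define x where "x = (\<lambda>N. aw_phi_coeff a c q (q ^ N * s) (M - N))"
  define X where "X = (\<lambda>N. aw_phi_coeff a c q (q ^ N * s) (Suc M - N))"
  \<comment> \<open>The factor of \<open>U N\<close> after reindexing. All values of
    \<open>x\<close> in it are rational multiples of \<open>X N\<close>, so the claim reduces to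
    \<open>bracket_identity\<close>.\<close>
  have bracket: "e * X N + w0 * (t + b * d / t) * (if N \<le> M then x N else 0)
      = w0 * c * ((if N = 0 then 0 else al (N - 1) * x (N - 1)) + be N * (if N \<le> M then x N else 0)
        + (if Suc N \<le> M then ga (Suc N) * x (Suc N) else 0))" if N: "N \<le> Suc M" for N
  proof -
    define k where "k = Suc M - N"
    define Y where "Y = q ^ k"
    define z where "z = q ^ N"
    define \<phi> where "\<phi> = w * z"
    define C where "C = X N"
    have Yz: "q ^ Suc M = Y * z" using N by (simp add: Y_def z_def k_def flip: power_add)
    have nn: "Y \<noteq> 0" "z \<noteq> 0" "\<phi> \<noteq> 0" using nz nz' by (simp_all add: Y_def z_def \<phi>_def)
    have s_eq: "s = a * c * w" "a = \<kappa> * c" using nz by (simp_all add: w_def \<kappa>_def)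
    have sg: "q ^ N * s / (a * c) = \<phi>" "q ^ N * s / a = c * \<phi>" "q ^ N * s / a\<^sup>2 = \<phi> / \<kappa>" "q ^ N * s = a * c * \<phi>"
      using nz nz' by (simp_all add: \<phi>_def z_def w_def \<kappa>_def power2_eq_square)
    have sg5: "x * (q ^ N * s) / a\<^sup>2 = x * (\<phi> / \<kappa>)" for x
      unfolding sg(3)[symmetric] by simp
    define D where "D = (1 - Y * (a * c * \<phi>) / q) * (1 - Y\<^sup>2 * \<phi>\<^sup>2) * (1 + Y * (\<phi> / \<kappa>))"
    define b1 where "b1 = 1 - Y * (a * c * \<phi>) / q"
    have QM: "q ^ M * s = Y * (a * c * \<phi>) / q"
    proof -
      have "q * q ^ M = Y * z" using Yz by simp
      then show ?thesis using nz by (simp add: \<phi>_def w_def field_simps)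
    qed
    have d: "1 - \<phi> \<noteq> 0" "1 - q*\<phi> \<noteq> 0" "1 - q*\<phi>^2 \<noteq> 0" "1 - Y*\<phi> \<noteq> 0" "1 + Y*\<phi> \<noteq> 0" "1 + Y*(\<phi>/\<kappa>) \<noteq> 0"
      "b1 \<noteq> 0" "1 - q*Y*\<phi>^2 \<noteq> 0"
      using gs(2)[of 0 N] gs(2)[of 1 N] gs(5)[of 1 N] gs(2)[of k N] gs(3)[of k N] gs(4)[of k N] gs(5)[of "Suc k" N] gen(1)[of M]
      unfolding sg(1-3) b1_def QM by (simp_all add: Y_def)
    have Y2: "1 - Y\<^sup>2 * \<phi>\<^sup>2 = (1 - Y*\<phi>) * (1 + Y*\<phi>)" by algebra
    have D0: "D \<noteq> 0" using d unfolding D_def Y2 b1_def[symmetric] by simp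
    have xk: "(if N \<le> M then x N else 0) = (if k = 0 then 0 else aw_phi_coeff a c q (q ^ N * s) (k - 1))"
      using N by (auto simp: x_def k_def)
    have CX: "aw_phi_coeff a c q (q ^ N * s) k = C" by (simp add: C_def X_def k_def)
    have xN: "(if N \<le> M then x N else 0) = - ((1-Y)*(1-q*Y*\<phi>^2)*Y*(c*\<phi>)) / (q*D) * C"
      unfolding xk lower CX Y_def[symmetric] D_def sg(1,2) sg5 unfolding sg(4) by simp
    \<comment> \<open>When \<open>Suc N\<close> exceeds \<open>M\<close>, that is for
      \<open>k = 0\<close> and \<open>k = 1\<close>, the right side vanishes through the factors
      \<open>1 - Y\<close> and \<open>1 - Y/q\<close>.\<close>
    have GA: "(if Suc N \<le> M then ga (Suc N) * x (Suc N) else 0)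
      = c*((1+q*\<phi>*\<kappa>)*(1-p*z)*(1-q*\<phi>^2/z)*(1-Y)*(1-Y/q)*Y*\<phi>^2)/((1-q*\<phi>)*(1-q*\<phi>^2)*D) * C"
    proof -
      define y where "y = (if N \<le> M then x N else 0)"
      have d3: "1 - q^3*\<phi>^2 \<noteq> 0" "1 - a*c*\<phi> \<noteq> 0" "1 + q*(\<phi>/\<kappa>) \<noteq> 0"
        using gs(5)[of 3 N] gs(1)[of 0 N] gs(4)[of 1 N] unfolding sg(1-3) unfolding sg(4) by simp_all
      have xS: "(if Suc N \<le> M then x (Suc N) else 0) = y * ((1 - Y/q) * (1 - q^3*\<phi>^2) * (- (c*\<phi>)))
          / ((1 - q*Y*\<phi>^2) * (1 - a*c*\<phi>) * (1 + q*(\<phi>/\<kappa>)))"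
      proof -
        consider "k = 0" | "k = 1" | i where "k = Suc (Suc i)"
          by (metis One_nat_def not0_implies_Suc)
        then show ?thesis
        proof cases
          case 1
          then show ?thesis using N by (simp add: y_def k_def)
        next
          case 2
          then have "Y = q" "\<not> Suc N \<le> M" using N by (auto simp: Y_def k_def)
          then show ?thesis using nz by simp
        next
          case (3 i)
          have i: "Suc N \<le> M" "M - Suc N = i" "M - N = Suc i" "N \<le> M" using 3 N by (auto simp: k_def)
          have Yi: "Y = q * (q * q^i)" by (simp add: Y_def 3)
          have "x (Suc N) = aw_phi_coeff a c q (q * (q ^ N * s)) i" unfolding x_def i by (simp add: mult.assoc)
          also have "\<dots> = x N * ((1 - q^i * q) * (1 - q^3 * \<phi>\<^sup>2) * (- (q ^ N * s) / a))
             / ((1 - q^i * (q^3 * \<phi>\<^sup>2)) * (1 - q ^ N * s) * (1 + q * (\<phi> / \<kappa>)))"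
            unfolding shift x_def i sg(1,3) ..
          finally show ?thesis
            using i nz nn unfolding y_def sg(4) Yi by (simp add: power2_eq_square power3_eq_cube mult_ac)
        qed
      qed
      have gaS: "ga (Suc N) = q*(1+q*\<phi>*\<kappa>)*(\<kappa>+q*\<phi>)*(1-p*z)*(1-a*c*\<phi>)*(1-q*\<phi>^2/z)/(a*((1-q*\<phi>^2)*(1-q^3*\<phi>^2)*(1-q*\<phi>)))"
      proof -
        have m: "\<mu> / q * p = 1 / a" using nz by (simp add: \<mu>_def p_def)
        have sz: "s * q^N = a*c*\<phi>" using sg(4) by (simp add: mult.commute)
        have f: "q^Suc N*w = q*\<phi>" "w^2*q^Suc N = q*\<phi>^2/z" "w^2*(q*(q^N)^2) = q*\<phi>^2" "w^2*q*(q^Suc N)^2 = q^3*\<phi>^2" "w*q^Suc N = q*\<phi>"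
          "q - p*q^Suc N = q*(1-p*z)"
          using nn nz by (simp_all add: \<phi>_def z_def power2_eq_square power3_eq_cube algebra_simps)
        show ?thesis
          unfolding ga_def diff_Suc_1 m sz f by (simp add: mult_ac)
      qed
      have kq: "\<kappa> + q*\<phi> = \<kappa> * (1 + q*(\<phi>/\<kappa>))" using nz' by (simp add: distrib_left)
      have cancel: "g1*g2*(\<kappa>*e3)*g4*g6*g5/(a*(h1*g3*h2)) * ((- (y1*g7*Y*(c*\<phi>)) / (q*D) * C) * (y2 * g3 * (- (c*\<phi>))) / (g7 * g6 * e3))
          = c*(g2*g4*g5*y1*y2*Y*\<phi>^2)/(h2*h1*D) * C"
        if "g3 \<noteq> 0" "g6 \<noteq> 0" "g7 \<noteq> 0" "e3 \<noteq> 0" "g1 = q" for g1 g2 g3 g4 g5 g6 g7 h1 h2 e3 y1 y2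
        using that nz by (simp add: s_eq(2) power2_eq_square) (simp add: \<kappa>_def mult_ac)
      have "ga (Suc N) * (if Suc N \<le> M then x (Suc N) else 0)
         = c*((1+q*\<phi>*\<kappa>)*(1-p*z)*(1-q*\<phi>^2/z)*(1-Y)*(1-Y/q)*Y*\<phi>^2)/((1-q*\<phi>)*(1-q*\<phi>^2)*D) * C"
        unfolding xS gaS y_def xN kq by (rule cancel[OF d3(1,2) d(8) d3(3) refl])
      moreover have "(if P then g * h else 0) = g * (if P then h else 0)" for P and g h :: complex by simp
      ultimately show ?thesis by (simp only:)
    qed
    \<comment> \<open>At \<open>N = 0\<close> the factor \<open>1 - z\<close> vanishes. Otherwise
      \<open>C\<close> is reached from \<open>x (N - 1)\<close> by one step in the index and one
      shift of the parameter \<open>r = q ^ (N-1) * s\<close>.\<close>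
    have AL: "(if N = 0 then 0 else al (N - 1) * x (N - 1))
      = c*(\<kappa>/q*(1-z)*(p-q*\<phi>^2/z)*(1+\<phi>/\<kappa>)*(1-Y*\<phi>^2)*(1-q*Y*\<phi>^2)*Y)/((1-\<phi>)*(1-q*\<phi>^2)*D) * C"
    proof (cases N)
      case 0
      then show ?thesis by (simp add: z_def)
    next
      case (Suc n)
      define r where "r = q ^ n * s"
      have r1: "q ^ N * s = q * r" "r \<noteq> 0" using nz by (simp_all add: r_def Suc mult.assoc)
      have "r = a * c * \<phi> / q" using sg(4) nz unfolding r1 by (simp add: eq_divide_eq mult.commute)
      note r = r1 sg(1,3)[unfolded r1] this
      have r': "q\<^sup>2 * (r / (a * c))\<^sup>2 = \<phi>\<^sup>2" "q^3 * (r / (a * c))\<^sup>2 = q * \<phi>\<^sup>2" "q * (r / a\<^sup>2) = \<phi> / \<kappa>"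
        unfolding r(4)[symmetric] unfolding r(3)[symmetric] by (simp_all add: power2_eq_square power3_eq_cube)
      have dr: "1 - Y * q \<noteq> 0" "1 - Y * \<phi>\<^sup>2 \<noteq> 0" "1 - r \<noteq> 0" "1 + \<phi> / \<kappa> \<noteq> 0"
      proof -
        show "1 - Y * q \<noteq> 0" using power_neq_1[OF q, of "Suc k"] by (simp add: Y_def mult.commute)
        have "q^(k+2) * (r / (a * c))\<^sup>2 = Y * \<phi>\<^sup>2" unfolding r'(1)[symmetric] by (simp add: Y_def power_add power2_eq_square)
        then show "1 - Y * \<phi>\<^sup>2 \<noteq> 0" using gs(5)[of "k+2" n] unfolding r_def[symmetric] by metis
        show "1 - r \<noteq> 0" using gs(1)[of 0 n] by (simp add: r_def)
        show "1 + \<phi> / \<kappa> \<noteq> 0" using gs(4)[of 1 n] unfolding r_def[symmetric] r'(3)[symmetric] by simp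
      qed
      have Mk: "M - n = k" "N - 1 = n" using Suc by (simp_all add: k_def)
      have xn: "x n = aw_phi_coeff a c q r k" by (simp add: x_def Mk r_def)
      have "C = aw_phi_coeff a c q (q * r) k" unfolding CX[symmetric] r(1) ..
      also have "\<dots> = aw_phi_coeff a c q r (Suc k) * ((1 - Y * q) * (1 - q * \<phi>\<^sup>2) * (- r / a)) / ((1 - Y * (q * \<phi>\<^sup>2)) * (1 - r) * (1 + \<phi> / \<kappa>))"
        unfolding r_def shift unfolding r_def[symmetric] r' Y_def ..
      also have "aw_phi_coeff a c q r (Suc k) = x n * ((1 - Y * r) * (1 - Y * \<phi>) * (1 + Y * \<phi>) * (1 + Y * (\<phi> / \<kappa>)) * (- a / r))
         / ((1 - Y * q) * (1 - Y * \<phi>\<^sup>2) * Y)"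
        unfolding r_def Suc_k unfolding r_def[symmetric] xn r(3,4) r' Y_def ..
      also have "1 - Y * r = b1" by (simp add: b1_def r(5))
      finally have C: "C = x n * (b1 * (1 - Y * \<phi>) * (1 + Y * \<phi>) * (1 + Y * (\<phi> / \<kappa>)) * (- a / r))
         / ((1 - Y * q) * (1 - Y * \<phi>\<^sup>2) * Y) * ((1 - Y * q) * (1 - q * \<phi>\<^sup>2) * (- r / a)) / ((1 - Y * (q * \<phi>\<^sup>2)) * (1 - r) * (1 + \<phi> / \<kappa>))" .
      have al: "al n = c * (\<kappa> / q) * ((1 - z) * (p - q*\<phi>^2/z)) / ((1 - r) * (1 - \<phi>))"
      proof -
        have f: "q * q^n = z" "s * q^n = r" "w * q * q^n = \<phi>" "w^2/p*q^2*q^n = q*\<phi>^2/z/p"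
          using nn nz by (simp_all add: z_def Suc r_def \<phi>_def power2_eq_square mult_ac)
        have "1 - q*\<phi>^2/z/p = (p - q*\<phi>^2/z) / p" using nz' by (simp add: diff_divide_distrib)
        moreover have "1 / (p * \<mu>) = c * (\<kappa> / q)" using nz by (simp add: p_def \<mu>_def \<kappa>_def)
        moreover have "y * (g / p) / (\<mu> * h * i) = 1 / (p * \<mu>) * (y * g) / (h * i)" for y g h i by simp
        ultimately show ?thesis unfolding al_def f by metis
      qed
      have cancel: "K * g / (g1 * h1) * y = K * g * g2 * g3 * g4 * Y / (h1 * h3 * (b1 * k1 * k2 * k3)) * (y * (b1 * k1 * k2 * k3 * (- a / r)) / (l * g3 * Y) * (l * h3 * (- r / a)) / (g4 * g1 * g2))"
        if "g2 \<noteq> 0" "g3 \<noteq> 0" "g4 \<noteq> 0" "h3 \<noteq> 0" "b1 \<noteq> 0" "k1 \<noteq> 0" "k2 \<noteq> 0" "k3 \<noteq> 0" "l \<noteq> 0"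
        for K g g1 g2 g3 g4 h1 h3 k1 k2 k3 l y
        using that nn nz r(2) by simp (simp add: mult_ac)
      have d8: "1 - Y * (q * \<phi>\<^sup>2) \<noteq> 0" using d(8) by (simp add: mult_ac)
      have "al n * x n = c * (\<kappa> / q) * ((1-z)*(p-q*\<phi>^2/z)) * (1+\<phi>/\<kappa>) * (1-Y*\<phi>^2) * (1-Y*(q*\<phi>^2)) * Y
          / ((1-\<phi>) * (1-q*\<phi>^2) * (b1 * (1-Y*\<phi>) * (1+Y*\<phi>) * (1+Y*(\<phi>/\<kappa>)))) * C"
        unfolding al C by (rule cancel[OF dr(4,2) d8 d(3,7,4,5,6) dr(1)])
      then show ?thesis
        unfolding Mk D_def Y2 b1_def[symmetric] by (simp add: Suc mult_ac)
    qed
    have BE: "be N = - (\<kappa>+p) + (1-p*z)*(\<kappa>+q*\<phi>)*(1-q*\<phi>^2/z)/((1-q*\<phi>^2)*(1-q*\<phi>)) + (1-z)*(1+\<phi>*\<kappa>)*(p-q*\<phi>^2/z)/((1-\<phi>)*(1-q*\<phi>^2))"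
      using nn unfolding be_def z_def[symmetric] \<phi>_def by (simp add: power2_eq_square mult_ac)
    have tY: "t = Y * c * \<phi>" using nz by (simp add: t_def QM)
    have w0: "w0 = b1 * (1 - Y*\<phi>) / (Y*\<phi>)"
      using nn nz unfolding w0_def QM b1_def tY by (simp add: field_simps)
    have bt: "b * d / t = c * (\<kappa> * p / (Y*\<phi>))" using nz nn by (simp add: tY p_def \<kappa>_def)
    have tt: "t + b * d / t = c * ((Y*\<phi>+\<kappa>)*(1+p/(Y*\<phi>)) - (\<kappa> + p))"
      unfolding bt unfolding tY using nn by (simp add: field_simps)
    have ee: "e = c\<^sup>2 * (\<kappa>*(Y*z-1)*(\<phi>/z-p/(q*Y*\<phi>)))"
    proof -
      have "b = p * a * c / d" using nz by (simp add: p_def)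
      then show ?thesis
        unfolding e_def Yz aw_eval_def using nz nz' nn
        by (simp add: \<phi>_def s_eq(1)) (simp add: s_eq(2) field_simps power2_eq_square)
    qed
    define B where "B = (Y*\<phi>+\<kappa>)*(1+p/(Y*\<phi>)) - (1-p*z)*(\<kappa>+q*\<phi>)*(1-q*\<phi>^2/z)/((1-q*\<phi>^2)*(1-q*\<phi>))
          - (1-z)*(1+\<phi>*\<kappa>)*(p-q*\<phi>^2/z)/((1-\<phi>)*(1-q*\<phi>^2))"
    have tb: "t + b * d / t = c * (be N + B)"
      unfolding tt BE B_def by simp
    have fin: "e0 = w1 * c * (c*x1/(m1*D) * C + bb * (- (x2*(c*\<phi>)) / (q*D) * C) + c*x3/(m2*D) * C)
        - w1 * (c * (bb + B)) * (- (x2*(c*\<phi>)) / (q*D) * C)"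
      if "e0 = w1 * c\<^sup>2 / D * (B * (x2*\<phi>/q) + x1/m1 + x3/m2) * C" for e0 w1 x1 m1 x2 x3 m2 bb
      unfolding that by (simp add: power2_eq_square divide_inverse inverse_mult_distrib algebra_simps)
    have id: "\<kappa>*(Y*z-1)*(\<phi>/z-p/(q*Y*\<phi>))*(1+Y*\<phi>)*(1+Y*\<phi>/\<kappa>) = 1/(Y*\<phi>) * (B * ((1-Y)*(1-q*Y*\<phi>^2)*Y*\<phi>/q)
        + \<kappa>/q*(1-z)*(p-q*\<phi>^2/z)*(1+\<phi>/\<kappa>)*(1-Y*\<phi>^2)*(1-q*Y*\<phi>^2)*Y/((1-\<phi>)*(1-q*\<phi>^2))
        + (1+q*\<phi>*\<kappa>)*(1-p*z)*(1-q*\<phi>^2/z)*(1-Y)*(1-Y/q)*Y*\<phi>^2/((1-q*\<phi>)*(1-q*\<phi>^2)))" (is "?l = 1/_ * ?K")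
      unfolding B_def by (rule bracket_identity) (use d nn nz nz' in simp_all)
    have "e * C = w0 * c\<^sup>2 / D * ?K * C"
    proof -
      have "?K = Y*\<phi> * ?l" unfolding id using nn by simp
      moreover have "w0 / D * (Y*\<phi> * ((1+Y*\<phi>)*(1+Y*\<phi>/\<kappa>))) = 1"
        unfolding w0 D_def Y2 b1_def[symmetric] using d nn by simp
      moreover have "w0 * c\<^sup>2 / D * (Y*\<phi> * (f*g*h)) = c\<^sup>2 * f * (w0 / D * (Y*\<phi> * (g*h)))" for f g h
        by simp
      ultimately show ?thesis unfolding ee by (simp only: mult_1_right)
    qed
    from fin[OF this, of "be N"] show ?thesis
      unfolding C_def[symmetric] xN GA AL tb by (simp add: algebra_simps)
  qed
  have T: "T M = (\<Sum>N\<le>M. U N * x N)" "T (Suc M) = (\<Sum>N\<le>Suc M. U N * X N)"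
    unfolding T_def U_def x_def X_def by simp_all
  define R where "R = (\<lambda>N. (if N = 0 then 0 else al (N - 1) * x (N - 1)) + be N * (if N \<le> M then x N else 0)
        + (if Suc N \<le> M then ga (Suc N) * x (Suc N) else 0))"
  \<comment> \<open>Reindexing makes \<open>U N\<close> the common factor of the three parts. The
    range grows to \<open>Suc M\<close> because \<open>al\<close> multiplies
    \<open>U (Suc N)\<close>.\<close>
  have s1: "(\<Sum>N\<le>M. al N * U (Suc N) * x N) = (\<Sum>N\<le>Suc M. U N * (if N = 0 then 0 else al (N - 1) * x (N - 1)))"
    by (subst sum.atMost_Suc_shift) (simp add: mult_ac)
  have s2: "(\<Sum>N\<le>M. be N * U N * x N) = (\<Sum>N\<le>Suc M. U N * (be N * (if N \<le> M then x N else 0)))"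
    by (simp add: mult_ac)
  have s3: "(\<Sum>N\<le>M. (if N = 0 then 0 else ga N * U (N - 1)) * x N) = (\<Sum>N\<le>Suc M. U N * (if Suc N \<le> M then ga (Suc N) * x (Suc N) else 0))"
  proof -
    have "(\<Sum>N\<le>M. (if N = 0 then 0 else ga N * U (N - 1)) * x N) = (\<Sum>N<M. U N * (ga (Suc N) * x (Suc N)))"
      by (subst sum.atMost_shift) (simp add: mult_ac)
    also have "\<dots> = (\<Sum>N\<le>Suc M. U N * (if Suc N \<le> M then ga (Suc N) * x (Suc N) else 0))"
      by (intro sum.mono_neutral_cong_left) auto
    finally show ?thesis .
  qed
  have "(\<Sum>N\<le>M. (b + d) / c * U N * x N) = (\<Sum>N\<le>Suc M. U N * R N)"
    unfolding three R_def distrib_right distrib_left sum.distrib s1 s2 s3 by simp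
  then have bd: "(b + d) / c * T M = (\<Sum>N\<le>Suc M. U N * R N)"
    unfolding T sum_distrib_left by (simp add: mult.assoc)
  have "T (Suc M) * e + T M * aw_lower a b c d q (q ^ M * s)
      = T (Suc M) * e + w0 * (t + b * d / t) * T M - w0 * c * ((b + d) / c * T M)"
    unfolding low by (simp add: algebra_simps)
  also have "\<dots> = (\<Sum>N\<le>Suc M. U N * (e * X N + w0 * (t + b * d / t) * (if N \<le> M then x N else 0) - w0 * c * R N))"
  proof -
    have "w0 * (t + b * d / t) * T M = (\<Sum>N\<le>Suc M. U N * (w0 * (t + b * d / t) * (if N \<le> M then x N else 0)))"
      unfolding T sum_distrib_left by (simp add: mult_ac)
    then show ?thesis
      unfolding bd unfolding T sum_distrib_left sum_distrib_right
      by (simp add: distrib_left right_diff_distrib sum.distrib sum_subtractf mult_ac del: sum.atMost_Suc)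
  qed
  also have "\<dots> = 0"
    by (intro sum.neutral ballI) (use bracket in \<open>simp add: R_def\<close>)
  finally show ?thesis unfolding e_def .
qed

section \<open>The expansion for general parameters\<close>

text \<open>The diagonal entry at \<open>n\<close> is
  \<open>(q^n - 1) * (q^(n+1) * s^2 - a*b*c*d) / (s * q^n)\<close>, which is \<open>q\<close> times
  the difference of the eigenvalues at \<open>q^n * s\<close> and \<open>s\<close>.\<close>

lemma aw_cleared_unique:
  assumes q: "q \<noteq> 0" "norm q < 1" and s: "s \<noteq> 0"
    and gen: "\<And>n. n > 0 \<Longrightarrow> q ^ Suc n * s\<^sup>2 \<noteq> a * b * c * d"
    and F: "aw_cleared a b c d q s F = 0" and G: "aw_cleared a b c d q s G = 0" and FG: "F $ 0 = G $ 0"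
  shows "F = G"
proof -
  define P where "P = a * b * c * d"
  have ev: "aw_num a b c d q $ 0 * (s * q ^ n - 1) + aw_num' a b c d q $ 0 * (inverse s * inverse q ^ n - 1)
      - (fps_const (aw_eval (a*b*c*d) q s) * aw_den q) $ 0 \<noteq> 0" if n: "n > 0" for n
  proof -
    have J: "q ^ n \<noteq> 0" "q ^ n \<noteq> 1" "q * q ^ n * s\<^sup>2 \<noteq> P"
      using q power_neq_1[OF q(2) n] gen[OF n] by (simp_all add: P_def)
    define K where "K = inverse (q ^ n)"
    have K: "K * q ^ n = 1" "inverse s * s = 1" using J s by (simp_all add: K_def)
    have "(s + P / (q * s) - 1 - P / q) * q = s * q + P * inverse s - q - P"
      using q s by (simp add: left_diff_distrib distrib_right) (simp add: divide_inverse)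
    moreover have "q * (s * J - 1) + P * (r * K - 1) - (s * q + P * r - q - P) = (J - 1) * (q * J * s\<^sup>2 - P) * (r * K)"
      if "K * J = 1" "r * s = 1" for J K r
    proof -
      have "(J - 1) * (q * J * s\<^sup>2 - P) * (r * K) = (J - 1) * (q * s * (K * J) * (r * s)) - P * r * (K * J) + P * r * K" by algebra
      then show ?thesis unfolding that by (simp add: algebra_simps)
    qed
    ultimately have "q * (s * q ^ n - 1) + P * (inverse s * K - 1) - aw_eval P q s * q
        = (q ^ n - 1) * (q * q ^ n * s\<^sup>2 - P) * (inverse s * K)"
      unfolding aw_eval_def by (metis K)
    moreover have "(q ^ n - 1) * (q * q ^ n * s\<^sup>2 - P) * (inverse s * K) \<noteq> 0"
      using J s by (simp add: K_def)
    moreover have "inverse q ^ n = K" by (simp add: K_def power_inverse)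
    ultimately have "q * (s * q ^ n - 1) + P * (inverse s * inverse q ^ n - 1) - aw_eval P q s * q \<noteq> 0"
      by metis
    then show ?thesis
      by (simp add: aw_num_def aw_num'_def aw_den_def P_def)
  qed
  have "qop (aw_num a b c d q) (aw_num' a b c d q) (fps_const (aw_eval (a*b*c*d) q s) * aw_den q) q s (F - G) = 0"
    using F G unfolding aw_cleared_def qop_diff by simp
  from qop_kernel_trivial[OF this _ ev] have "F - G = 0"
    using FG by simp
  then show ?thesis by simp
qed

text \<open>Both series lie in the kernel for (a, -a, c, -c) and have constant term 1; uniqueness
  then gives the transformation between them.\<close>

lemma phi_series_aw_phi_coeff:
  assumes nz: "a \<noteq> 0" "c \<noteq> 0" "q \<noteq> 0" "s \<noteq> 0" and q: "norm q < 1"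
    and gen: "\<And>j. q ^ j * s \<noteq> 1" "\<And>j. q ^ j * s \<noteq> a * c" "\<And>j. q ^ j * s \<noteq> - (a * c)" "\<And>j. q ^ j * s \<noteq> - a\<^sup>2"
      "\<And>j. q ^ j * s \<noteq> a\<^sup>2" "\<And>j. q ^ j * s\<^sup>2 \<noteq> (a * c)\<^sup>2" "\<And>j. q ^ j * s\<^sup>2 \<noteq> a\<^sup>2" "\<And>j. q ^ j * s\<^sup>2 \<noteq> 1"
  shows "phi_series a q s (aw_phi_coeff a c q s) = even_series (a\<^sup>2) (c\<^sup>2) q s oo fps_X ^ 2"
proof -
  have P: "a * - a * c * - c = (a * c)\<^sup>2" by (simp add: power2_eq_square mult_ac)
  have "aw_phi_coeff a c q s (Suc k) * (aw_eval (a * - a * c * - c) q (q ^ Suc k * s) - aw_eval (a * - a * c * - c) q s)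
      + aw_phi_coeff a c q s k * aw_lower a (- a) c (- c) q (q ^ k * s) = 0" for k
  proof -
    define J where "J = q ^ k"
    have J: "J \<noteq> 0" "1 - J * q \<noteq> 0" "1 - J * (q\<^sup>2 * (s / (a * c))\<^sup>2) \<noteq> 0"
      using nz power_neq_1[OF q, of "Suc k"] shifted_factors_nonzero(5)[OF nz q gen(1-4,6), of "k + 2"]
      by (simp_all add: J_def power_add power2_eq_square mult_ac)
    have ev: "aw_eval ((a * c)\<^sup>2) q (q * J * s) - aw_eval ((a * c)\<^sup>2) q s
        = (1 - J * q) * (1 - J * (q\<^sup>2 * (s / (a * c))\<^sup>2)) * ((a * c)\<^sup>2 / (q\<^sup>2 * J * s))"
      using nz J(1) by (simp add: aw_eval_def field_simps power2_eq_square)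
    have lo: "aw_lower a (- a) c (- c) q (J * s)
        = (1 - J * s) * (1 - J * (q * s / (a * c))) * (1 + J * (q * s / (a * c))) * (1 + J * (q * s / a\<^sup>2)) * (a^3 * c\<^sup>2 / (q\<^sup>2 * J\<^sup>2 * s\<^sup>2))"
    proof -
      define t where "t = q * (J * s) / a"
      have t: "t \<noteq> 0" "J * (q * s / (a * c)) = t / c" "J * (q * s / a\<^sup>2) = t / a" "a^3 * c\<^sup>2 / (q\<^sup>2 * J\<^sup>2 * s\<^sup>2) = a * c\<^sup>2 / t\<^sup>2"
        using nz J(1) by (simp_all add: t_def power2_eq_square power3_eq_cube mult_ac)
      have "t * (1 - - a / t) = a * (1 + t / a)" "(1 - c / t) * (1 - - c / t) = - ((1 - t / c) * (1 + t / c) * (c\<^sup>2 / t\<^sup>2))"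
        using t(1) nz by (simp_all add: field_simps power2_eq_square)
      moreover have "(J * s - 1) * u * x * y * z = (1 - J * s) * m * n * k * (a * c\<^sup>2 / t\<^sup>2)"
        if "u * x = a * k" "y * z = - (m * n * (c\<^sup>2 / t\<^sup>2))" for u x y z m n k
      proof -
        have "(J * s - 1) * u * x * y * z = (J * s - 1) * (u * x) * (y * z)" by simp
        also have "\<dots> = (1 - J * s) * m * n * k * (a * (c\<^sup>2 / t\<^sup>2))" unfolding that by algebra
        finally show ?thesis by simp
      qed
      ultimately show ?thesis
        unfolding t aw_lower_def Let_def t_def[symmetric] by blast
    qed
    have "x * (g * (- a / s)) / (e1 * e2 * J) * (e1 * e2 * ((a * c)\<^sup>2 / (q\<^sup>2 * J * s))) + x * (g * (a^3 * c\<^sup>2 / (q\<^sup>2 * J\<^sup>2 * s\<^sup>2))) = 0"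
      if "e1 \<noteq> 0" "e2 \<noteq> 0" for x g e1 e2
      using that nz J(1) by (simp add: power2_eq_square power3_eq_cube mult_ac)
    from this[OF J(2,3)] show ?thesis
      unfolding P aw_phi_coeff_Suc[OF nz q gen(1-4,6)] power_Suc J_def[symmetric] ev lo by blast
  qed
  then have "aw_cleared a (- a) c (- c) q s (phi_series a q s (aw_phi_coeff a c q s)) = 0"
    by (intro phi_series_kernel nz q)
  moreover have "aw_cleared a (- a) c (- c) q s (even_series (a\<^sup>2) (c\<^sup>2) q s oo fps_X ^ 2) = 0"
    using gen by (intro aw_cleared_even_series nz q) (simp_all add: power_mult_distrib)
  moreover have "phi_series a q s (aw_phi_coeff a c q s) $ 0 = (even_series (a\<^sup>2) (c\<^sup>2) q s oo fps_X ^ 2) $ 0"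
    using aw_phi_coeff_0[OF nz q gen(1-4,6)]
    by (simp add: phi_series_def even_series_def even_conn_def)
  moreover have "q ^ Suc n * s\<^sup>2 \<noteq> a * - a * c * - c" for n
    unfolding P by (rule gen(6))
  ultimately show ?thesis
    by (metis aw_cleared_unique[OF nz(3) q nz(4)])
qed

lemma c_e_eq: "c_e a c q k l s = even_conn (a\<^sup>2) (c\<^sup>2) q s l * rogers_coeff (a\<^sup>2) q ((q\<^sup>2) ^ l * s) k"
proof -
  have e: "((q\<^sup>2) ^ l * s)\<^sup>2 = q^(4*l) * s\<^sup>2" "q\<^sup>2 * (q^(4*l) * s\<^sup>2) / a\<^sup>2 = q^(4*l+2) * s\<^sup>2 / a\<^sup>2" "(a\<^sup>2)\<^sup>2 = a^4"
    by (simp_all add: power_mult_distrib mult_ac flip: power_mult) (simp add: power_add power2_eq_square)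
  show ?thesis
    unfolding c_e_def even_conn_def rogers_coeff_def e by (simp only: mult_ac)
qed

text \<open>Factorials of length \<open>m + n\<close> split by \<open>qpoch_add\<close>. The part
  \<open>qpoch (- (q * s) / (a * c)) q m\<close> is cancelled against a denominator of
  \<open>two_phi_coeff\<close>, which is where the assumption enters.\<close>

lemma aw_conn_eq_sum_c_o:
  assumes "\<And>n. qpoch (- (q * s) / (a * c)) q n \<noteq> 0"
  shows "aw_conn a b c d q s N = (\<Sum>m\<le>N. c_o a b c d q m (N - m) s)"
proof -
  have "qpoch s q (m + n) * qpoch (q * s\<^sup>2 / (a\<^sup>2 * c\<^sup>2)) q (m + n) * qpoch (- (q * s) / (a * c)) q (m + n)
     / (qpoch (q\<^sup>2 * s\<^sup>2 / (a * b * c * d)) q (m + n) * qpoch (q * s\<^sup>2 / (a\<^sup>2 * c\<^sup>2)) (q\<^sup>2) (m + n))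
     * (two_phi_coeff a b c d q s m * two_phi_coeff c d a b q s n) = c_o a b c d q m n s" for m n
  proof -
    have e: "q ^ m * (q * s\<^sup>2 / (a\<^sup>2 * c\<^sup>2)) = q^(m+1) * s\<^sup>2 / (a\<^sup>2 * c\<^sup>2)" "q ^ m * (- (q * s) / (a * c)) = - (q^(m+1) * s) / (a * c)"
      "q ^ m * (q\<^sup>2 * s\<^sup>2 / (a * b * c * d)) = q^(m+2) * s\<^sup>2 / (a * b * c * d)"
      "(q\<^sup>2) ^ m * (q * s\<^sup>2 / (a\<^sup>2 * c\<^sup>2)) = q^(2*m+1) * s\<^sup>2 / (a\<^sup>2 * c\<^sup>2)"
      by (simp_all add: power_add power_mult power2_eq_square power_mult_distrib mult_ac)
    have "k1 * k2 * (k3 * k4) * (p * k5) / (k6 * k7 * (k8 * k9)) * (t1 * t2 / (t3 * p) * t4 * (u1 * u2 / (u3 * u4) * u5))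
        = t1 * k1 * t2 * k3 / (t3 * k6 * k8) * t4 * (u1 * k2 * u2 * k5 * k4 / (u3 * k7 * u4 * k9)) * u5"
      if "p \<noteq> 0" for p k1 k2 k3 k4 k5 k6 k7 k8 k9 t1 t2 t3 t4 u1 u2 u3 u4 u5 :: complex
      using that by (simp add: mult_ac)
    from this[OF assms[of m]] show ?thesis
      unfolding qpoch_add e two_phi_coeff_def c_o_def mult.commute[of c a] by (rule trans[rotated]) (simp add: mult_ac)
  qed
  note t = this
  show ?thesis
    unfolding aw_conn_def two_phi_conv_def sum_distrib_left
  proof (rule sum.cong[OF refl])
    fix m assume "m \<in> {..N}"
    then show "qpoch s q N * qpoch (q * s\<^sup>2 / (a\<^sup>2 * c\<^sup>2)) q N * qpoch (- (q * s) / (a * c)) q N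
       / (qpoch (q\<^sup>2 * s\<^sup>2 / (a * b * c * d)) q N * qpoch (q * s\<^sup>2 / (a\<^sup>2 * c\<^sup>2)) (q\<^sup>2) N)
       * (two_phi_coeff a b c d q s m * two_phi_coeff c d a b q s (N - m)) = c_o a b c d q m (N - m) s"
      using t[of m "N - m"] by simp
  qed
qed

definition aw_series :: "complex \<Rightarrow> complex \<Rightarrow> complex \<Rightarrow> complex \<Rightarrow> complex \<Rightarrow> complex \<Rightarrow> complex fps" where
  "aw_series a b c d q s = Abs_fps (\<lambda>N. \<Sum>(k, l, m, n) \<in> {(k, l, m, n). 2*k + 2*l + m + n = N}.
     c_e a c q k l (q^(m+n) * s) * c_o a b c d q m n s)"

text \<open>Groups the fourfold sum by \<open>j = m + n\<close>; the remaining degree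
  \<open>N - j = 2 * (k + l)\<close> is even, which matches composition with
  \<open>fps_X ^ 2\<close>.\<close>

lemma aw_series_nth_conv:
  assumes "\<And>n. qpoch (- (q * s) / (a * c)) q n \<noteq> 0"
  shows "aw_series a b c d q s $ N =
    (\<Sum>j\<le>N. aw_conn a b c d q s j * (even_series (a\<^sup>2) (c\<^sup>2) q (q ^ j * s) oo fps_X ^ 2) $ (N - j))"
proof -
  let ?f = "\<lambda>j m l. c_o a b c d q m (j - m) s * c_e a c q ((N - j) div 2 - l) l (q ^ j * s)"
  define S where "S = (\<lambda>j. if even (N - j) then {..(N - j) div 2} else {})"
  have [simp]: "finite (S j)" for j by (simp add: S_def)
  have "aw_conn a b c d q s j * (even_series (a\<^sup>2) (c\<^sup>2) q (q ^ j * s) oo fps_X ^ 2) $ (N - j)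
      = (\<Sum>m\<le>j. \<Sum>l\<in>S j. ?f j m l)" for j
    unfolding S_def aw_conn_eq_sum_c_o[OF assms] fps_nth_compose_X_power even_series_def c_e_eq
    by (simp add: sum_product)
  then have "(\<Sum>j\<le>N. aw_conn a b c d q s j * (even_series (a\<^sup>2) (c\<^sup>2) q (q ^ j * s) oo fps_X ^ 2) $ (N - j))
      = (\<Sum>(j, m, l)\<in>(SIGMA j:{..N}. SIGMA m:{..j}. S j). ?f j m l)"
    by (simp add: sum.Sigma split_def)
  also have "\<dots> = (\<Sum>(k, l, m, n) \<in> {(k, l, m, n). 2*k + 2*l + m + n = N}.
     c_e a c q k l (q^(m+n) * s) * c_o a b c d q m n s)"
    by (rule sum.reindex_bij_witness[where j = "\<lambda>(j, m, l). ((N - j) div 2 - l, l, m, j - m)" and i = "\<lambda>(k, l, m, n). (m + n, m, l)"])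
      (auto simp: S_def split: if_splits, presburger+)
  finally show ?thesis by (simp add: aw_series_def)
qed

text \<open>Inserting the expansion of every even eigenfunction and collecting the total index gives
  a \<open>phi_series\<close>, whose coefficients satisfy the recurrence of
  \<open>phi_series_kernel\<close>.\<close>

lemma aw_cleared_aw_series:
  assumes nz: "a \<noteq> 0" "b \<noteq> 0" "c \<noteq> 0" "d \<noteq> 0" "q \<noteq> 0" "s \<noteq> 0" and q: "norm q < 1"
    and gen: "\<And>j. q ^ j * s \<noteq> 1" "\<And>j. q ^ j * s \<noteq> a * c" "\<And>j. q ^ j * s \<noteq> - (a * c)" "\<And>j. q ^ j * s \<noteq> - a\<^sup>2"
      "\<And>j. q ^ j * s \<noteq> a\<^sup>2" "\<And>j. q ^ j * s\<^sup>2 \<noteq> (a * c)\<^sup>2" "\<And>j. q ^ j * s\<^sup>2 \<noteq> a\<^sup>2" "\<And>j. q ^ j * s\<^sup>2 \<noteq> 1"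
      "\<And>j. q ^ j * s\<^sup>2 \<noteq> a * b * c * d"
  shows "aw_cleared a b c d q s (aw_series a b c d q s) = 0"
proof -
  define T where "T = (\<lambda>M. \<Sum>N\<le>M. aw_conn a b c d q s N * aw_phi_coeff a c q (q ^ N * s) (M - N))"
  have even: "even_series (a\<^sup>2) (c\<^sup>2) q (q ^ N * s) oo fps_X ^ 2 = phi_series a q (q ^ N * s) (aw_phi_coeff a c q (q ^ N * s))" for N
  proof -
    have "q ^ j * (q ^ N * s) = q ^ (j + N) * s" "q ^ j * (q ^ N * s)\<^sup>2 = q ^ (j + N + N) * s\<^sup>2" for j
      by (simp_all add: power_add power2_eq_square mult_ac)
    note e = this
    have "q ^ N * s \<noteq> 0" using nz by simp
    from phi_series_aw_phi_coeff[OF nz(1,3,5) this q] show ?thesis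
      unfolding e using gen by metis
  qed
  have "qpoch (- (q * s) / (a * c)) q n \<noteq> 0" for n
    unfolding qpoch_neq_0_iff
  proof (intro allI impI)
    fix i
    have "q ^ i * (- (q * s) / (a * c)) = - (q ^ Suc i * s) / (a * c)" by simp
    then show "q ^ i * (- (q * s) / (a * c)) \<noteq> 1"
      using gen(3)[of "Suc i"] nz by (metis divide_eq_1_iff minus_equation_iff)
  qed
  note conv = aw_series_nth_conv[OF this]
  have "aw_series a b c d q s = phi_series a q s T"
  proof (rule fps_ext)
    fix n
    let ?g = "\<lambda>j i. aw_conn a b c d q s j * aw_phi_coeff a c q (q ^ j * s) (i - j) * aw_phi a q (q ^ i * s) $ (n - i)"
    have "aw_series a b c d q s $ n = (\<Sum>j\<le>n. \<Sum>i\<le>n-j. ?g j (i + j))"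
      unfolding conv even phi_series_def by (simp add: sum_distrib_left power_add mult_ac diff_diff_left add.commute)
    also have "\<dots> = (\<Sum>(j, i)\<in>(SIGMA j:{..n}. {..n-j}). ?g j (i + j))" by (simp add: sum.Sigma)
    also have "\<dots> = (\<Sum>(i, j)\<in>(SIGMA i:{..n}. {..i}). ?g j i)"
      by (rule sum.reindex_bij_witness[where j = "\<lambda>(j, i). (i + j, j)" and i = "\<lambda>(i, j). (j, i - j)"]) auto
    also have "\<dots> = (\<Sum>i\<le>n. \<Sum>j\<le>i. ?g j i)" by (simp add: sum.Sigma)
    also have "\<dots> = phi_series a q s T $ n"
      by (simp add: phi_series_def T_def sum_distrib_right)
    finally show "aw_series a b c d q s $ n = phi_series a q s T $ n" .
  qed
  moreover have "aw_cleared a b c d q s (phi_series a q s T) = 0"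
    unfolding T_def
    by (intro phi_series_kernel aw_conn_phi_recurrence nz q) (use gen in auto)
  ultimately show ?thesis by simp
qed

section \<open>Continuity in s and removal of the exceptional values\<close>

lemma tendsto_qpoch [tendsto_intros]:
  assumes "(X \<longlongrightarrow> x) F"
  shows "((\<lambda>s. qpoch (X s) p n) \<longlongrightarrow> qpoch x p n) F"
  unfolding qpoch_def by (intro tendsto_intros assms)

text \<open>A nonzero value would persist on a disc, which contains an uncountable horizontal
  segment.\<close>

lemma isCont_zero_off_countable:
  fixes f :: "complex \<Rightarrow> complex"
  assumes "isCont f z" and "countable {s. f s \<noteq> 0}"
  shows "f z = 0"
proof (rule ccontr)
  assume "f z \<noteq> 0"
  with assms(1) have "eventually (\<lambda>s. f s \<noteq> 0) (nhds z)"
    by (simp add: isCont_def tendsto_imp_eventually_ne eventually_nhds_conv_at)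
  then obtain e where e: "e > 0" "\<And>s. dist s z < e \<Longrightarrow> f s \<noteq> 0"
    unfolding eventually_nhds_metric by blast
  let ?g = "\<lambda>t. z + complex_of_real t"
  have "?g ` {0<..<e} \<subseteq> {s. f s \<noteq> 0}"
    using e(2) by (auto simp: dist_norm)
  then have "countable (?g ` {0<..<e})"
    using assms(2) countable_subset by blast
  moreover have "inj_on ?g {0<..<e}" by (auto simp: inj_on_def)
  ultimately have "countable {0<..<e}"
    using countable_image_inj_on by blast
  then show False using uncountable_open_interval[of 0 e] e(1) by simp
qed

lemma finite_monomial_level:
  fixes C x :: complex
  assumes "C \<noteq> 0" "k > 0"
  shows "finite {s. C * s ^ k = x}"
proof -
  have "{s. C * s ^ k = x} = {s. s ^ k = x / C}"
    using assms(1) by (auto simp: field_simps)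
  then show ?thesis using finite_nth_roots[OF assms(2)] by simp
qed

lemma aw_genericD:
  assumes "aw_generic a b c d q s" and nz: "a \<noteq> 0" "b \<noteq> 0" "c \<noteq> 0" "d \<noteq> 0"
  shows "s \<noteq> 0" and "n > 0 \<Longrightarrow> q ^ Suc n * s\<^sup>2 \<noteq> a * b * c * d"
proof -
  show "s \<noteq> 0" using assms(1) by (simp add: aw_generic_def)
  assume "n > 0"
  then obtain m where m: "n = Suc m" by (cases n) auto
  have "qpoch (q\<^sup>2 * s\<^sup>2 / (a * b * c * d)) q (Suc m) \<noteq> 0"
    using assms(1) unfolding aw_generic_def by blast
  then have "q ^ m * (q\<^sup>2 * s\<^sup>2 / (a * b * c * d)) \<noteq> 1"
    unfolding qpoch_neq_0_iff by blast
  then show "q ^ Suc n * s\<^sup>2 \<noteq> a * b * c * d"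
    using nz by (auto simp: m power2_eq_square mult_ac)
qed

text \<open>Each coefficient is a finite sum of rational functions of \<open>s\<close>, and
  genericity says precisely that their \<open>s\<close>-dependent denominators do not
  vanish.\<close>

lemma tendsto_aw_series_nth:
  assumes nz: "a \<noteq> 0" "b \<noteq> 0" "c \<noteq> 0" "d \<noteq> 0" "q \<noteq> 0" and q: "norm q < 1" and gen: "aw_generic a b c d q s"
  shows "((\<lambda>s. aw_series a b c d q s $ N) \<longlongrightarrow> aw_series a b c d q s $ N) (at s)"
proof -
  have "norm (q\<^sup>2) < 1" using q by (simp add: norm_power power_less_one_iff)
  then have n: "qpoch q q j \<noteq> 0" "qpoch (q\<^sup>2) (q\<^sup>2) j \<noteq> 0" for j
    using q by (simp_all add: qpoch_self_neq_0)
  have o: "qpoch (q\<^sup>2 * s\<^sup>2 / (a*b*c*d)) q m \<noteq> 0" "qpoch (q * s\<^sup>2 / (a\<^sup>2 * c\<^sup>2)) (q\<^sup>2) m \<noteq> 0"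
      "qpoch (q^(m+2) * s\<^sup>2 / (a*b*c*d)) q j \<noteq> 0" "qpoch (- (q * s) / (a*c)) q j \<noteq> 0"
      "qpoch (q^(2*m+1) * s\<^sup>2 / (a\<^sup>2 * c\<^sup>2)) (q\<^sup>2) j \<noteq> 0" for m j
    using gen unfolding aw_generic_def by blast+
  have e: "qpoch (q^(4*l+2) * (q^r * s)\<^sup>2 / a\<^sup>2) (q\<^sup>2) k \<noteq> 0" "qpoch (q^3 * (q^r * s)\<^sup>2 / (a\<^sup>2 * c\<^sup>2)) (q\<^sup>2) l \<noteq> 0"
        "qpoch (q * (q^r * s) / a\<^sup>2) q (2*l) \<noteq> 0" "qpoch ((q^r * s)\<^sup>2 / a\<^sup>2) (q\<^sup>2) (2*l) \<noteq> 0" for k l r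
    using gen unfolding aw_generic_def by blast+
  have co: "((\<lambda>s. c_o a b c d q m j s) \<longlongrightarrow> c_o a b c d q m j s) (at s)" for m j
    unfolding c_o_def by (intro tendsto_intros) (use nz n o in simp_all)
  have ce: "((\<lambda>s. c_e a c q k l (q ^ r * s)) \<longlongrightarrow> c_e a c q k l (q ^ r * s)) (at s)" for k l r
    unfolding c_e_def by (intro tendsto_intros) (use nz n e in \<open>simp_all del: power_mult_distrib\<close>)
  show ?thesis
    unfolding aw_series_def fps_nth_Abs_fps
    by (intro tendsto_sum) (auto intro!: tendsto_mult co ce)
qed

lemma aw_eigenseries_aw_series:
  assumes nz: "a \<noteq> 0" "b \<noteq> 0" "c \<noteq> 0" "d \<noteq> 0" "q \<noteq> 0" and q: "norm q < 1" and gen: "aw_generic a b c d q s"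
  shows "aw_eigenseries a b c d q s (aw_series a b c d q s)"
proof -
  have "{(k, l, m, n). 2*k + 2*l + m + n = (0::nat)} = {(0, 0, 0, 0)}" by auto
  then have "aw_series a b c d q s $ 0 = c_e a c q 0 0 (q ^ (0 + 0) * s) * c_o a b c d q 0 0 s"
    unfolding aw_series_def fps_nth_Abs_fps by (simp only: sum.empty sum.insert finite.emptyI empty_iff not_False_eq_True prod.case add_0_right)
  also have "\<dots> = 1" by (simp add: c_e_def c_o_def)
  finally have "aw_series a b c d q s $ 0 = 1" .
  moreover have "aw_cleared a b c d q s (aw_series a b c d q s) = 0"
  proof (rule fps_ext)
    fix N
    \<comment> \<open>A generic \<open>s\<close> may be exceptional for
      \<open>aw_cleared_aw_series\<close>, for instance \<open>s = 1\<close>. For fixed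
      \<open>N\<close> the defect \<open>?f\<close> involves finitely many coefficients, so its
      continuity follows termwise.\<close>
    let ?f = "\<lambda>s. aw_cleared a b c d q s (aw_series a b c d q s) $ N"
    let ?L = "\<lambda>k x. \<Union>j. {s. q ^ j * s ^ k = x}"
    have summand: "((\<lambda>t. (A * (t * q ^ i - 1) + B * (inverse t * inverse q ^ i - 1) - (t + P / (q * t) - 1 - P / q) * D) * g t)
        \<longlongrightarrow> (A * (s * q ^ i - 1) + B * (inverse s * inverse q ^ i - 1) - (s + P / (q * s) - 1 - P / q) * D) * g s) (at s)"
      if "(g \<longlongrightarrow> g s) (at s)" for A B D P g i
    proof -
      have "s \<noteq> 0" "q * s \<noteq> 0" using nz aw_genericD(1)[OF gen nz(1-4)] by simp_all
      then show ?thesis by (intro tendsto_intros that)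
    qed
    have cont: "isCont ?f s"
      unfolding isCont_def aw_cleared_def qop_nth aw_eval_def fps_mult_left_const_nth
      by (intro tendsto_sum summand[where g = "\<lambda>t. aw_series a b c d q t $ _"] tendsto_aw_series_nth[OF nz q gen])
    have "countable {s. ?f s \<noteq> 0}"
    proof (rule countable_subset)
      show "{s. ?f s \<noteq> 0} \<subseteq> {0} \<union> ?L 1 1 \<union> ?L 1 (a*c) \<union> ?L 1 (-(a*c)) \<union> ?L 1 (-a\<^sup>2) \<union> ?L 1 (a\<^sup>2)
          \<union> ?L 2 ((a*c)\<^sup>2) \<union> ?L 2 (a\<^sup>2) \<union> ?L 2 1 \<union> ?L 2 (a*b*c*d)" (is "_ \<subseteq> ?C")
      proof
        fix t assume t: "t \<in> {s. ?f s \<noteq> 0}"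
        show "t \<in> ?C"
        proof (rule ccontr)
          assume "t \<notin> ?C"
          then have n: "t \<notin> {0}" "t \<notin> ?L 1 1" "t \<notin> ?L 1 (a*c)" "t \<notin> ?L 1 (-(a*c))" "t \<notin> ?L 1 (-a\<^sup>2)" "t \<notin> ?L 1 (a\<^sup>2)"
            "t \<notin> ?L 2 ((a*c)\<^sup>2)" "t \<notin> ?L 2 (a\<^sup>2)" "t \<notin> ?L 2 1" "t \<notin> ?L 2 (a*b*c*d)"
            unfolding Un_iff de_Morgan_disj by - (elim conjE, assumption)+
          have lev: "q ^ j * t ^ k \<noteq> x" if "t \<notin> ?L k x" for j k x using that by blast
          have "t \<noteq> 0" using n(1) by blast
          from aw_cleared_aw_series[OF nz this q n(2-10)[THEN lev, unfolded power_one_right]]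
          have "aw_cleared a b c d q t (aw_series a b c d q t) = 0" .
          with t show False by (simp only: mem_Collect_eq fps_zero_nth simp_thms)
        qed
      qed
      have L: "countable (?L k x)" if "k > 0" for k x
      proof (rule countable_UN)
        show "countable {s. q ^ j * s ^ k = x}" for j
          using nz that by (intro countable_finite finite_monomial_level) simp_all
      qed simp
      have "countable {0::complex}" by simp
      then show "countable ?C"
        by (intro countable_Un L zero_less_one zero_less_numeral)
    qed
    from isCont_zero_off_countable[OF cont this] show "?f s = 0 $ N"
      by (simp only: fps_zero_nth)
  qed
  ultimately show ?thesis unfolding aw_eigenseries_iff[OF nz(5)] ..
qed

theorem theorem1p5:
  fixes a b c d q s :: complex
  assumes "a \<noteq> 0" and "b \<noteq> 0" and "c \<noteq> 0" and "d \<noteq> 0"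
    and "q \<noteq> 0" and "norm q < 1"
    and "aw_generic a b c d q s"
  shows "(\<exists>!F. aw_eigenseries a b c d q s F) \<and>
    aw_f a b c d q s =
      Abs_fps (\<lambda>N. \<Sum>(k, l, m, n) \<in> {(k, l, m, n). 2*k + 2*l + m + n = N}.
        c_e a c q k l (q^(m+n) * s) * c_o a b c d q m n s)"
proof -
  have ex: "aw_eigenseries a b c d q s (aw_series a b c d q s)"
    by (rule aw_eigenseries_aw_series[OF assms])
  have un: "G = aw_series a b c d q s" if "aw_eigenseries a b c d q s G" for G
  proof (rule aw_cleared_unique[OF assms(5,6)])
    show "s \<noteq> 0" by (rule aw_genericD(1)[OF assms(7,1-4)])
    show "q ^ Suc n * s\<^sup>2 \<noteq> a * b * c * d" if "n > 0" for n
      by (rule aw_genericD(2)[OF assms(7,1-4) that])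
    note iff = aw_eigenseries_iff[OF assms(5), THEN iffD1]
    show "aw_cleared a b c d q s G = 0" "aw_cleared a b c d q s (aw_series a b c d q s) = 0"
      using iff[OF that] iff[OF ex] by blast+
    show "G $ 0 = aw_series a b c d q s $ 0"
      using iff[OF that] iff[OF ex] by argo
  qed
  have "aw_f a b c d q s = aw_series a b c d q s"
    unfolding aw_f_def by (rule the_equality[of "aw_eigenseries a b c d q s", OF ex un])
  moreover have "\<exists>!F. aw_eigenseries a b c d q s F"
    by (rule ex1I[of "aw_eigenseries a b c d q s", OF ex un])
  ultimately show ?thesis
    unfolding aw_series_def by blast
qed

end
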